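(* Let $s\in\overline{\mathbf R_\flat}$, $\boldsymbol r\in\mathbf R^d$, $p\in(0,\infty]$ and let $\omega$ be a weight on $\mathbf R^{2d}$ such that $$\omega(x,\xi)=\omega_0(|z_1|,\dots,|z_d|),\qquad z_j=x_j+i\xi_j\in\mathbf C,\ j=1,\dots,d,$$ for some $\omega_0$. Then the following is true: (1) $\mathscr F_{\boldsymbol r}$ is continuous and bijective on $\mathcal H_s(\mathbf R^d)$, $\mathcal H_{0,s}(\mathbf R^d)$ and $\mathscr S(\mathbf R^d)$, and on their duals; (2) $\mathscr F_{\boldsymbol r}h_\alpha=e^{-i\langle\boldsymbol r,\alpha\rangle\frac\pi2}h_\alpha$ for every $\alpha\in\mathbf N^d$, and $\mathscr F_{\boldsymbol r}\circ H=H\circ\mathscr F_{\boldsymbol r}$ on $\boldsymbol{\mathcal S}_0'(\mathbf R^d)$; (3) $\mathscr F_{\boldsymbol r}$ is isometric and bijective on $M^p_{(\omega)}(\mathbf R^d)$. Moreover, if $N$ is an integer and $f\in\mathcal H_{\flat_1}'(\mathbf R^d)$, then $$\|H^N(\mathscr F_{\boldsymbol r}f)\|_{M^p_{(\omega)}}=\|H^Nf\|_{M^p_{(\omega)}}.$$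
   Context: $\mathscr S(\mathbf R^d)$ is the Schwartz space. $\overline{\mathbf R_\flat}=[0,\infty)\cup\{\flat_\sigma\,;\,\sigma>0\}$ with formal symbols $\flat_\sigma$. Let $h_\alpha(x)=\pi^{-d/4}(-1)^{|\alpha|}(2^{|\alpha|}\alpha!)^{-1/2}e^{|x|^2/2}\partial^\alpha e^{-|x|^2}$ and $e_\alpha(z)=z^\alpha/\sqrt{\alpha!}$, $\alpha\in\mathbf N^d$. $\mathcal H_0'(\mathbf R^d)$ is the Fréchet space of all formal Hermite series $f=\sum_\alpha c_\alpha h_\alpha$, with the topology of coefficientwise convergence, also denoted $\boldsymbol{\mathcal S}_0'(\mathbf R^d)$ (the two are identified). $\mathcal H_0(\mathbf R^d)$ consists of finite such sums (inductive limit topology of the finite-dimensional spaces of sums over $|\alpha|\le N$), and $\mathcal H_{0,0}(\mathbf R^d)=\{0\}$. For $r>0$ let $\vartheta_{r,s}(\alpha)=e^{r|\alpha|^{1/(2s)}}$ for real $s>0$ and $\vartheta_{r,\flat_\sigma}(\alpha)=r^{|\alpha|}(\alpha!)^{1/(2\sigma)}$. For $s\ne0$, $\mathcal H_s$ ($\mathcal H_{0,s}$) consists of the $f$ with $\sup_\alpha|c_\alpha|\vartheta_{r,s}(\alpha)<\infty$ for some (every) $r>0$, with the inductive (projective) limit topology; the duals $\mathcal H_s'$ ($\mathcal H_{0,s}'$) consist of the $f$ with $\sup_\alpha|c_\alpha|/\vartheta_{r,s}(\alpha)<\infty$ for every (some) $r>0$, with the projective (inductive) limit topology. The Bargmann transform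 of $f=\sum c_\alpha h_\alpha\in\mathcal H_0'(\mathbf R^d)$ is the formal power series $\mathfrak V_df=\sum c_\alpha e_\alpha$ (an entire function when $f\in\mathcal H_{\flat_1}'$). The partial fractional Fourier transform is $\mathscr F_{\boldsymbol r}=\mathfrak V_d^{-1}\circ T_{\boldsymbol r}\circ\mathfrak V_d$ where $(T_{\boldsymbol r}F)(z)=F(e^{-ir_1\frac\pi2}z_1,\dots,e^{-ir_d\frac\pi2}z_d)$, $\boldsymbol r=(r_1,\dots,r_d)$. $H=|x|^2-\Delta$; it acts on Hermite series by $Hh_\alpha=(2|\alpha|+d)h_\alpha$, so $H^N$ is defined on $\mathcal H_0'(\mathbf R^d)$ for every integer $N$. A weight on $\mathbf R^{2d}$ is a positive function $\omega$ with $\omega,1/\omega\in L^\infty_{loc}(\mathbf R^{2d})$. $M^p_{(\omega)}(\mathbf R^d)$ is the set of $f\in\mathcal H_{\flat_1}'(\mathbf R^d)$ with $\|f\|_{M^p_{(\omega)}}=\|V_\phi f\cdot\omega\|_{L^p(\mathbf R^{2d})}<\infty$, where $\phi(x)=\pi^{-d/4}e^{-|x|^2/2}$ and $V_\phi f(x,\xi)=(2\pi)^{-d/2}e^{-\frac14(|x|^2+|\xi|^2)}e^{-i\langle x,\xi\rangle/2}(\mathfrak V_df)(2^{-1/2}(x-i\xi))$ (for $f\in L^2$ this is the usual short-time Fourier transform $(2\pi)^{-d/2}\int f(y)\overline{\phi(y-x)}e^{-i\langle y,\xi\rangle}dy$). The norm is $\infty$ when $f\notin M^p_{(\omega)}$.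 *)

theory Defs
  imports "HOL-Analysis.Analysis" "HOL-Probability.Essential_Supremum"
begin

text \<open>
  The dimension is \<open>d = CARD('d)\<close>; multi-indices are vectors \<open>\<alpha> :: nat ^ 'd\<close>.  A formal Hermite series
  \<open>\<Sum>\<^sub>\<alpha> c\<^sub>\<alpha> h\<^sub>\<alpha>\<close> is represented by its coefficient family \<open>c\<close>, and a formal power series
  \<open>\<Sum>\<^sub>\<alpha> a\<^sub>\<alpha> z\<^sup>\<alpha>\<close> by its family \<open>a\<close> of coefficients with respect to the monomials \<open>z\<^sup>\<alpha>\<close>.
\<close>

type_synonym 'd hermite_series = "(nat, 'd) vec \<Rightarrow> complex"
type_synonym 'd power_series = "(nat, 'd) vec \<Rightarrow> complex"

section \<open>Multi-indices\<close>

definition mdeg :: "nat ^ 'd \<Rightarrow> nat" where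
  "mdeg \<alpha> = (\<Sum>j\<in>UNIV. \<alpha> $ j)"

definition mfact :: "nat ^ 'd \<Rightarrow> real" where
  "mfact \<alpha> = (\<Prod>j\<in>UNIV. fact (\<alpha> $ j))"

definition mpow :: "'a::comm_monoid_mult ^ 'd \<Rightarrow> nat ^ 'd \<Rightarrow> 'a" where
  "mpow z \<alpha> = (\<Prod>j\<in>UNIV. (z $ j) ^ (\<alpha> $ j))"


section \<open>Topologies given by seminorms\<close>

definition seminorm_on :: "('i \<Rightarrow> complex) set \<Rightarrow> (('i \<Rightarrow> complex) \<Rightarrow> real) \<Rightarrow> bool" where
  "seminorm_on X q \<longleftrightarrow>
     (\<forall>f\<in>X. \<forall>g\<in>X. q (\<lambda>i. f i + g i) \<le> q f + q g) \<and>
     (\<forall>f\<in>X. \<forall>a. q (\<lambda>i. a * f i) = cmod a * q f)"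

text \<open>The locally convex topology on the linear space \<open>X\<close> generated by the seminorms in \<open>P\<close>.\<close>

definition seminorm_topology ::
    "('i \<Rightarrow> complex) set \<Rightarrow> (('i \<Rightarrow> complex) \<Rightarrow> real) set \<Rightarrow> ('i \<Rightarrow> complex) topology" where
  "seminorm_topology X P = topology (\<lambda>U. U \<subseteq> X \<and>
     (\<forall>f\<in>U. \<exists>Q \<epsilon>. finite Q \<and> Q \<subseteq> P \<and> 0 < \<epsilon> \<and>
        (\<forall>g\<in>X. (\<forall>q\<in>Q. q (\<lambda>i. g i - f i) < \<epsilon>) \<longrightarrow> g \<in> U)))"

lemma openin_seminorm_topology:
  "openin (seminorm_topology X P) U \<longleftrightarrow> U \<subseteq> X \<and>
     (\<forall>f\<in>U. \<exists>Q \<epsilon>. finite Q \<and> Q \<subseteq> P \<and> 0 < \<epsilon> \<and>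
        (\<forall>g\<in>X. (\<forall>q\<in>Q. q (\<lambda>i. g i - f i) < \<epsilon>) \<longrightarrow> g \<in> U))"
proof -
  define nb where "nb f U \<longleftrightarrow> (\<exists>Q \<epsilon>. finite Q \<and> Q \<subseteq> P \<and> 0 < \<epsilon> \<and>
        (\<forall>g\<in>X. (\<forall>q\<in>Q. q (\<lambda>i. g i - f i) < \<epsilon>) \<longrightarrow> g \<in> U))" for f U
  have mono: "nb f V" if "nb f U" "U \<subseteq> V" for f U V
    using that unfolding nb_def by (meson subsetD)
  have inter: "nb f (U \<inter> V)" if U: "nb f U" and V: "nb f V" for f U V
  proof -
    obtain Q \<epsilon> where 1: "finite Q" "Q \<subseteq> P" "0 < \<epsilon>"
        "\<forall>g\<in>X. (\<forall>q\<in>Q. q (\<lambda>i. g i - f i) < \<epsilon>) \<longrightarrow> g \<in> U"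
      using U unfolding nb_def by auto
    obtain R \<delta> where 2: "finite R" "R \<subseteq> P" "0 < \<delta>"
        "\<forall>g\<in>X. (\<forall>q\<in>R. q (\<lambda>i. g i - f i) < \<delta>) \<longrightarrow> g \<in> V"
      using V unfolding nb_def by auto
    show ?thesis
      unfolding nb_def using 1 2
      by (intro exI[of _ "Q \<union> R"] exI[of _ "min \<epsilon> \<delta>"]) simp
  qed
  have "istopology (\<lambda>U. U \<subseteq> X \<and> (\<forall>f\<in>U. nb f U))"
    unfolding istopology_def
  proof (intro conjI allI impI)
    fix U V assume "U \<subseteq> X \<and> (\<forall>f\<in>U. nb f U)" "V \<subseteq> X \<and> (\<forall>f\<in>V. nb f V)"
    then show "U \<inter> V \<subseteq> X" "\<forall>f\<in>U \<inter> V. nb f (U \<inter> V)"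
      using inter by auto
  next
    fix \<K> assume "\<forall>K\<in>\<K>. K \<subseteq> X \<and> (\<forall>f\<in>K. nb f K)"
    then show "\<Union>\<K> \<subseteq> X" "\<forall>f\<in>\<Union>\<K>. nb f (\<Union>\<K>)"
      using mono by (blast, meson Union_iff Union_upper)
  qed
  then show ?thesis
    unfolding seminorm_topology_def nb_def by (simp add: topology_inverse')
qed

lemma topspace_seminorm_topology [simp]: "topspace (seminorm_topology X P) = X"
proof
  show "topspace (seminorm_topology X P) \<subseteq> X"
    by (meson openin_seminorm_topology openin_topspace)
  have "openin (seminorm_topology X P) X"
    unfolding openin_seminorm_topology by (auto intro!: exI[of _ "{}"] exI[of _ "1::real"])
  then show "X \<subseteq> topspace (seminorm_topology X P)"
    by (rule openin_subset)
qed

text \<open>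
  Limits of a family of normed spaces \<open>(E j, n j)\<close>, \<open>j \<in> J\<close>.  The inductive limit is taken in the category
  of locally convex spaces: it carries the finest locally convex topology for which all the
  inclusions are continuous, that is, the one generated by all seminorms whose restriction to each
  step \<open>E j\<close> is continuous.
\<close>

definition proj_limit_topology ::
    "'j set \<Rightarrow> ('j \<Rightarrow> ('i \<Rightarrow> complex) set) \<Rightarrow> ('j \<Rightarrow> ('i \<Rightarrow> complex) \<Rightarrow> real) \<Rightarrow> ('i \<Rightarrow> complex) topology" where
  "proj_limit_topology J E n = seminorm_topology (\<Inter>j\<in>J. E j) (n ` J)"

definition ind_limit_topology ::
    "'j set \<Rightarrow> ('j \<Rightarrow> ('i \<Rightarrow> complex) set) \<Rightarrow> ('j \<Rightarrow> ('i \<Rightarrow> complex) \<Rightarrow> real) \<Rightarrow> ('i \<Rightarrow> complex) topology" where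
  "ind_limit_topology J E n = seminorm_topology (\<Union>j\<in>J. E j)
     {q. seminorm_on (\<Union>j\<in>J. E j) q \<and> (\<forall>j\<in>J. \<exists>C. \<forall>f\<in>E j. q f \<le> C * n j f)}"

text \<open>
  The image of a topological space under an identification \<open>e\<close> of its points with other objects.
  When \<open>e\<close> is injective, this makes \<open>e\<close> a homeomorphism onto its image.
\<close>

definition transport_topology :: "('a \<Rightarrow> 'b) \<Rightarrow> 'a topology \<Rightarrow> 'b topology" where
  "transport_topology e T =
     topology (\<lambda>V. V \<subseteq> e ` topspace T \<and> openin T {x \<in> topspace T. e x \<in> V})"

lemma openin_transport_topology:
  "openin (transport_topology e T) V \<longleftrightarrow> V \<subseteq> e ` topspace T \<and> openin T {x \<in> topspace T. e x \<in> V}"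
proof -
  have "istopology (\<lambda>V. V \<subseteq> e ` topspace T \<and> openin T {x \<in> topspace T. e x \<in> V})"
    unfolding istopology_def
  proof (intro conjI allI impI)
    fix U V
    assume U: "U \<subseteq> e ` topspace T \<and> openin T {x \<in> topspace T. e x \<in> U}"
      and V: "V \<subseteq> e ` topspace T \<and> openin T {x \<in> topspace T. e x \<in> V}"
    show "U \<inter> V \<subseteq> e ` topspace T" using U by blast
    have "{x \<in> topspace T. e x \<in> U \<inter> V} =
        {x \<in> topspace T. e x \<in> U} \<inter> {x \<in> topspace T. e x \<in> V}" by blast
    then show "openin T {x \<in> topspace T. e x \<in> U \<inter> V}" using U V by auto
  next
    fix \<K> assume K: "\<forall>K\<in>\<K>. K \<subseteq> e ` topspace T \<and> openin T {x \<in> topspace T. e x \<in> K}"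
    show "\<Union>\<K> \<subseteq> e ` topspace T" using K by blast
    have "{x \<in> topspace T. e x \<in> \<Union>\<K>} = \<Union> ((\<lambda>K. {x \<in> topspace T. e x \<in> K}) ` \<K>)" by blast
    then show "openin T {x \<in> topspace T. e x \<in> \<Union>\<K>}" using K by auto
  qed
  then show ?thesis
    unfolding transport_topology_def by (simp add: topology_inverse')
qed

lemma topspace_transport_topology [simp]: "topspace (transport_topology e T) = e ` topspace T"
proof
  show "topspace (transport_topology e T) \<subseteq> e ` topspace T"
    by (meson openin_transport_topology openin_topspace)
  have "{x \<in> topspace T. e x \<in> e ` topspace T} = topspace T" by blast
  then have "openin (transport_topology e T) (e ` topspace T)"
    by (simp add: openin_transport_topology)
  then show "e ` topspace T \<subseteq> topspace (transport_topology e T)"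
    by (rule openin_subset)
qed

definition continuous_bijective :: "'a topology \<Rightarrow> ('a \<Rightarrow> 'a) \<Rightarrow> bool" where
  "continuous_bijective T F \<longleftrightarrow> continuous_map T T F \<and> bij_betw F (topspace T) (topspace T)"


section \<open>Pilipovic spaces\<close>

text \<open>\<open>Ord s\<close> is the real number \<open>s\<close> and \<open>Flat \<sigma>\<close> the formal symbol with index \<open>\<sigma>\<close>.\<close>

datatype flat_real = Ord real | Flat real

definition extended_flat_reals :: "flat_real set" where
  "extended_flat_reals = Ord ` {0..} \<union> Flat ` {0<..}"

text \<open>Only used for indices different from \<open>Ord 0\<close>.\<close>

fun vartheta :: "real \<Rightarrow> flat_real \<Rightarrow> nat ^ 'd \<Rightarrow> real" where
  "vartheta r (Ord s) \<alpha> = exp (r * real (mdeg \<alpha>) powr (1 / (2 * s)))"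
| "vartheta r (Flat \<sigma>) \<alpha> = r ^ mdeg \<alpha> * mfact \<alpha> powr (1 / (2 * \<sigma>))"

definition weighted_space :: "(nat ^ 'd \<Rightarrow> real) \<Rightarrow> 'd hermite_series set" where
  "weighted_space w = {c. bdd_above (range (\<lambda>\<alpha>. cmod (c \<alpha>) * w \<alpha>))}"

definition weighted_norm :: "(nat ^ 'd \<Rightarrow> real) \<Rightarrow> 'd hermite_series \<Rightarrow> real" where
  "weighted_norm w c = (SUP \<alpha>. cmod (c \<alpha>) * w \<alpha>)"

definition Hs_top :: "flat_real \<Rightarrow> 'd::finite hermite_series topology" where
  "Hs_top s =
     (if s = Ord 0
      then ind_limit_topology UNIV (\<lambda>N::nat. {c. \<forall>\<alpha>. N < mdeg \<alpha> \<longrightarrow> c \<alpha> = 0}) (\<lambda>_. weighted_norm (\<lambda>_. 1))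
      else ind_limit_topology {0<..}
             (\<lambda>r. weighted_space (vartheta r s)) (\<lambda>r. weighted_norm (vartheta r s)))"

definition H0s_top :: "flat_real \<Rightarrow> 'd::finite hermite_series topology" where
  "H0s_top s =
     (if s = Ord 0
      then discrete_topology {\<lambda>_. 0}
      else proj_limit_topology {0<..}
             (\<lambda>r. weighted_space (vartheta r s)) (\<lambda>r. weighted_norm (vartheta r s)))"

definition Hs_dual_top :: "flat_real \<Rightarrow> 'd::finite hermite_series topology" where
  "Hs_dual_top s =
     (if s = Ord 0
      then product_topology (\<lambda>_. euclidean) UNIV
      else proj_limit_topology {0<..}
             (\<lambda>r. weighted_space (\<lambda>\<alpha>. 1 / vartheta r s \<alpha>)) (\<lambda>r. weighted_norm (\<lambda>\<alpha>. 1 / vartheta r s \<alpha>)))"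

text \<open>For \<open>s = Ord 0\<close> this is the dual of the trivial space \<open>{0}\<close>.\<close>

definition H0s_dual_top :: "flat_real \<Rightarrow> 'd::finite hermite_series topology" where
  "H0s_dual_top s =
     (if s = Ord 0
      then discrete_topology {\<lambda>_. 0}
      else ind_limit_topology {0<..}
             (\<lambda>r. weighted_space (\<lambda>\<alpha>. 1 / vartheta r s \<alpha>)) (\<lambda>r. weighted_norm (\<lambda>\<alpha>. 1 / vartheta r s \<alpha>)))"

abbreviation H_flat1_dual :: "'d::finite hermite_series set" where
  "H_flat1_dual \<equiv> topspace (Hs_dual_top (Flat 1))"


section \<open>Schwartz functions and tempered distributions\<close>

definition partial_deriv :: "'d \<Rightarrow> (real ^ 'd \<Rightarrow> 'b::real_normed_vector) \<Rightarrow> real ^ 'd \<Rightarrow> 'b" where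
  "partial_deriv j f x = frechet_derivative f (at x) (axis j 1)"

primrec partial_derivs :: "'d list \<Rightarrow> (real ^ 'd \<Rightarrow> 'b::real_normed_vector) \<Rightarrow> real ^ 'd \<Rightarrow> 'b" where
  "partial_derivs [] f = f"
| "partial_derivs (j # js) f = partial_deriv j (partial_derivs js f)"

text \<open>
  \<open>\<partial>\<^sup>\<alpha>\<close> differentiates \<open>\<alpha> $ j\<close> times in direction \<open>j\<close>.  The index type carries no order, so the order of
  differentiation is left to choice; for smooth functions it is irrelevant.
\<close>

definition multi_deriv :: "nat ^ 'd \<Rightarrow> (real ^ 'd \<Rightarrow> 'b::real_normed_vector) \<Rightarrow> real ^ 'd \<Rightarrow> 'b" where
  "multi_deriv \<alpha> f = partial_derivs (SOME js. \<forall>j. count_list js j = \<alpha> $ j) f"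

text \<open>All iterated partial derivatives exist and are differentiable everywhere, hence also continuous.\<close>

definition smooth :: "(real ^ 'd \<Rightarrow> 'b::real_normed_vector) \<Rightarrow> bool" where
  "smooth f \<longleftrightarrow> (\<forall>js x. partial_derivs js f differentiable (at x))"

definition schwartz :: "(real ^ 'd \<Rightarrow> complex) set" where
  "schwartz = {f. smooth f \<and> (\<forall>\<beta> js. bdd_above (range (\<lambda>x. cmod (of_real (mpow x \<beta>) * partial_derivs js f x))))}"

definition schwartz_seminorm :: "nat ^ 'd \<Rightarrow> 'd list \<Rightarrow> (real ^ 'd \<Rightarrow> complex) \<Rightarrow> real" where
  "schwartz_seminorm \<beta> js f = (SUP x. cmod (of_real (mpow x \<beta>) * partial_derivs js f x))"

definition schwartz_top :: "(real ^ 'd::finite \<Rightarrow> complex) topology" where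
  "schwartz_top = seminorm_topology schwartz {schwartz_seminorm \<beta> js |\<beta> js. True}"

text \<open>
  Continuous linear forms on the Schwartz space.  Functions in HOL are total, so a form is
  normalised to be \<open>0\<close> outside the Schwartz space.
\<close>

definition tempered :: "((real ^ 'd::finite \<Rightarrow> complex) \<Rightarrow> complex) set" where
  "tempered = {u.
     (\<forall>f\<in>schwartz. \<forall>g\<in>schwartz. \<forall>a b. u (\<lambda>x. a * f x + b * g x) = a * u f + b * u g) \<and>
     continuous_map schwartz_top euclidean u \<and>
     (\<forall>f. f \<notin> schwartz \<longrightarrow> u f = 0)}"

definition schwartz_bounded :: "(real ^ 'd \<Rightarrow> complex) set \<Rightarrow> bool" where
  "schwartz_bounded B \<longleftrightarrow> B \<subseteq> schwartz \<and> (\<forall>\<beta> js. bdd_above (schwartz_seminorm \<beta> js ` B))"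

definition tempered_strong_top :: "((real ^ 'd::finite \<Rightarrow> complex) \<Rightarrow> complex) topology" where
  "tempered_strong_top =
     seminorm_topology tempered {(\<lambda>u. SUP f\<in>B. cmod (u f)) |B. schwartz_bounded B \<and> B \<noteq> {}}"

definition tempered_weak_top :: "((real ^ 'd::finite \<Rightarrow> complex) \<Rightarrow> complex) topology" where
  "tempered_weak_top = seminorm_topology tempered {(\<lambda>u. cmod (u f)) |f. f \<in> schwartz}"


section \<open>Hermite functions and Hermite expansions\<close>

definition hermite_fun :: "nat ^ 'd::finite \<Rightarrow> real ^ 'd \<Rightarrow> real" where
  "hermite_fun \<alpha> x =
     pi powr (- real CARD('d) / 4) * (-1) ^ mdeg \<alpha> * (2 ^ mdeg \<alpha> * mfact \<alpha>) powr (- 1 / 2) *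
     exp ((norm x)\<^sup>2 / 2) * multi_deriv \<alpha> (\<lambda>y. exp (- (norm y)\<^sup>2)) x"

abbreviation chermite_fun :: "nat ^ 'd::finite \<Rightarrow> real ^ 'd \<Rightarrow> complex" where
  "chermite_fun \<alpha> \<equiv> \<lambda>x. complex_of_real (hermite_fun \<alpha> x)"

text \<open>The formal Hermite series consisting of the single term \<open>h\<^sub>\<alpha>\<close>.\<close>

definition hermite_term :: "nat ^ 'd \<Rightarrow> 'd hermite_series" where
  "hermite_term \<alpha> = (\<lambda>\<beta>. if \<beta> = \<alpha> then 1 else 0)"

text \<open>
  Schwartz functions and tempered distributions are identified with their Hermite series.
  The Hermite functions are a real orthonormal basis of \<open>L\<^sup>2\<close> whose span is dense in the Schwartz
  space, so both identifications are injective.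
\<close>

definition hermite_coeffs :: "(real ^ 'd::finite \<Rightarrow> complex) \<Rightarrow> 'd hermite_series" where
  "hermite_coeffs f \<alpha> = (LINT x|lborel. f x * chermite_fun \<alpha> x)"

definition tempered_coeffs :: "((real ^ 'd::finite \<Rightarrow> complex) \<Rightarrow> complex) \<Rightarrow> 'd hermite_series" where
  "tempered_coeffs u \<alpha> = u (chermite_fun \<alpha>)"

definition S_top :: "'d::finite hermite_series topology" where
  "S_top = transport_topology hermite_coeffs schwartz_top"

definition S_dual_strong_top :: "'d::finite hermite_series topology" where
  "S_dual_strong_top = transport_topology tempered_coeffs tempered_strong_top"

definition S_dual_weak_top :: "'d::finite hermite_series topology" where
  "S_dual_weak_top = transport_topology tempered_coeffs tempered_weak_top"


section \<open>Bargmann transform, fractional Fourier transform, harmonic oscillator\<close>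

text \<open>\<open>c\<^sub>\<alpha> e\<^sub>\<alpha>(z) = c\<^sub>\<alpha> / sqrt (\<alpha>!) z\<^sup>\<alpha>\<close>\<close>

definition bargmann :: "'d::finite hermite_series \<Rightarrow> 'd power_series" where
  "bargmann c = (\<lambda>\<alpha>. c \<alpha> / of_real (sqrt (mfact \<alpha>)))"

definition eval_power_series :: "'d::finite power_series \<Rightarrow> complex ^ 'd \<Rightarrow> complex" where
  "eval_power_series a z = (\<Sum>\<^sub>\<infinity>\<alpha>. a \<alpha> * mpow z \<alpha>)"

text \<open>The formal substitution \<open>F(w\<^sub>1 z\<^sub>1, \<dots>, w\<^sub>d z\<^sub>d)\<close>.\<close>

definition scale_power_series :: "complex ^ 'd::finite \<Rightarrow> 'd power_series \<Rightarrow> 'd power_series" where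
  "scale_power_series w a = (\<lambda>\<alpha>. a \<alpha> * mpow w \<alpha>)"

definition rotate_power_series :: "real ^ 'd::finite \<Rightarrow> 'd power_series \<Rightarrow> 'd power_series" where
  "rotate_power_series r = scale_power_series (\<chi> j. exp (- \<i> * of_real (r $ j) * of_real (pi / 2)))"

definition frac_fourier :: "real ^ 'd::finite \<Rightarrow> 'd hermite_series \<Rightarrow> 'd hermite_series" where
  "frac_fourier r = inv bargmann \<circ> rotate_power_series r \<circ> bargmann"

definition harmonic_osc :: "'d::finite hermite_series \<Rightarrow> 'd hermite_series" where
  "harmonic_osc c = (\<lambda>\<alpha>. of_nat (2 * mdeg \<alpha> + CARD('d)) * c \<alpha>)"

definition harmonic_osc_pow :: "int \<Rightarrow> 'd::finite hermite_series \<Rightarrow> 'd hermite_series" where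
  "harmonic_osc_pow N = (if 0 \<le> N then harmonic_osc ^^ nat N else inv harmonic_osc ^^ nat (- N))"


section \<open>Modulation spaces\<close>

text \<open>Local essential boundedness is with respect to Lebesgue measure, tested on compact sets.\<close>

definition Linf_loc :: "('a::euclidean_space \<Rightarrow> real) \<Rightarrow> bool" where
  "Linf_loc w \<longleftrightarrow> w \<in> borel_measurable lebesgue \<and>
     (\<forall>K. compact K \<longrightarrow> (\<exists>C. AE X in lebesgue. X \<in> K \<longrightarrow> \<bar>w X\<bar> \<le> C))"

definition weight_fun :: "((real ^ 'd) \<times> (real ^ 'd) \<Rightarrow> real) \<Rightarrow> bool" where
  "weight_fun \<omega> \<longleftrightarrow> (\<forall>X. 0 < \<omega> X) \<and> Linf_loc \<omega> \<and> Linf_loc (\<lambda>X. 1 / \<omega> X)"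

text \<open>The short-time Fourier transform with the standard Gaussian window, for \<open>f \<in> H_flat1_dual\<close>.\<close>

definition stft :: "'d::finite hermite_series \<Rightarrow> (real ^ 'd) \<times> (real ^ 'd) \<Rightarrow> complex" where
  "stft f = (\<lambda>(x, \<xi>).
     of_real ((2 * pi) powr (- real CARD('d) / 2) * exp (- ((norm x)\<^sup>2 + (norm \<xi>)\<^sup>2) / 4)) *
     exp (- \<i> * of_real (x \<bullet> \<xi>) / 2) *
     eval_power_series (bargmann f) (\<chi> j. (of_real (x $ j) - \<i> * of_real (\<xi> $ j)) / of_real (sqrt 2)))"

definition Lp_qnorm :: "ennreal \<Rightarrow> ('a::euclidean_space \<Rightarrow> complex) \<Rightarrow> ennreal" where
  "Lp_qnorm p g =
     (if p = \<infinity> then esssup lebesgue (\<lambda>X. ennreal (cmod (g X)))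
      else let I = (\<integral>\<^sup>+ X. ennreal (cmod (g X) powr enn2real p) \<partial>lebesgue)
           in if I = \<infinity> then \<infinity> else ennreal (enn2real I powr (1 / enn2real p)))"

text \<open>
  The quasi-norm is \<open>\<infinity>\<close> outside the space \<open>H_flat1_dual\<close>, where the short-time Fourier transform
  is not defined.
\<close>

definition mod_qnorm ::
    "ennreal \<Rightarrow> ((real ^ 'd) \<times> (real ^ 'd) \<Rightarrow> real) \<Rightarrow> 'd::finite hermite_series \<Rightarrow> ennreal" where
  "mod_qnorm p \<omega> f = (if f \<in> H_flat1_dual then Lp_qnorm p (\<lambda>X. stft f X * of_real (\<omega> X)) else \<infinity>)"

definition mod_space ::
    "ennreal \<Rightarrow> ((real ^ 'd) \<times> (real ^ 'd) \<Rightarrow> real) \<Rightarrow> 'd::finite hermite_series set" where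
  "mod_space p \<omega> = {f \<in> H_flat1_dual. mod_qnorm p \<omega> f < \<infinity>}"

end

theory Submission
  imports Defs "HOL-Probability.Distributions" "HOL-Probability.Sinc_Integral"
begin

text \<open>
  On Hermite coefficients the partial fractional Fourier transform multiplies \<open>c\<^sub>\<alpha>\<close> by the unimodular number
  \<open>exp (- i \<langle>r, \<alpha>\<rangle> \<pi> / 2)\<close> (lemma \<open>frac_fourier_eq\<close>), and its inverse is the transform for \<open>- r\<close>.  Everything that
  only sees the moduli of the coefficients is therefore preserved, in particular the weighted norms that define the
  Pilipovic spaces and their duals.  Being diagonal, the transform commutes with \<open>H\<close> and all its powers.

  For the modulation spaces, the transform composes the Bargmann transform with a rotation in each complex
  variable.  Up to a unimodular factor this composes the short-time Fourier transform with a rotation of phase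
  space that preserves all \<open>|z\<^sub>j|\<close>, hence the Gaussian factor and the weight.  Such a rotation preserves Lebesgue
  measure because it is a product of shears (\<open>distr_phase_rotation\<close>), so the quasi-norms agree.

  The Schwartz space is the substantial part, since its topology is given by seminorms of functions and not of
  coefficients.  The transform is realised there as \<open>f \<mapsto> \<Sum> exp (- i \<langle>r, \<alpha>\<rangle> \<pi> / 2) \<langle>f, h\<^sub>\<alpha>\<rangle> h\<^sub>\<alpha>\<close>, and
  three facts show that this is a well-defined continuous operator with the right coefficients.  First, every Schwartz
  seminorm of \<open>h\<^sub>\<alpha>\<close> grows at most polynomially in \<open>|\<alpha>|\<close> (\<open>hermite_fun_poly_bound\<close>): a one-dimensional Sobolev
  inequality bounds the supremum, and the ladder relations reduce derivatives and polynomial factors to it.  Second,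
  the coefficients of a Schwartz function decay faster than any power of \<open>|\<alpha>|\<close>, with bounds by Schwartz seminorms
  (\<open>hermite_coeffs_rapid_decay\<close>): integration by parts moves powers of the harmonic oscillator onto the function.
  Third, the Hermite functions are orthonormal (\<open>hermite_coeffs_chermite_fun\<close>), so the series has the prescribed
  coefficients.  The space of tempered distributions follows by transposition.

  The topologies on coefficient families are transported from the function spaces.  It is therefore enough to lift
  the diagonal operator to a continuous operator upstairs, and bijectivity follows from the lift for \<open>- r\<close>.
\<close>


section \<open>The fractional Fourier transform as a diagonal operator\<close>

definition phase :: "real ^ 'd::finite \<Rightarrow> nat ^ 'd \<Rightarrow> complex" where
  "phase r \<alpha> = exp (- \<i> * of_real (\<Sum>j\<in>UNIV. r $ j * real (\<alpha> $ j)) * of_real (pi / 2))"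

lemma norm_phase [simp]: "cmod (phase r \<alpha>) = 1"
proof -
  have "- \<i> * of_real (\<Sum>j\<in>UNIV. r $ j * real (\<alpha> $ j)) * of_real (pi / 2) =
      \<i> * of_real (- (\<Sum>j\<in>UNIV. r $ j * real (\<alpha> $ j)) * (pi / 2))"
    by simp
  then show ?thesis unfolding phase_def by (metis norm_exp_i_times)
qed

lemma phase_uminus_mult [simp]: "phase (- r) \<alpha> * (phase r \<alpha> * z) = z" "phase r \<alpha> * (phase (- r) \<alpha> * z) = z"
proof -
  have "phase (- r) \<alpha> * phase r \<alpha> = 1"
    unfolding phase_def exp_add[symmetric] by (simp add: sum_negf)
  then show "phase (- r) \<alpha> * (phase r \<alpha> * z) = z" "phase r \<alpha> * (phase (- r) \<alpha> * z) = z"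
    by (simp_all add: mult.assoc[symmetric]) (simp add: mult.commute)
qed

lemma mpow_rotation:
  "mpow (\<chi> j. exp (- \<i> * of_real (r $ j) * of_real (pi / 2))) \<alpha> = phase r \<alpha>"
proof -
  have "mpow (\<chi> j. exp (- \<i> * of_real (r $ j) * of_real (pi / 2))) \<alpha> =
      (\<Prod>j\<in>UNIV. exp (of_nat (\<alpha> $ j) * (- \<i> * of_real (r $ j) * of_real (pi / 2))))"
    by (simp only: mpow_def vec_lambda_beta exp_of_nat_mult)
  also have "\<dots> = exp (\<Sum>j\<in>UNIV. of_nat (\<alpha> $ j) * (- \<i> * of_real (r $ j) * of_real (pi / 2)))"
    by (simp add: exp_sum)
  also have "(\<Sum>j\<in>UNIV. of_nat (\<alpha> $ j) * (- \<i> * of_real (r $ j) * of_real (pi / 2))) =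
      - \<i> * of_real (\<Sum>j\<in>UNIV. r $ j * real (\<alpha> $ j)) * of_real (pi / 2)"
    by (simp add: sum_distrib_left sum_distrib_right sum_negf mult_ac)
  finally show ?thesis by (simp add: phase_def)
qed

lemma mfact_pos: "0 < mfact \<alpha>"
  by (auto simp: mfact_def intro!: prod_pos)

lemma inj_bargmann: "inj bargmann"
proof (rule injI)
  fix c c' :: "'a hermite_series" assume "bargmann c = bargmann c'"
  then have "bargmann c \<alpha> = bargmann c' \<alpha>" for \<alpha> by simp
  moreover have "mfact \<alpha> \<noteq> 0" for \<alpha> :: "nat ^ 'a" using mfact_pos[of \<alpha>] by simp
  ultimately show "c = c'" by (auto simp: bargmann_def fun_eq_iff)
qed

lemma frac_fourier_eq: "frac_fourier r c = (\<lambda>\<alpha>. phase r \<alpha> * c \<alpha>)"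
proof -
  have "(rotate_power_series r \<circ> bargmann) c = bargmann (\<lambda>\<alpha>. phase r \<alpha> * c \<alpha>)"
    unfolding rotate_power_series_def scale_power_series_def mpow_rotation
    by (simp add: bargmann_def mult_ac)
  then show ?thesis
    using inj_bargmann by (simp add: frac_fourier_def inv_f_f[OF inj_bargmann])
qed

lemma frac_fourier_uminus [simp]:
  "frac_fourier (- r) (frac_fourier r c) = c" "frac_fourier r (frac_fourier (- r) c) = c"
  by (simp_all add: frac_fourier_eq)

text \<open>
  Additivity in the form in which seminorm topologies use it, since their neighbourhoods are described by
  differences.
\<close>

lemma frac_fourier_diff:
  "(\<lambda>\<alpha>. frac_fourier r g \<alpha> - frac_fourier r f \<alpha>) = frac_fourier r (\<lambda>\<alpha>. g \<alpha> - f \<alpha>)"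
  by (simp add: frac_fourier_eq algebra_simps)

text \<open>
  Invariance for every \<open>r\<close> suffices: the transforms for \<open>r\<close> and \<open>- r\<close> are inverse to each other.
\<close>

lemma bij_betw_frac_fourier:
  assumes "\<And>r c. c \<in> A \<Longrightarrow> frac_fourier r c \<in> A"
  shows "bij_betw (frac_fourier r) A A"
  by (rule bij_betw_byWitness[where f' = "frac_fourier (- r)"]) (use assms in auto)

section \<open>Continuity for topologies given by seminorms\<close>

text \<open>
  The \<open>\<epsilon>\<close>-\<open>\<delta>\<close> criterion, uniform in the base point as is natural for linear maps.
\<close>

lemma continuous_map_seminorm_topology:
  assumes F: "\<And>f. f \<in> X \<Longrightarrow> F f \<in> Y"
    and cont: "\<And>q \<epsilon>. q \<in> P' \<Longrightarrow> 0 < \<epsilon> \<Longrightarrow> \<exists>Q \<delta>. finite Q \<and> Q \<subseteq> P \<and> 0 < \<delta> \<and>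
      (\<forall>f\<in>X. \<forall>g\<in>X. (\<forall>p\<in>Q. p (\<lambda>i. g i - f i) < \<delta>) \<longrightarrow> q (\<lambda>i. F g i - F f i) < \<epsilon>)"
  shows "continuous_map (seminorm_topology X P) (seminorm_topology Y P') F"
  unfolding continuous_map
proof (intro conjI allI impI)
  show "F ` topspace (seminorm_topology X P) \<subseteq> topspace (seminorm_topology Y P')"
    using F by auto
next
  fix U assume U: "openin (seminorm_topology Y P') U"
  show "openin (seminorm_topology X P) {f \<in> topspace (seminorm_topology X P). F f \<in> U}"
    unfolding openin_seminorm_topology
  proof (intro conjI ballI)
    show "{f \<in> topspace (seminorm_topology X P). F f \<in> U} \<subseteq> X" by auto
    fix f assume "f \<in> {f \<in> topspace (seminorm_topology X P). F f \<in> U}"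
    then have f: "f \<in> X" "F f \<in> U" by auto
    have "\<exists>Q \<epsilon>. finite Q \<and> Q \<subseteq> P' \<and> 0 < \<epsilon> \<and>
        (\<forall>g\<in>Y. (\<forall>q\<in>Q. q (\<lambda>i. g i - F f i) < \<epsilon>) \<longrightarrow> g \<in> U)"
      using U f(2) unfolding openin_seminorm_topology by (elim conjE) (erule bspec)
    then obtain Q \<epsilon> where Q: "finite Q" "Q \<subseteq> P'" "0 < \<epsilon>"
      and QU: "\<And>g. g \<in> Y \<Longrightarrow> (\<forall>q\<in>Q. q (\<lambda>i. g i - F f i) < \<epsilon>) \<Longrightarrow> g \<in> U"
      by blast
    define nb where "nb q R \<delta> \<longleftrightarrow> finite R \<and> R \<subseteq> P \<and> 0 < \<delta> \<and>
      (\<forall>f\<in>X. \<forall>g\<in>X. (\<forall>p\<in>R. p (\<lambda>i. g i - f i) < \<delta>) \<longrightarrow> q (\<lambda>i. F g i - F f i) < \<epsilon>)" for q R \<delta>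
    have "\<exists>R \<delta>. nb q R \<delta>" if "q \<in> Q" for q
      unfolding nb_def by (rule cont) (use Q that in auto)
    then obtain R \<delta> where nb: "\<And>q. q \<in> Q \<Longrightarrow> nb q (R q) (\<delta> q)"
      by metis
    have R: "finite (R q)" "R q \<subseteq> P" "0 < \<delta> q" if "q \<in> Q" for q
      using nb[OF that] unfolding nb_def by simp_all
    have Rq: "q (\<lambda>i. F g i - F f i) < \<epsilon>"
      if "q \<in> Q" "f \<in> X" "g \<in> X" "\<forall>p\<in>R q. p (\<lambda>i. g i - f i) < \<delta> q" for q f g
      using that(2-) by (rule nb[OF that(1), unfolded nb_def, THEN conjunct2, THEN conjunct2, THEN conjunct2,
          THEN bspec, THEN bspec, THEN mp])
    define d where "d = Min (insert (1::real) (\<delta> ` Q))"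
    have d: "0 < d" "\<And>q. q \<in> Q \<Longrightarrow> d \<le> \<delta> q"
      using Q(1) R by (auto simp: d_def)
    show "\<exists>Q \<epsilon>. finite Q \<and> Q \<subseteq> P \<and> 0 < \<epsilon> \<and> (\<forall>g\<in>X. (\<forall>q\<in>Q. q (\<lambda>i. g i - f i) < \<epsilon>) \<longrightarrow>
            g \<in> {f \<in> topspace (seminorm_topology X P). F f \<in> U})"
    proof (intro exI[of _ "\<Union>q\<in>Q. R q"] exI[of _ d] conjI ballI impI)
      show "finite (\<Union>q\<in>Q. R q)" "(\<Union>q\<in>Q. R q) \<subseteq> P" "0 < d" using Q(1) R d by auto
      fix g assume g: "g \<in> X" "\<forall>q\<in>\<Union>q\<in>Q. R q. q (\<lambda>i. g i - f i) < d"
      have "F g \<in> U"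
      proof (rule QU, use F g in blast, intro ballI Rq)
        fix q p assume "q \<in> Q" "p \<in> R q"
        then show "p (\<lambda>i. g i - f i) < \<delta> q" using g(2) d(2)[of q] by fastforce
      qed (use g f in auto)
      then show "g \<in> {f \<in> topspace (seminorm_topology X P). F f \<in> U}" using g by simp
    qed
  qed
qed

lemma continuous_bijective_frac_fourier:
  assumes "\<And>r. continuous_map T T (frac_fourier r)"
  shows "continuous_bijective T (frac_fourier r)"
  unfolding continuous_bijective_def
proof
  show "bij_betw (frac_fourier r) (topspace T) (topspace T)"
    by (rule bij_betw_frac_fourier) (use assms continuous_map_image_subset_topspace in fastforce)
qed (use assms in simp)

lemma continuous_bijective_proj_limit:
  assumes E: "\<And>j r c. j \<in> J \<Longrightarrow> c \<in> E j \<Longrightarrow> frac_fourier r c \<in> E j"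
    and n: "\<And>j r c. j \<in> J \<Longrightarrow> n j (frac_fourier r c) = n j c"
  shows "continuous_bijective (proj_limit_topology J E n) (frac_fourier r)"
proof (rule continuous_bijective_frac_fourier)
  fix r
  show "continuous_map (proj_limit_topology J E n) (proj_limit_topology J E n) (frac_fourier r)"
    unfolding proj_limit_topology_def
  proof (rule continuous_map_seminorm_topology)
    show "frac_fourier r f \<in> \<Inter> (E ` J)" if "f \<in> \<Inter> (E ` J)" for f
      using that E by blast
    fix q and \<epsilon> :: real assume "q \<in> n ` J" "0 < \<epsilon>"
    then show "\<exists>Q \<delta>. finite Q \<and> Q \<subseteq> n ` J \<and> 0 < \<delta> \<and> (\<forall>f\<in>\<Inter> (E ` J). \<forall>g\<in>\<Inter> (E ` J).
        (\<forall>p\<in>Q. p (\<lambda>i. g i - f i) < \<delta>) \<longrightarrow> q (\<lambda>i. frac_fourier r g i - frac_fourier r f i) < \<epsilon>)"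
      by (intro exI[of _ "{q}"] exI[of _ \<epsilon>]) (auto simp: frac_fourier_diff n)
  qed
qed

text \<open>
  A seminorm that is continuous on every step stays so after composition with a linear map that is
  isometric on every step; this is all that continuity for the inductive limit requires.
\<close>

lemma continuous_bijective_ind_limit:
  assumes E: "\<And>j r c. j \<in> J \<Longrightarrow> c \<in> E j \<Longrightarrow> frac_fourier r c \<in> E j"
    and n: "\<And>j r c. j \<in> J \<Longrightarrow> n j (frac_fourier r c) = n j c"
  shows "continuous_bijective (ind_limit_topology J E n) (frac_fourier r)"
proof (rule continuous_bijective_frac_fourier)
  fix r
  let ?X = "\<Union>j\<in>J. E j"
  let ?P = "{q. seminorm_on ?X q \<and> (\<forall>j\<in>J. \<exists>C. \<forall>f\<in>E j. q f \<le> C * n j f)}"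
  have X: "frac_fourier r f \<in> ?X" if "f \<in> ?X" for f using that E by blast
  show "continuous_map (ind_limit_topology J E n) (ind_limit_topology J E n) (frac_fourier r)"
    unfolding ind_limit_topology_def
  proof (rule continuous_map_seminorm_topology)
    fix q and \<epsilon> :: real assume q: "q \<in> ?P" "0 < \<epsilon>"
    have add: "frac_fourier r (\<lambda>i. f i + g i) = (\<lambda>i. frac_fourier r f i + frac_fourier r g i)" for f g
      by (simp add: frac_fourier_eq algebra_simps)
    have scale: "frac_fourier r (\<lambda>i. a * f i) = (\<lambda>i. a * frac_fourier r f i)" for f a
      by (simp add: frac_fourier_eq algebra_simps)
    have "seminorm_on ?X (q \<circ> frac_fourier r)"
    proof -
      note q' = q(1)[unfolded mem_Collect_eq seminorm_on_def]
      have *: "\<And>f g. f \<in> ?X \<Longrightarrow> g \<in> ?X \<Longrightarrow> q (\<lambda>i. f i + g i) \<le> q f + q g"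
        "\<And>f a. f \<in> ?X \<Longrightarrow> q (\<lambda>i. a * f i) = cmod a * q f"
        by (rule q'[THEN conjunct1, THEN conjunct1, THEN bspec, THEN bspec], assumption+)
          (rule q'[THEN conjunct1, THEN conjunct2, THEN bspec, THEN spec])
      show ?thesis
        unfolding seminorm_on_def comp_apply add scale
        by (intro conjI ballI allI * X)
    qed
    moreover have "\<exists>C. \<forall>f\<in>E j. (q \<circ> frac_fourier r) f \<le> C * n j f" if "j \<in> J" for j
    proof -
      obtain C where "\<And>f. f \<in> E j \<Longrightarrow> q f \<le> C * n j f" using q \<open>j \<in> J\<close> by blast
      then show ?thesis using that E n by (metis comp_apply)
    qed
    ultimately have "q \<circ> frac_fourier r \<in> ?P" by blast
    then show "\<exists>Q \<delta>. finite Q \<and> Q \<subseteq> ?P \<and> 0 < \<delta> \<and> (\<forall>f\<in>?X. \<forall>g\<in>?X.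
        (\<forall>p\<in>Q. p (\<lambda>i. g i - f i) < \<delta>) \<longrightarrow> q (\<lambda>i. frac_fourier r g i - frac_fourier r f i) < \<epsilon>)"
      using q(2) by (intro exI[of _ "{q \<circ> frac_fourier r}"] exI[of _ \<epsilon>]) (simp add: frac_fourier_diff)
  qed (fact X)
qed

lemma frac_fourier_weighted:
  "frac_fourier r c \<in> weighted_space w \<longleftrightarrow> c \<in> weighted_space w"
  "weighted_norm w (frac_fourier r c) = weighted_norm w c"
  by (simp_all add: weighted_space_def weighted_norm_def frac_fourier_eq norm_mult)

lemma continuous_bijective_discrete_zero:
  "continuous_bijective (discrete_topology {\<lambda>_. 0}) (frac_fourier r)"
  by (rule continuous_bijective_frac_fourier) (simp add: frac_fourier_eq)

lemma continuous_bijective_Pilipovic: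
  "continuous_bijective (Hs_top s) (frac_fourier r)"
  "continuous_bijective (H0s_top s) (frac_fourier r)"
  "continuous_bijective (Hs_dual_top s) (frac_fourier r)"
  "continuous_bijective (H0s_dual_top s) (frac_fourier r)"
proof -
  show "continuous_bijective (Hs_top s) (frac_fourier r)"
    unfolding Hs_top_def
    by (auto intro!: continuous_bijective_ind_limit simp: frac_fourier_weighted)
       (auto simp: frac_fourier_eq)
  show "continuous_bijective (H0s_top s) (frac_fourier r)"
    unfolding H0s_top_def
    by (auto intro!: continuous_bijective_proj_limit continuous_bijective_discrete_zero simp: frac_fourier_weighted)
  show "continuous_bijective (H0s_dual_top s) (frac_fourier r)"
    unfolding H0s_dual_top_def
    by (auto intro!: continuous_bijective_ind_limit continuous_bijective_discrete_zero simp: frac_fourier_weighted)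
  have prod: "continuous_map (product_topology (\<lambda>_. euclidean) UNIV) (product_topology (\<lambda>_. euclidean) UNIV)
      (frac_fourier r)" for r :: "real ^ 'a"
    unfolding euclidean_product_topology continuous_map_iff_continuous2 continuous_on_coordinatewise_iff
      frac_fourier_eq
    by (intro allI continuous_intros continuous_on_product_coordinates)
  show "continuous_bijective (Hs_dual_top s) (frac_fourier r)"
    unfolding Hs_dual_top_def
    by (auto intro!: continuous_bijective_proj_limit continuous_bijective_frac_fourier[OF prod]
        simp: frac_fourier_weighted)
qed

text \<open>
  A lift of the diagonal operator along \<open>e\<close> is enough: preimages of open sets are computed upstairs, and the
  lift for \<open>- r\<close> provides the inverse.
\<close>

lemma continuous_bijective_transport:
  fixes T :: "'a topology"
  assumes G: "\<And>r. continuous_map T T (G r)"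
    and e: "\<And>r x. x \<in> topspace T \<Longrightarrow> e (G r x) = frac_fourier r (e x)"
  shows "continuous_bijective (transport_topology e T) (frac_fourier r)"
proof (rule continuous_bijective_frac_fourier)
  fix r
  have GT: "G r x \<in> topspace T" if "x \<in> topspace T" for x
    using continuous_map_image_subset_topspace[OF G] that by blast
  show "continuous_map (transport_topology e T) (transport_topology e T) (frac_fourier r)"
    unfolding continuous_map
  proof (intro conjI allI impI)
    show "frac_fourier r ` topspace (transport_topology e T) \<subseteq> topspace (transport_topology e T)"
      using e GT by (force simp flip: e)
    fix V assume V: "openin (transport_topology e T) V"
    have "openin T {x \<in> topspace T. G r x \<in> {x \<in> topspace T. e x \<in> V}}"
      using V by (intro openin_continuous_map_preimage[OF G]) (simp add: openin_transport_topology)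
    also have "{x \<in> topspace T. G r x \<in> {x \<in> topspace T. e x \<in> V}} =
        {x \<in> topspace T. e x \<in> {c \<in> topspace (transport_topology e T). frac_fourier r c \<in> V}}"
      using e GT by auto
    finally show "openin (transport_topology e T)
        {c \<in> topspace (transport_topology e T). frac_fourier r c \<in> V}"
      by (auto simp: openin_transport_topology)
  qed
qed

section \<open>The harmonic oscillator\<close>

lemma harmonic_osc_factor: "of_nat (2 * mdeg \<alpha> + CARD('d)) \<noteq> (0::complex)" for \<alpha> :: "nat ^ 'd::finite"
  by (simp only: of_nat_eq_0_iff) simp

lemma inv_harmonic_osc:
  "inv harmonic_osc c = (\<lambda>\<alpha>. c \<alpha> / of_nat (2 * mdeg \<alpha> + CARD('d)))" for c :: "'d::finite hermite_series"
proof (rule inv_f_eq)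
  show "inj (harmonic_osc :: 'd hermite_series \<Rightarrow> _)"
  proof (rule injI)
    fix c c' :: "'d hermite_series" assume "harmonic_osc c = harmonic_osc c'"
    then have "harmonic_osc c \<alpha> = harmonic_osc c' \<alpha>" for \<alpha> by simp
    then show "c = c'" using harmonic_osc_factor by (auto simp: harmonic_osc_def fun_eq_iff)
  qed
  show "harmonic_osc (\<lambda>\<alpha>. c \<alpha> / of_nat (2 * mdeg \<alpha> + CARD('d))) = c"
    using harmonic_osc_factor[where 'd='d] by (simp add: harmonic_osc_def)
qed

lemma frac_fourier_harmonic_osc:
  "frac_fourier r (harmonic_osc c) = harmonic_osc (frac_fourier r c)"
  "frac_fourier r (inv harmonic_osc c) = inv harmonic_osc (frac_fourier r c)"
  by (simp_all add: inv_harmonic_osc) (simp_all add: harmonic_osc_def frac_fourier_eq mult_ac)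

lemma frac_fourier_harmonic_osc_pow:
  "frac_fourier r (harmonic_osc_pow N c) = harmonic_osc_pow N (frac_fourier r c)"
proof -
  have "frac_fourier r ((harmonic_osc ^^ n) c) = (harmonic_osc ^^ n) (frac_fourier r c)"
    "frac_fourier r ((inv harmonic_osc ^^ n) c) = (inv harmonic_osc ^^ n) (frac_fourier r c)" for n
    by (induction n) (simp_all add: frac_fourier_harmonic_osc)
  then show ?thesis by (simp add: harmonic_osc_pow_def)
qed

section \<open>Measure-preserving maps\<close>

text \<open>
  By Fubini's theorem a shear is a translation in one variable for each fixed value of the other.
\<close>

lemma distr_lborel_shear_fst:
  fixes f :: "'b::euclidean_space \<Rightarrow> 'a::euclidean_space"
  assumes [measurable]: "f \<in> borel_measurable borel"
  shows "distr lborel borel (\<lambda>(x, y). (x + f y, y)) = lborel"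
proof (rule measure_eqI)
  have m [measurable]: "(\<lambda>(x, y). (x + f y, y)) \<in> borel_measurable borel"
    unfolding borel_prod[symmetric] by measurable
  fix A :: "('a \<times> 'b) set" assume "A \<in> sets (distr lborel borel (\<lambda>(x, y). (x + f y, y)))"
  then have A [measurable]: "A \<in> sets borel" by simp
  have shift: "(\<integral>\<^sup>+x. g (x + c) \<partial>lborel) = (\<integral>\<^sup>+x. g x \<partial>lborel)"
    if "g \<in> borel_measurable borel" for g :: "'a \<Rightarrow> ennreal" and c
    using nn_integral_distr[of "(+) c" lborel borel g] that by (simp add: lborel_distr_plus add.commute)
  have [measurable]: "(\<lambda>z. indicator A z :: ennreal) \<in> borel_measurable (lborel \<Otimes>\<^sub>M lborel)"
    by (simp add: lborel_prod)
  have [measurable]: "(\<lambda>z. indicator A ((\<lambda>(x, y). (x + f y, y)) z) :: ennreal) \<in> borel_measurable (lborel \<Otimes>\<^sub>M lborel)"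
    unfolding lborel_prod by measurable
  have "emeasure (distr lborel borel (\<lambda>(x, y). (x + f y, y))) A =
      (\<integral>\<^sup>+z. indicator A z \<partial>distr lborel borel (\<lambda>(x, y). (x + f y, y)))"
    by simp
  also have "\<dots> = (\<integral>\<^sup>+z. indicator A ((\<lambda>(x, y). (x + f y, y)) z) \<partial>(lborel \<Otimes>\<^sub>M lborel))"
    by (subst nn_integral_distr) (simp_all add: lborel_prod)
  also have "\<dots> = (\<integral>\<^sup>+y. (\<integral>\<^sup>+x. indicator A (x + f y, y) \<partial>lborel) \<partial>lborel)"
    by (subst lborel_pair.nn_integral_snd[symmetric]) simp_all
  also have "\<dots> = (\<integral>\<^sup>+y. (\<integral>\<^sup>+x. indicator A (x, y) \<partial>lborel) \<partial>lborel)"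
  proof (rule nn_integral_cong)
    fix y :: 'b
    have "(\<lambda>x. indicator A (x, y) :: ennreal) \<in> borel_measurable borel"
      by (rule measurable_compose[OF _ borel_measurable_indicator[OF A]]) (simp add: borel_prod[symmetric])
    from shift[OF this, of "f y"]
    show "(\<integral>\<^sup>+x. indicator A (x + f y, y) \<partial>lborel) = (\<integral>\<^sup>+x. indicator A (x, y) \<partial>lborel)" .
  qed
  also have "\<dots> = (\<integral>\<^sup>+z. indicator A z \<partial>(lborel \<Otimes>\<^sub>M lborel))"
    by (subst lborel_pair.nn_integral_snd[symmetric]) simp_all
  also have "\<dots> = emeasure lborel A" by (simp add: lborel_prod)
  finally show "emeasure (distr lborel borel (\<lambda>(x, y). (x + f y, y))) A = emeasure lborel A" .
qed simp

lemma distr_lborel_swap: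
  "distr lborel borel prod.swap = (lborel :: ('a::euclidean_space \<times> 'b::euclidean_space) measure)"
proof -
  have "distr lborel lborel (\<lambda>(x, y). (y, x)) = (lborel :: ('a \<times> 'b) measure)"
    using lborel_pair.distr_pair_swap[where 'a='a and 'b='b] by (simp only: lborel_prod)
  moreover have "distr lborel lborel (\<lambda>(x, y). (y, x)) = distr lborel (borel :: ('a \<times> 'b) measure) prod.swap"
    by (rule distr_cong) auto
  ultimately show ?thesis by simp
qed

text \<open>
  Conjugate of the shear in the first variable by the swap of the factors.
\<close>

lemma distr_lborel_shear_snd:
  fixes f :: "'a::euclidean_space \<Rightarrow> 'b::euclidean_space"
  assumes [measurable]: "f \<in> borel_measurable borel"
  shows "distr lborel borel (\<lambda>(x, y). (x, y + f x)) = lborel"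
proof -
  let ?S = "\<lambda>(y, x). (y + f x, x)"
  have [measurable]: "?S \<in> borel_measurable borel"
    unfolding borel_prod[symmetric] by measurable
  have [measurable]: "prod.swap \<in> borel_measurable (borel :: ('a \<times> 'b) measure)"
    "prod.swap \<in> borel_measurable (borel :: ('b \<times> 'a) measure)"
    unfolding borel_prod[symmetric] prod.swap_def[abs_def] by measurable
  have "(\<lambda>(x, y). (x, y + f x)) = prod.swap \<circ> (?S \<circ> prod.swap)"
    by auto
  then have "distr lborel borel (\<lambda>(x, y). (x, y + f x)) =
      distr (distr (distr lborel borel prod.swap) borel ?S) borel prod.swap"
    by (simp add: distr_distr)
  then show ?thesis
    by (simp add: distr_lborel_swap distr_lborel_shear_fst)
qed

lemma lborel_measure_preserving_comp:
  fixes S T :: "'a::euclidean_space \<Rightarrow> 'a"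
  assumes [measurable]: "S \<in> borel_measurable borel" "T \<in> borel_measurable borel"
    and "distr lborel borel S = lborel" "distr lborel borel T = lborel"
  shows "distr lborel borel (S \<circ> T) = lborel"
  using distr_distr[of S borel borel T lborel] assms by (simp add: measurable_lborel1)

text \<open>
  The modulation norms are integrals with respect to the completed measure, so invariance must be carried over from
  Borel sets to Lebesgue sets.
\<close>

lemma lebesgue_measure_preserving:
  fixes T :: "'a::euclidean_space \<Rightarrow> 'a"
  assumes T: "T \<in> borel_measurable borel" "distr lborel borel T = lborel"
  shows "T \<in> measurable lebesgue lebesgue" "distr lebesgue lebesgue T = lebesgue"
proof -
  have T': "T \<in> measurable lborel lborel" "distr lborel lborel T = lborel"
    using T by (simp_all cong: distr_cong)
  have D: "distr lebesgue lborel T = lborel"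
    using distr_completion[OF T'(1)] T'(2) by simp
  have L: "T \<in> measurable lebesgue lborel" using T'(1) by (rule measurable_completion)
  have "completion (distr lebesgue lborel T) = distr lebesgue lebesgue T"
    by (rule completion.completion_distr_eq[OF L]) (simp add: D)
  then show "distr lebesgue lebesgue T = lebesgue" by (simp add: D)
  show "T \<in> measurable lebesgue lebesgue"
    by (rule completion.measurable_completion2[OF L]) (simp add: D)
qed

text \<open>
  The integral is a supremum over the simple functions below the integrand, and an invertible measure-preserving
  map permutes these together with their integrals.
\<close>

lemma nn_integral_measure_iso:
  assumes T: "T \<in> measurable M M" "distr M M T = M"
    and S: "S \<in> measurable M M" "distr M M S = M"
    and TS: "\<And>x. x \<in> space M \<Longrightarrow> T (S x) = x"
  shows "(\<integral>\<^sup>+x. f (T x) \<partial>M) = (\<integral>\<^sup>+x. f x \<partial>M)"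
proof -
  have le: "(\<integral>\<^sup>+x. g x \<partial>M) \<le> (\<integral>\<^sup>+x. g (T x) \<partial>M)"
    if T: "T \<in> measurable M M" "distr M M T = M" for g :: "_ \<Rightarrow> ennreal" and T
    unfolding nn_integral_def[of M g]
  proof (rule SUP_least)
    fix s assume "s \<in> {s. simple_function M s \<and> s \<le> g}"
    then have s: "simple_function M s" "\<And>x. s x \<le> g x" by (auto simp: le_fun_def)
    have "integral\<^sup>S M s = (\<integral>\<^sup>+x. s x \<partial>distr M M T)"
      using s T by (simp add: nn_integral_eq_simple_integral)
    also have "\<dots> = (\<integral>\<^sup>+x. s (T x) \<partial>M)"
      using T s by (intro nn_integral_distr) (auto intro: borel_measurable_simple_function)
    also have "\<dots> \<le> (\<integral>\<^sup>+x. g (T x) \<partial>M)" using s by (intro nn_integral_mono) simp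
    finally show "integral\<^sup>S M s \<le> (\<integral>\<^sup>+x. g (T x) \<partial>M)" .
  qed
  have "(\<integral>\<^sup>+x. f (T x) \<partial>M) \<le> (\<integral>\<^sup>+x. f (T (S x)) \<partial>M)" using le[OF S] .
  also have "\<dots> = (\<integral>\<^sup>+x. f x \<partial>M)" using TS by (intro nn_integral_cong) simp
  finally show ?thesis using le[OF T, of f] by simp
qed

lemma esssup_measure_iso:
  fixes f :: "_ \<Rightarrow> ennreal"
  assumes T: "T \<in> measurable M M" "distr M M T = M"
    and S: "S \<in> measurable M M"
    and TS: "\<And>x. x \<in> space M \<Longrightarrow> T (S x) = x"
  shows "esssup M (\<lambda>x. f (T x)) = esssup M f"
proof (cases "f \<in> borel_measurable M")
  case True
  have "(AE x in M. f (T x) \<le> z) \<longleftrightarrow> (AE x in M. f x \<le> z)" for z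
  proof -
    have "(AE x in distr M M T. f x \<le> z) \<longleftrightarrow> (AE x in M. f (T x) \<le> z)"
      using True T by (intro AE_distr_iff) auto
    then show ?thesis unfolding T(2) ..
  qed
  then show ?thesis
    using True measurable_compose[OF T(1) True] by (simp add: esssup_eq_AE)
next
  case False
  have "(\<lambda>x. f (T x)) \<notin> borel_measurable M"
  proof
    assume "(\<lambda>x. f (T x)) \<in> borel_measurable M"
    then have "(\<lambda>x. f (T (S x))) \<in> borel_measurable M" using S by (rule measurable_compose[rotated])
    then show False using False TS by (simp cong: measurable_cong)
  qed
  with False show ?thesis by (simp add: esssup_non_measurable)
qed

section \<open>Phase space rotations\<close>

text \<open>
  The rotation \<open>z\<^sub>j \<mapsto> b\<^sub>j z\<^sub>j\<close> of \<open>z\<^sub>j = x\<^sub>j + i \<xi>\<^sub>j\<close>.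
\<close>

definition phase_rotation :: "complex ^ 'd \<Rightarrow> (real ^ 'd) \<times> (real ^ 'd) \<Rightarrow> (real ^ 'd) \<times> (real ^ 'd)" where
  "phase_rotation b = (\<lambda>(x, \<xi>). (\<chi> j. Re (b $ j) * x $ j - Im (b $ j) * \<xi> $ j, \<chi> j. Im (b $ j) * x $ j +
      Re (b $ j) * \<xi> $ j))"

lemma phase_rotation_mult: "phase_rotation a (phase_rotation b X) = phase_rotation (\<chi> j. a $ j * b $ j) X"
  by (cases X) (simp add: phase_rotation_def vec_eq_iff algebra_simps)

lemma phase_rotation_one: "phase_rotation (\<chi> j. 1) X = X"
  by (cases X) (simp add: phase_rotation_def vec_eq_iff)

lemma measurable_diag [measurable]:
  "(\<lambda>x. \<chi> j. c j * x $ j) \<in> borel_measurable (borel :: (real ^ 'd) measure)"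
  by (intro borel_measurable_continuous_onI continuous_intros)

lemma measurable_phase_rotation [measurable]: "phase_rotation b \<in> borel_measurable borel"
  unfolding phase_rotation_def case_prod_beta
  by (intro borel_measurable_continuous_onI continuous_intros)

text \<open>
  A plane rotation by the angle \<open>\<theta> \<noteq> \<pi>\<close> is the product of three shears, with parameters \<open>- tan (\<theta> / 2)\<close>, \<open>sin \<theta>\<close> and
  \<open>- tan (\<theta> / 2)\<close>.  All coordinates can be sheared at once.
\<close>

lemma distr_phase_rotation_no_half_turn:
  assumes b: "\<And>j. cmod (b $ j) = 1" "\<And>j. b $ j \<noteq> -1"
  shows "distr lborel borel (phase_rotation (b :: complex ^ 'd)) = lborel"
proof -
  define t s where "t = (\<lambda>j. - (Im (b $ j) / (1 + Re (b $ j))))" and "s = (\<lambda>j. Im (b $ j))"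
  define S1 S2 :: "(real ^ 'd) \<times> (real ^ 'd) \<Rightarrow> _" where
    "S1 = (\<lambda>(x, y). (x + (\<chi> j. t j * y $ j), y))" and "S2 = (\<lambda>(x, y). (x, y + (\<chi> j. s j * x $ j)))"
  have m [measurable]: "S1 \<in> borel_measurable borel" "S2 \<in> borel_measurable borel"
    unfolding S1_def S2_def borel_prod[symmetric] by measurable
  have d: "distr lborel borel S1 = lborel" "distr lborel borel S2 = lborel"
    unfolding S1_def S2_def by (intro distr_lborel_shear_fst distr_lborel_shear_snd; measurable)+
  have "1 - Im (b $ j) * (Im (b $ j) / (1 + Re (b $ j))) = Re (b $ j)"
    and ne: "1 + Re (b $ j) \<noteq> 0" for j
  proof -
    have sq: "(Re (b $ j))\<^sup>2 + (Im (b $ j))\<^sup>2 = 1" using b(1)[of j] by (metis cmod_power2 one_power2)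
    show ne: "1 + Re (b $ j) \<noteq> 0"
    proof
      assume "1 + Re (b $ j) = 0"
      then have "Re (b $ j) = -1" by simp
      with sq have "Im (b $ j) = 0" by simp
      with \<open>Re (b $ j) = -1\<close> b(2)[of j] show False by (simp add: complex_eq_iff)
    qed
    have "Im (b $ j) * Im (b $ j) = (1 - Re (b $ j)) * (1 + Re (b $ j))"
      using sq by (simp add: power2_eq_square algebra_simps)
    then show "1 - Im (b $ j) * (Im (b $ j) / (1 + Re (b $ j))) = Re (b $ j)"
      using ne by simp
  qed
  then have st: "1 + s j * t j = Re (b $ j)" for j by (simp add: s_def t_def)
  have ts: "t j * (1 + Re (b $ j)) = - s j" for j using ne[of j] by (simp add: s_def t_def)
  have "phase_rotation b = S1 \<circ> (S2 \<circ> S1)"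
  proof (rule ext, rule prod_eqI)
    fix X :: "(real ^ 'd) \<times> (real ^ 'd)"
    obtain x y where X: "X = (x, y)" by force
    have "Re (b $ j) * x $ j - s j * y $ j = (x $ j + t j * y $ j) + t j * (y $ j + s j * (x $ j + t j * y $ j))"
        for j
    proof -
      have "(x $ j + t j * y $ j) + t j * (y $ j + s j * (x $ j + t j * y $ j)) =
          (1 + s j * t j) * x $ j + t j * (1 + (1 + s j * t j)) * y $ j"
        by (simp add: algebra_simps)
      then show ?thesis unfolding st ts by simp
    qed
    then show "fst (phase_rotation b X) = fst ((S1 \<circ> (S2 \<circ> S1)) X)"
      by (simp add: X phase_rotation_def S1_def S2_def vec_eq_iff s_def)
    have "s j * x $ j + Re (b $ j) * y $ j = y $ j + s j * (x $ j + t j * y $ j)" for j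
      unfolding st[symmetric] by (simp add: algebra_simps)
    then show "snd (phase_rotation b X) = snd ((S1 \<circ> (S2 \<circ> S1)) X)"
      by (simp add: X phase_rotation_def S1_def S2_def vec_eq_iff s_def)
  qed
  then show ?thesis using m d by (auto intro!: lborel_measure_preserving_comp measurable_comp[of _ _ borel])
qed

text \<open>
  Square roots in the right half plane avoid the half turn, so every rotation is the square of a product of shears.
\<close>

lemma distr_phase_rotation:
  assumes b: "\<And>j. cmod (b $ j) = 1"
  shows "distr lborel borel (phase_rotation (b :: complex ^ 'd)) = lborel"
proof -
  define a where "a = (\<chi> j. csqrt (b $ j))"
  have "phase_rotation b = phase_rotation a \<circ> phase_rotation a"
    by (auto simp: phase_rotation_mult a_def power2_eq_square[symmetric] fun_eq_iff vec_nth_inverse)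
  moreover have "distr lborel borel (phase_rotation a) = lborel"
  proof (rule distr_phase_rotation_no_half_turn)
    show "cmod (a $ j) = 1" for j using b[of j] by (simp add: a_def norm_csqrt)
    show "a $ j \<noteq> - 1" for j
    proof
      assume "a $ j = - 1"
      then have "Re (csqrt (b $ j)) < 0" by (simp add: a_def del: csqrt.simps)
      then show False using csqrt_principal[of "b $ j"] by (auto simp del: csqrt.simps)
    qed
  qed
  ultimately show ?thesis by (simp add: lborel_measure_preserving_comp)
qed

lemma Lp_qnorm_phase_rotation:
  assumes b: "\<And>j. cmod (b $ j) = 1"
  shows "Lp_qnorm p (\<lambda>X. g (phase_rotation b X)) = Lp_qnorm p g"
proof -
  define b' where "b' = (\<chi> j. cnj (b $ j))"
  have bb: "b $ j * cnj (b $ j) = 1" for j using b[of j] by (simp add: complex_norm_square[symmetric])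
  have inv: "phase_rotation b (phase_rotation b' X) = X" for X
    by (simp add: phase_rotation_mult b'_def bb phase_rotation_one)
  have b': "cmod (b' $ j) = 1" for j using b by (simp add: b'_def)
  note T = lebesgue_measure_preserving[OF measurable_phase_rotation distr_phase_rotation[OF b]]
  note S = lebesgue_measure_preserving[OF measurable_phase_rotation distr_phase_rotation[OF b']]
  show ?thesis
    using nn_integral_measure_iso[OF T S inv, of "\<lambda>X. ennreal (cmod (g X) powr enn2real p)"]
      esssup_measure_iso[OF T S(1) inv, of "\<lambda>X. ennreal (cmod (g X))"]
    unfolding Lp_qnorm_def by simp
qed

section \<open>Modulation spaces\<close>

text \<open>
  The argument of the Bargmann transform is built from \<open>x\<^sub>j - i \<xi>\<^sub>j\<close>, so the factor \<open>exp (- i r\<^sub>j \<pi> / 2)\<close> there rotates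
  \<open>x\<^sub>j + i \<xi>\<^sub>j\<close> by the conjugate factor.
\<close>

lemma norm_stft_frac_fourier:
  defines "b r \<equiv> (\<chi> j. exp (\<i> * of_real (r $ j * (pi / 2))))"
  shows "cmod (stft (frac_fourier r f) X) = cmod (stft f (phase_rotation (b r) X))"
proof -
  obtain x \<xi> where X: "X = (x, \<xi>)" by force
  obtain x' \<xi>' where X': "phase_rotation (b r) X = (x', \<xi>')" by force
  have cmod_eq: "cmod (stft f (x, \<xi>)) = (2 * pi) powr (- real CARD('a) / 2) * exp (- ((norm x)\<^sup>2 + (norm \<xi>)\<^sup>2) / 4) *
     cmod (eval_power_series (bargmann f) (\<chi> j. (of_real (x $ j) - \<i> * of_real (\<xi> $ j)) / of_real (sqrt 2)))"
    for f and x \<xi> :: "real ^ 'a"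
  proof -
    have "cmod (exp (- \<i> * of_real (x \<bullet> \<xi>) / 2)) = 1"
      by (metis (no_types, opaque_lifting) norm_exp_i_times mult_minus_left mult_minus_right of_real_minus
          of_real_divide of_real_numeral times_divide_eq_right)
    then show ?thesis by (simp add: stft_def norm_mult)
  qed
  define w where "w = (\<chi> j. exp (- \<i> * of_real (r $ j) * of_real (pi / 2)))"
  have w: "of_real (x' $ j) - \<i> * of_real (\<xi>' $ j) = w $ j * (of_real (x $ j) - \<i> * of_real (\<xi> $ j))" for j
  proof -
    have "x' $ j = cos (r $ j * (pi / 2)) * x $ j - sin (r $ j * (pi / 2)) * \<xi> $ j"
      "\<xi>' $ j = sin (r $ j * (pi / 2)) * x $ j + cos (r $ j * (pi / 2)) * \<xi> $ j"
      using X' by (auto simp: X phase_rotation_def b_def Re_exp Im_exp)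
    moreover have "w $ j = Complex (cos (r $ j * (pi / 2))) (- sin (r $ j * (pi / 2)))"
      by (simp add: w_def complex_eq_iff Re_exp Im_exp)
    ultimately show ?thesis by (simp add: complex_eq_iff algebra_simps)
  qed
  have "(norm x')\<^sup>2 + (norm \<xi>')\<^sup>2 = (norm x)\<^sup>2 + (norm \<xi>)\<^sup>2"
  proof -
    have "(x' $ j)\<^sup>2 + (\<xi>' $ j)\<^sup>2 = (x $ j)\<^sup>2 + (\<xi> $ j)\<^sup>2" for j
    proof -
      have "(cmod (of_real (x' $ j) - \<i> * of_real (\<xi>' $ j)))\<^sup>2 = (cmod (of_real (x $ j) - \<i> * of_real (\<xi> $ j)))\<^sup>2"
        unfolding w by (simp add: norm_mult w_def)
      then show ?thesis by (simp add: cmod_power2)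
    qed
    then show ?thesis
      unfolding power2_norm_eq_inner inner_vec_def sum.distrib[symmetric]
      by (simp add: power2_eq_square)
  qed
  moreover have "eval_power_series (bargmann (frac_fourier r f)) (\<chi> j. (of_real (x $ j) - \<i> *
      of_real (\<xi> $ j)) / of_real (sqrt 2)) =
      eval_power_series (bargmann f) (\<chi> j. (of_real (x' $ j) - \<i> * of_real (\<xi>' $ j)) / of_real (sqrt 2))"
  proof -
    have "phase r \<alpha> = mpow w \<alpha>" for \<alpha> unfolding w_def mpow_rotation ..
    moreover have "mpow (\<chi> j. w $ j * z $ j) \<alpha> = mpow w \<alpha> * mpow z \<alpha>" for \<alpha> and z :: "complex ^ 'a"
      by (simp add: mpow_def power_mult_distrib prod.distrib)
    from this[of "\<chi> j. (of_real (x $ j) - \<i> * of_real (\<xi> $ j)) / of_real (sqrt 2)"]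
    have "mpow (\<chi> j. w $ j * (of_real (x $ j) - \<i> * of_real (\<xi> $ j)) / of_real (sqrt 2)) \<alpha> =
        mpow w \<alpha> * mpow (\<chi> j. (of_real (x $ j) - \<i> * of_real (\<xi> $ j)) / of_real (sqrt 2)) \<alpha>" for \<alpha>
      by simp
    ultimately show ?thesis
      unfolding eval_power_series_def w by (simp add: bargmann_def frac_fourier_eq mult_ac)
  qed
  ultimately show ?thesis unfolding X' unfolding X cmod_eq by simp
qed

lemma Lp_qnorm_cong_norm: "(\<And>X. cmod (f X) = cmod (g X)) \<Longrightarrow> Lp_qnorm p f = Lp_qnorm p g"
  by (simp add: Lp_qnorm_def)

lemma frac_fourier_H_flat1_dual:
  "frac_fourier r f \<in> H_flat1_dual \<longleftrightarrow> f \<in> H_flat1_dual"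
  by (simp add: Hs_dual_top_def proj_limit_topology_def frac_fourier_weighted)

lemma mod_qnorm_frac_fourier:
  fixes r :: "real ^ 'd::finite" and \<omega>\<^sub>0 :: "real ^ 'd \<Rightarrow> real"
  assumes \<omega>: "\<And>x \<xi>. \<omega> (x, \<xi>) = \<omega>\<^sub>0 (\<chi> j. cmod (Complex (x $ j) (\<xi> $ j)))"
  shows "mod_qnorm p \<omega> (frac_fourier r f) = mod_qnorm p \<omega> f"
proof -
  define b where "b = (\<chi> j. exp (\<i> * of_real (r $ j * (pi / 2))))"
  have b: "cmod (b $ j) = 1" for j
    unfolding b_def by (simp only: vec_lambda_beta norm_exp_i_times)
  have "\<omega> (phase_rotation b X) = \<omega> X" for X
  proof -
    obtain x \<xi> where X: "X = (x, \<xi>)" by force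
    have "Complex (Re (b $ j) * x $ j - Im (b $ j) * \<xi> $ j) (Im (b $ j) * x $ j + Re (b $ j) * \<xi> $ j) =
        b $ j * Complex (x $ j) (\<xi> $ j)" for j
      by (simp add: complex_eq_iff algebra_simps)
    then show ?thesis by (simp add: X phase_rotation_def \<omega> norm_mult b)
  qed
  then have "Lp_qnorm p (\<lambda>X. stft (frac_fourier r f) X * of_real (\<omega> X)) =
      Lp_qnorm p (\<lambda>X. stft f (phase_rotation b X) * of_real (\<omega> (phase_rotation b X)))"
    by (intro Lp_qnorm_cong_norm) (simp add: norm_mult norm_stft_frac_fourier b_def)
  also have "\<dots> = Lp_qnorm p (\<lambda>X. stft f X * of_real (\<omega> X))"
    by (rule Lp_qnorm_phase_rotation) (fact b)
  finally show ?thesis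
    by (simp add: mod_qnorm_def frac_fourier_H_flat1_dual)
qed

section \<open>Hermite functions of one variable\<close>

text \<open>
  The normalised Hermite functions \<open>\<psi>\<^sub>n\<close> on the line, introduced by their three-term recurrence; the link to the
  definition by derivatives of the Gaussian is \<open>hermite_fun_eq_prod\<close> below.
\<close>

fun hermite1 :: "nat \<Rightarrow> real \<Rightarrow> real" where
  "hermite1 0 t = pi powr (- 1 / 4) * exp (- (t\<^sup>2 / 2))"
| "hermite1 (Suc 0) t = sqrt 2 * t * hermite1 0 t"
| "hermite1 (Suc (Suc n)) t =
     (sqrt 2 * t * hermite1 (Suc n) t - sqrt (real (Suc n)) * hermite1 n t) / sqrt (real (Suc (Suc n)))"

text \<open>
  The recurrence in symmetric form.  For \<open>n = 0\<close> the truncated index \<open>n - 1\<close> is harmless because its coefficient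
  vanishes.
\<close>

lemma hermite1_rec:
  "2 * t * hermite1 n t = sqrt (2 * real n) * hermite1 (n - 1) t + sqrt (2 * real (Suc n)) * hermite1 (Suc n) t"
proof (cases n)
  case 0
  have "sqrt 2 * (sqrt 2 * x) = 2 * x" for x by (simp add: mult.assoc[symmetric])
  then show ?thesis using 0 by (simp add: mult_ac)
next
  case (Suc m)
  have [simp]: "sqrt (2 * real k) = sqrt 2 * sqrt (real k)" for k by (simp add: real_sqrt_mult)
  have *: "sqrt (real (Suc (Suc m))) * hermite1 (Suc (Suc m)) t =
      sqrt 2 * t * hermite1 (Suc m) t - sqrt (real (Suc m)) * hermite1 m t"
    by simp
  have "sqrt 2 * sqrt (real (Suc m)) * hermite1 m t +
      sqrt 2 * (sqrt (real (Suc (Suc m))) * hermite1 (Suc (Suc m)) t) =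
      (sqrt 2 * sqrt 2) * t * hermite1 (Suc m) t"
    unfolding * by (simp only: algebra_simps)
  then show ?thesis unfolding Suc
    by (simp add: mult_ac real_sqrt_mult del: hermite1.simps of_nat_Suc)
qed

text \<open>
  The recurrence alone determines the derivatives: in the inductive step the derivatives of the two previous
  functions, one in raising and one in lowering form, combine to the claim by the recurrence.
\<close>

lemma has_derivative_hermite1_raise:
  "(hermite1 n has_real_derivative (t * hermite1 n t - sqrt (2 * real (Suc n)) * hermite1 (Suc n) t)) (at t)"
proof (induction n t rule: hermite1.induct)
  case (1 t)
  have "(hermite1 0 has_real_derivative (- t * hermite1 0 t)) (at t)"
    unfolding hermite1.simps[abs_def]
    by (auto intro!: derivative_eq_intros simp: field_simps)
  moreover have "t * hermite1 0 t - sqrt (2 * real (Suc 0)) * hermite1 (Suc 0) t = - t * hermite1 0 t"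
    using hermite1_rec[of t 0] by simp
  ultimately show ?case by metis
next
  case (2 t)
  have "t * hermite1 0 t - sqrt (2 * real (Suc 0)) * hermite1 (Suc 0) t = - t * hermite1 0 t"
    using hermite1_rec[of t 0] by simp
  with 2 have D: "(hermite1 0 has_real_derivative (- t * hermite1 0 t)) (at t)"
    by metis
  have "((\<lambda>t. sqrt 2 * t * hermite1 0 t) has_real_derivative (sqrt 2 * hermite1 0 t - t * hermite1 (Suc 0) t)) (at t)"
    by (rule derivative_eq_intros D refl | simp add: algebra_simps)+
  moreover have "hermite1 (Suc 0) = (\<lambda>t. sqrt 2 * t * hermite1 0 t)"
    by (rule ext) (simp del: hermite1.simps(1))
  ultimately have "(hermite1 (Suc 0) has_real_derivative (sqrt 2 * hermite1 0 t - t * hermite1 (Suc 0) t)) (at t)"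
    by metis
  then show ?case
    by (rule DERIV_cong) (use hermite1_rec[of t "Suc 0"] in \<open>simp del: hermite1.simps\<close>)
next
  case (3 n t)
  let ?h = "\<lambda>k. hermite1 k t"
  define a b where "a = sqrt (real (Suc n))" and "b = sqrt (real (Suc (Suc n)))"
  have b0: "b \<noteq> 0" and a2: "a * a = real (Suc n)" and b2: "b * b = real (Suc (Suc n))"
    by (simp_all add: a_def b_def)
  have s2: "sqrt 2 * sqrt 2 = (2::real)" by simp
  have [simp]: "sqrt (2 * real k) = sqrt 2 * sqrt (real k)" for k by (simp add: real_sqrt_mult)
  have D1: "(hermite1 (Suc n) has_real_derivative (sqrt 2 * a * ?h n - t * ?h (Suc n))) (at t)"
    using hermite1_rec[of t "Suc n"]
    by (intro DERIV_cong[OF "3.IH"(1)]) (simp add: a_def del: hermite1.simps of_nat_Suc)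
  have D0: "(hermite1 n has_real_derivative (t * ?h n - sqrt 2 * a * ?h (Suc n))) (at t)"
    using "3.IH"(2) by (simp add: a_def del: hermite1.simps of_nat_Suc)
  have E: "hermite1 (Suc (Suc n)) = (\<lambda>t. (sqrt 2 * t * hermite1 (Suc n) t - a * hermite1 n t) / b)"
    by (rule ext) (simp add: a_def b_def)
  have bh: "b * ?h (Suc (Suc n)) = sqrt 2 * t * ?h (Suc n) - a * ?h n"
    unfolding E using b0 by simp
  have "((\<lambda>t. (sqrt 2 * t * hermite1 (Suc n) t - a * hermite1 n t) / b) has_real_derivative
      ((sqrt 2 * ?h (Suc n) + sqrt 2 * t * (sqrt 2 * a * ?h n - t * ?h (Suc n))
        - a * (t * ?h n - sqrt 2 * a * ?h (Suc n))) / b)) (at t)"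
    by (intro DERIV_cdivide) (rule derivative_eq_intros D0 D1 refl | simp add: algebra_simps)+
  moreover have "(sqrt 2 * ?h (Suc n) + sqrt 2 * t * (sqrt 2 * a * ?h n - t * ?h (Suc n))
        - a * (t * ?h n - sqrt 2 * a * ?h (Suc n))) = b * (sqrt 2 * b * ?h (Suc n) - t * ?h (Suc (Suc n)))"
  proof -
    have "b * (sqrt 2 * b * ?h (Suc n) - t * ?h (Suc (Suc n))) =
        sqrt 2 * (b * b) * ?h (Suc n) - t * (b * ?h (Suc (Suc n)))"
      by (simp only: algebra_simps)
    also have "\<dots> = sqrt 2 * (1 + a * a) * ?h (Suc n) - t * (sqrt 2 * t * ?h (Suc n) - a * ?h n)"
      unfolding bh b2 a2 by simp
    also have "\<dots> = sqrt 2 * ?h (Suc n) + (sqrt 2 * sqrt 2) * t * a * ?h n - sqrt 2 * t * t * ?h (Suc n)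
        - a * t * ?h n + sqrt 2 * a * a * ?h (Suc n)"
      unfolding s2 by (simp add: algebra_simps)
    also have "\<dots> = (sqrt 2 * ?h (Suc n) + sqrt 2 * t * (sqrt 2 * a * ?h n - t * ?h (Suc n))
        - a * (t * ?h n - sqrt 2 * a * ?h (Suc n)))"
      by (simp only: algebra_simps)
    finally show ?thesis by simp
  qed
  moreover have "sqrt 2 * b * ?h (Suc n) - t * ?h (Suc (Suc n)) =
      t * ?h (Suc (Suc n)) - sqrt (2 * real (Suc (Suc (Suc n)))) * ?h (Suc (Suc (Suc n)))"
    using hermite1_rec[of t "Suc (Suc n)"] by (simp add: b_def del: hermite1.simps of_nat_Suc)
  ultimately show ?case
    unfolding E[symmetric] using b0 by (simp del: hermite1.simps of_nat_Suc)
qed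

lemma hermite1_times:
  "t * hermite1 n t = sqrt (real n / 2) * hermite1 (n - 1) t + sqrt (real (Suc n) / 2) * hermite1 (Suc n) t"
proof -
  have *: "sqrt (2 * x) = 2 * sqrt (x / 2)" for x :: real
    by (simp add: real_sqrt_mult real_sqrt_divide field_simps)
  have "2 * (t * hermite1 n t) =
      2 * (sqrt (real n / 2) * hermite1 (n - 1) t + sqrt (real (Suc n) / 2) * hermite1 (Suc n) t)"
    using hermite1_rec[of t n] unfolding * by (simp del: hermite1.simps add: algebra_simps)
  then show ?thesis by simp
qed

lemma has_derivative_hermite1:
  "(hermite1 n has_real_derivative
     (sqrt (real n / 2) * hermite1 (n - 1) t - sqrt (real (Suc n) / 2) * hermite1 (Suc n) t)) (at t)"
proof -
  have *: "sqrt (2 * x) = 2 * sqrt (x / 2)" for x :: real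
    by (simp add: real_sqrt_mult real_sqrt_divide field_simps)
  have "t * hermite1 n t - sqrt (2 * real (Suc n)) * hermite1 (Suc n) t =
      sqrt (real n / 2) * hermite1 (n - 1) t - sqrt (real (Suc n) / 2) * hermite1 (Suc n) t"
    unfolding hermite1_times * by simp
  with has_derivative_hermite1_raise[of n t] show ?thesis by simp
qed

lemma continuous_hermite1: "continuous_on UNIV (hermite1 n)"
  by (rule continuous_at_imp_continuous_on) (auto intro: DERIV_isCont has_derivative_hermite1)

lemma measurable_hermite1 [measurable]: "hermite1 n \<in> borel_measurable borel"
  by (rule borel_measurable_continuous_onI) (rule continuous_hermite1)

lemma power_div_fact_le_exp: "x ^ k / fact k \<le> exp x" if "0 \<le> x" for x :: real
proof -
  have "(\<Sum>n\<in>{k}. x ^ n /\<^sub>R fact n) \<le> (\<Sum>n. x ^ n /\<^sub>R fact n)"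
    by (rule sum_le_suminf) (use that summable_exp_generic[of x] in auto)
  then show ?thesis by (simp add: exp_def field_simps)
qed

text \<open>
  A qualitative bound with a constant that depends on \<open>n\<close>; it provides integrability and decay at infinity, from which
  the bound with controlled growth in \<open>n\<close> is obtained later.
\<close>

lemma hermite1_rapid_decay: "\<exists>C. \<forall>t. \<bar>t ^ k * hermite1 n t\<bar> \<le> C"
proof (induction n arbitrary: k rule: less_induct)
  case (less n)
  consider "n = 0" | m where "n = Suc m" by (cases n) auto
  then show ?case
  proof cases
    case 1
    have "\<bar>t ^ k * exp (- (t\<^sup>2 / 2))\<bar> \<le> 1 + 2 ^ k * fact k" for t :: real
    proof -
      have "\<bar>t\<bar> ^ k \<le> 1 + (\<bar>t\<bar> ^ k)\<^sup>2"
      proof -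
        have "0 \<le> \<bar>t\<bar> ^ k" by simp
        moreover have "0 \<le> (\<bar>t\<bar> ^ k)\<^sup>2 - 2 * \<bar>t\<bar> ^ k + 1"
          using zero_le_power2[of "\<bar>t\<bar> ^ k - 1"] unfolding power2_diff by simp
        ultimately show ?thesis by linarith
      qed
      also have "\<dots> = 1 + 2 ^ k * fact k * ((t\<^sup>2 / 2) ^ k / fact k)"
      proof -
        have "(\<bar>t\<bar> ^ k)\<^sup>2 = (t\<^sup>2) ^ k"
          unfolding power2_abs[of t, symmetric] power_mult[symmetric] by (simp only: mult.commute)
        then show ?thesis by (simp add: power_divide)
      qed
      also have "\<dots> \<le> 1 + 2 ^ k * fact k * exp (t\<^sup>2 / 2)"
        by (intro add_left_mono mult_left_mono power_div_fact_le_exp) auto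
      finally have "\<bar>t\<bar> ^ k \<le> 1 + 2 ^ k * fact k * exp (t\<^sup>2 / 2)" .
      then have "\<bar>t\<bar> ^ k * exp (- (t\<^sup>2 / 2)) \<le> (1 + 2 ^ k * fact k * exp (t\<^sup>2 / 2)) * exp (- (t\<^sup>2 / 2))"
        by (intro mult_right_mono) auto
      also have "\<dots> = exp (- (t\<^sup>2 / 2)) + 2 ^ k * fact k"
        by (simp add: algebra_simps exp_minus)
      also have "\<dots> \<le> 1 + 2 ^ k * fact k" by simp
      finally show ?thesis by (simp add: abs_mult power_abs)
    qed
    then have "\<bar>t ^ k * hermite1 n t\<bar> \<le> pi powr (- 1 / 4) * (1 + 2 ^ k * fact k)" for t
      using 1 mult_left_mono[of "\<bar>t ^ k * exp (- (t\<^sup>2 / 2))\<bar>" "1 + 2 ^ k * fact k" "pi powr (- 1 / 4)"]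
      by (simp add: abs_mult mult_ac)
    then show ?thesis by blast
  next
    case (2 m)
    have "m < n" "m - 1 < n" using 2 by simp_all
    then obtain C D where C: "\<And>t. \<bar>t ^ Suc k * hermite1 m t\<bar> \<le> C"
      and D: "\<And>t. \<bar>t ^ k * hermite1 (m - 1) t\<bar> \<le> D"
      using less.IH by metis
    have "sqrt (2 * real (Suc m)) \<ge> 1" by simp
    have "\<bar>t ^ k * hermite1 n t\<bar> \<le> 2 * C + sqrt (2 * real m) * D" for t
    proof -
      have "\<bar>t ^ k * hermite1 n t\<bar> \<le> sqrt (2 * real (Suc m)) * \<bar>t ^ k * hermite1 n t\<bar>"
        using mult_right_mono[OF \<open>sqrt (2 * real (Suc m)) \<ge> 1\<close>, of "\<bar>t ^ k * hermite1 n t\<bar>"] by simp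
      also have "\<dots> = \<bar>t ^ k * (sqrt (2 * real (Suc m)) * hermite1 (Suc m) t)\<bar>"
        by (simp add: abs_mult 2 del: hermite1.simps)
      also have "\<dots> = \<bar>2 * (t ^ Suc k * hermite1 m t) - sqrt (2 * real m) * (t ^ k * hermite1 (m - 1) t)\<bar>"
      proof -
        have *: "sqrt (2 * real (Suc m)) * hermite1 (Suc m) t = 2 * t * hermite1 m t - sqrt (2 * real m) *
            hermite1 (m - 1) t"
          using hermite1_rec[of t m] by linarith
        show ?thesis unfolding * by (simp only: right_diff_distrib power_Suc mult_ac)
      qed
      also have "\<dots> \<le> 2 * \<bar>t ^ Suc k * hermite1 m t\<bar> + sqrt (2 * real m) * \<bar>t ^ k * hermite1 (m - 1) t\<bar>"
        by (rule order_trans[OF abs_triangle_ineq4]) (simp add: abs_mult)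
      also have "\<dots> \<le> 2 * C + sqrt (2 * real m) * D"
        by (intro add_mono mult_left_mono C D) auto
      finally show ?thesis .
    qed
    then show ?thesis by blast
  qed
qed

lemma integrable_inverse_square: "integrable lborel (\<lambda>t::real. 1 / (1 + t\<^sup>2))"
  using integrable_inverse_1_plus_square by (simp add: set_integrable_def inverse_eq_divide)

lemma inverse_square_translate:
  fixes s u :: real
  assumes "0 \<le> s" "s \<le> 1"
  shows "1 / (1 + (u + s)\<^sup>2) \<le> 3 * (1 / (1 + u\<^sup>2))"
proof -
  have "s\<^sup>2 \<le> 1" using assms by (simp add: power_le_one)
  then have "1 + u\<^sup>2 \<le> 3 * (1 + (u + s)\<^sup>2)"
    using zero_le_power2[of "u + 2 * s"] zero_le_power2[of "u + s"] by (simp add: power2_eq_square algebra_simps)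
  then show ?thesis by (simp add: divide_simps add_pos_nonneg)
qed

text \<open>
  The integral is invariant under translation, so difference quotients have integral \<open>0\<close>.  The bound on the
  derivative along unit segments makes their convergence dominated.
\<close>

lemma integral_directional_derivative_eq_0:
  fixes F D :: "'a::euclidean_space \<Rightarrow> complex" and G :: "'a \<Rightarrow> real"
  assumes F: "integrable lborel F" and G: "integrable lborel G" and b: "b \<noteq> 0"
    and D: "\<And>x. ((\<lambda>t. F (x + t *\<^sub>R b)) has_vector_derivative D x) (at 0)"
    and bound: "\<And>x t. 0 \<le> t \<Longrightarrow> t \<le> 1 \<Longrightarrow> cmod (D (x + t *\<^sub>R b)) \<le> G x"
  shows "integrable lborel D" "(LINT x|lborel. D x) = 0"
proof -
  define q where "q n x = (F (x + (1 / real (Suc n)) *\<^sub>R b) - F x) * of_nat (Suc n)" for n x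
  have D': "((\<lambda>t. F (x + t *\<^sub>R b)) has_vector_derivative D (x + t *\<^sub>R b)) (at t)" for x t
  proof -
    have "((\<lambda>u. F ((x + t *\<^sub>R b) + u *\<^sub>R b)) has_vector_derivative D (x + t *\<^sub>R b)) (at (t - t))"
      using D[of "x + t *\<^sub>R b"] by simp
    then have "((\<lambda>u. F ((x + t *\<^sub>R b) + u *\<^sub>R b)) \<circ> (\<lambda>s. s - t) has_vector_derivative 1 *\<^sub>R D (x + t *\<^sub>R b)) (at t)"
      by (intro vector_diff_chain_at) (auto intro!: derivative_eq_intros)
    then show ?thesis by (simp add: o_def algebra_simps)
  qed
  have Fm [measurable]: "F \<in> borel_measurable borel" using borel_measurable_integrable[OF F] by simp
  have shift: "has_bochner_integral lborel (\<lambda>x. F (x + c)) (LINT x|lborel. F x)" for c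
  proof -
    have "integrable (distr lborel borel ((+) c)) F" using F by (simp add: lborel_distr_plus)
    moreover have "(LINT x|distr lborel borel ((+) c). F x) = (LINT x|lborel. F x)"
      by (simp add: lborel_distr_plus)
    ultimately show ?thesis
      by (simp add: has_bochner_integral_iff integrable_distr_eq integral_distr add.commute)
  qed
  have q: "has_bochner_integral lborel (q n) 0" for n
  proof -
    have "has_bochner_integral lborel (q n) (((LINT x|lborel. F x) - (LINT x|lborel. F x)) * of_nat (Suc n))"
      unfolding q_def using F by (intro has_bochner_integral_mult_left has_bochner_integral_diff shift)
        (simp add: has_bochner_integral_integrable)
    then show ?thesis by simp
  qed
  have lim: "(\<lambda>n. q n x) \<longlonglongrightarrow> D x" for x
  proof -
    have "((\<lambda>t. norm (F (x + t *\<^sub>R b) - F x - t *\<^sub>R D x) / norm t) \<longlongrightarrow> 0) (at 0)"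
      using D[of x] by (simp add: has_vector_derivative_def has_derivative_at)
    moreover have "filterlim (\<lambda>n. 1 / real (Suc n)) (at 0) sequentially"
      using lim_1_over_n LIMSEQ_Suc[OF lim_1_over_n] by (auto simp: filterlim_at)
    ultimately have "(\<lambda>n. norm (F (x + (1 / real (Suc n)) *\<^sub>R b) - F x - (1 / real (Suc n)) *\<^sub>R D x) /
        norm (1 / real (Suc n))) \<longlonglongrightarrow> 0"
      by (rule filterlim_compose)
    moreover have "norm (F (x + (1 / real (Suc n)) *\<^sub>R b) - F x - (1 / real (Suc n)) *\<^sub>R D x) /
        norm (1 / real (Suc n)) = norm (q n x - D x)" for n
    proof -
      have "q n x - D x = (F (x + (1 / real (Suc n)) *\<^sub>R b) - F x - (1 / real (Suc n)) *\<^sub>R D x) * of_nat (Suc n)"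
        by (simp add: q_def left_diff_distrib scaleR_conv_of_real del: of_nat_Suc)
      then show ?thesis by (simp add: norm_mult del: of_nat_Suc)
    qed
    ultimately have "(\<lambda>n. norm (q n x - D x)) \<longlonglongrightarrow> 0" by simp
    then show ?thesis by (metis LIM_zero_cancel tendsto_norm_zero_iff)
  qed
  have le: "cmod (q n x) \<le> G x" for n x
  proof -
    have "norm (F (x + (1 / real (Suc n)) *\<^sub>R b) - F (x + 0 *\<^sub>R b)) \<le> G x * norm (1 / real (Suc n) - 0)"
    proof (rule differentiable_bound[where S = "{0 .. 1 / real (Suc n)}" and f' = "\<lambda>t h. h *\<^sub>R D (x + t *\<^sub>R b)"])
      fix t assume t: "t \<in> {0..1 / real (Suc n)}"
      then have "t \<le> 1" by (auto intro: order_trans)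
      then show "onorm (\<lambda>h. h *\<^sub>R D (x + t *\<^sub>R b)) \<le> G x"
        using t bound[of t x] by (simp add: onorm_scaleR_left onorm_id)
      show "((\<lambda>t. F (x + t *\<^sub>R b)) has_derivative (\<lambda>h. h *\<^sub>R D (x + t *\<^sub>R b))) (at t within {0..1 / real (Suc n)})"
        using D'[of x t] unfolding has_vector_derivative_def by (rule has_derivative_at_withinI)
    qed auto
    then show ?thesis by (simp add: q_def norm_mult pos_le_divide_eq del: of_nat_Suc)
  qed
  have [measurable]: "q n \<in> borel_measurable borel" for n
    using q[of n] borel_measurable_integrable by (fastforce simp: has_bochner_integral_iff)
  have [measurable]: "D \<in> borel_measurable borel"
    by (rule borel_measurable_LIMSEQ_metric[of q]) (use lim in auto)
  show "integrable lborel D"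
    by (rule integrable_dominated_convergence[where s = q and w = G]) (use G lim le in auto)
  have "(\<lambda>n. LINT x|lborel. q n x) \<longlonglongrightarrow> (LINT x|lborel. D x)"
    by (rule integral_dominated_convergence[where w = G]) (use G lim le in auto)
  moreover have "(LINT x|lborel. q n x) = 0" for n using q[of n] by (simp add: has_bochner_integral_iff)
  ultimately show "(LINT x|lborel. D x) = 0" by (simp add: LIMSEQ_const_iff)
qed


lemma hermite1_inverse_square_decay: "\<exists>C. 0 \<le> C \<and> (\<forall>t. \<bar>hermite1 n t\<bar> \<le> C * (1 / (1 + t\<^sup>2)))"
proof -
  obtain C D where C: "\<And>t. \<bar>t ^ 0 * hermite1 n t\<bar> \<le> C" and D: "\<And>t. \<bar>t ^ 2 * hermite1 n t\<bar> \<le> D"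
    using hermite1_rapid_decay by metis
  have le: "\<bar>hermite1 n t\<bar> * (1 + t\<^sup>2) \<le> C + D" for t
    using C[of t] D[of t] by (simp add: abs_mult algebra_simps)
  moreover have "0 \<le> C + D" by (rule order_trans[OF _ le[of 0]]) simp
  ultimately show ?thesis by (intro exI[of _ "C + D"]) (simp add: pos_le_divide_eq add_pos_nonneg)
qed

lemma hermite1_mult_decay: "\<exists>C. 0 \<le> C \<and> (\<forall>t. \<bar>hermite1 m t * hermite1 n t\<bar> \<le> C * (1 / (1 + t\<^sup>2)))"
proof -
  obtain C where C: "0 \<le> C" "\<And>t. \<bar>hermite1 m t\<bar> \<le> C * (1 / (1 + t\<^sup>2))"
    using hermite1_inverse_square_decay by blast
  obtain D where D: "\<And>t. \<bar>t ^ 0 * hermite1 n t\<bar> \<le> D" using hermite1_rapid_decay by blast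
  have D0: "0 \<le> D" by (rule order_trans[OF _ D[of 0]]) simp
  have "\<bar>hermite1 m t\<bar> * \<bar>hermite1 n t\<bar> \<le> (C * (1 / (1 + t\<^sup>2))) * D" for t
    using C(1) C(2)[of t] D[of t] by (intro mult_mono) auto
  then have "\<bar>hermite1 m t * hermite1 n t\<bar> \<le> C * D * (1 / (1 + t\<^sup>2))" for t
    by (simp add: abs_mult mult_ac)
  then show ?thesis using C(1) D0 by (intro exI[of _ "C * D"]) simp
qed

lemma integrable_hermite1_mult: "integrable lborel (\<lambda>t. hermite1 m t * hermite1 n t)"
proof -
  obtain C where C: "\<And>t. \<bar>hermite1 m t * hermite1 n t\<bar> \<le> C * (1 / (1 + t\<^sup>2))"
    using hermite1_mult_decay by blast
  show ?thesis
  proof (rule Bochner_Integration.integrable_bound[OF integrable_mult_right[OF integrable_inverse_square, of C]])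
    show "AE t in lborel. norm (hermite1 m t * hermite1 n t) \<le> norm (C * (1 / (1 + t\<^sup>2)))"
      unfolding real_norm_def using order_trans[OF C abs_ge_self] by (intro AE_I2)
  qed simp
qed

text \<open>
  The function \<open>\<psi>\<^sub>n \<psi>\<^sub>n\<^sub>+\<^sub>1\<close> has derivative \<open>sqrt (2 (n + 1)) (\<psi>\<^sub>n\<^sup>2 - \<psi>\<^sub>n\<^sub>+\<^sub>1\<^sup>2)\<close>, so all \<open>\<psi>\<^sub>n\<close> have the same norm.
\<close>

lemma integral_hermite1_sq_Suc:
  "(LINT t|lborel. (hermite1 (Suc n) t)\<^sup>2) = (LINT t|lborel. (hermite1 n t)\<^sup>2)"
proof -
  define s where "s = sqrt (2 * real (Suc n))"
  have s: "s \<noteq> 0" and s0: "0 \<le> s" by (simp_all add: s_def)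
  define D where "D t = s * (hermite1 n t * hermite1 n t - hermite1 (Suc n) t * hermite1 (Suc n) t)" for t
  have deriv: "((\<lambda>t. hermite1 n t * hermite1 (Suc n) t) has_real_derivative D t) (at t)" for t
  proof -
    have D1: "(hermite1 (Suc n) has_real_derivative (s * hermite1 n t - t * hermite1 (Suc n) t)) (at t)"
      using hermite1_rec[of t "Suc n"]
      by (intro DERIV_cong[OF has_derivative_hermite1_raise]) (simp add: s_def del: hermite1.simps of_nat_Suc)
    show ?thesis
      using DERIV_mult[OF has_derivative_hermite1_raise[of n t] D1]
      by (simp add: D_def s_def algebra_simps del: hermite1.simps of_nat_Suc)
  qed
  obtain A where A: "0 \<le> A" "\<And>t. \<bar>hermite1 n t * hermite1 n t\<bar> \<le> A * (1 / (1 + t\<^sup>2))"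
    using hermite1_mult_decay by blast
  obtain B where B: "0 \<le> B" "\<And>t. \<bar>hermite1 (Suc n) t * hermite1 (Suc n) t\<bar> \<le> B * (1 / (1 + t\<^sup>2))"
    using hermite1_mult_decay by blast
  define K where "K = s * (A + B)"
  have K0: "0 \<le> K" using A(1) B(1) s0 by (simp add: K_def)
  have K: "\<bar>D t\<bar> \<le> K * (1 / (1 + t\<^sup>2))" for t
  proof -
    have "\<bar>D t\<bar> \<le> s * (\<bar>hermite1 n t * hermite1 n t\<bar> + \<bar>hermite1 (Suc n) t * hermite1 (Suc n) t\<bar>)"
      unfolding D_def abs_mult[of s] abs_of_nonneg[OF s0] by (intro mult_left_mono abs_triangle_ineq4 s0)
    also have "\<dots> \<le> s * (A * (1 / (1 + t\<^sup>2)) + B * (1 / (1 + t\<^sup>2)))"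
      by (intro mult_left_mono add_mono A B s0)
    finally show ?thesis by (simp add: K_def distrib_left add_divide_distrib)
  qed
  have bound: "\<bar>D (x + t)\<bar> \<le> 3 * K * (1 / (1 + x\<^sup>2))" if "0 \<le> t" "t \<le> 1" for x t
  proof -
    have "\<bar>D (x + t)\<bar> \<le> K * (1 / (1 + (x + t)\<^sup>2))" by (rule K)
    also have "\<dots> \<le> K * (3 * (1 / (1 + x\<^sup>2)))"
      using that K0 by (intro mult_left_mono inverse_square_translate)
    finally show ?thesis by (simp add: mult_ac)
  qed
  have "(LINT t|lborel. complex_of_real (D t)) = 0"
  proof (rule integral_directional_derivative_eq_0(2)[where b = "1::real"
        and F = "\<lambda>t. complex_of_real (hermite1 n t * hermite1 (Suc n) t)" and G = "\<lambda>x. 3 * K * (1 / (1 + x\<^sup>2))"])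
    show "integrable lborel (\<lambda>t. complex_of_real (hermite1 n t * hermite1 (Suc n) t))"
      by (intro integrable_of_real integrable_hermite1_mult)
    show "integrable lborel (\<lambda>x::real. 3 * K * (1 / (1 + x\<^sup>2)))"
      by (intro integrable_mult_right integrable_inverse_square)
    fix x t :: real
    have "((\<lambda>t. hermite1 n (x + t) * hermite1 (Suc n) (x + t)) has_real_derivative D x) (at 0)"
      using deriv[of x] DERIV_shift[of "\<lambda>t. hermite1 n t * hermite1 (Suc n) t" "D x" 0 x]
      by (simp add: add.commute del: hermite1.simps)
    then show "((\<lambda>t. complex_of_real (hermite1 n (x + t *\<^sub>R 1) * hermite1 (Suc n) (x + t *\<^sub>R 1)))
        has_vector_derivative complex_of_real (D x)) (at 0)"
      unfolding has_real_derivative_iff_has_vector_derivative real_scaleR_def mult_1_right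
      by (rule bounded_linear.has_vector_derivative[OF bounded_linear_of_real])
    show "cmod (complex_of_real (D (x + t *\<^sub>R 1))) \<le> 3 * K * (1 / (1 + x\<^sup>2))" if "0 \<le> t" "t \<le> 1"
      using bound[OF that, of x] by simp
  qed auto
  then have "(LINT t|lborel. D t) = 0" by simp
  moreover have "(LINT t|lborel. D t) = s * ((LINT t|lborel. (hermite1 n t)\<^sup>2) - (LINT t|lborel. (hermite1 (Suc n)
      t)\<^sup>2))"
    unfolding D_def power2_eq_square
    by (simp add: integrable_hermite1_mult Bochner_Integration.integral_diff del: hermite1.simps)
  ultimately show ?thesis using s by simp
qed

lemma nn_integral_gaussian: "(\<integral>\<^sup>+t. ennreal (exp (- t\<^sup>2)) \<partial>lborel) = ennreal (sqrt pi)"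
proof -
  have "has_bochner_integral lborel (\<lambda>t::real. exp (- t\<^sup>2)) (2 *\<^sub>R (sqrt pi / 2))"
    by (rule has_bochner_integral_even_function[OF gaussian_moment_0]) simp
  then show ?thesis by (simp add: has_bochner_integral_iff nn_integral_eq_integral)
qed

lemma integral_hermite1_sq: "has_bochner_integral lborel (\<lambda>t. (hermite1 n t)\<^sup>2) 1"
proof -
  have int: "integrable lborel (\<lambda>t. (hermite1 n t)\<^sup>2)" for n
    using integrable_hermite1_mult[of n n] by (simp add: power2_eq_square)
  have "(LINT t|lborel. (hermite1 n t)\<^sup>2) = 1"
  proof (induction n)
    case 0
    have "(hermite1 0 t)\<^sup>2 = exp (- t\<^sup>2) / sqrt pi" for t
    proof -
      have "(pi powr (- 1 / 4))\<^sup>2 = 1 / sqrt pi"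
      proof -
        have "(pi powr (- 1 / 4))\<^sup>2 = pi powr - (1 / 2)"
          unfolding power2_eq_square powr_add[symmetric] by simp
        then show ?thesis by (simp add: powr_minus_divide powr_half_sqrt)
      qed
      moreover have "(exp (- (t\<^sup>2 / 2)))\<^sup>2 = exp (- t\<^sup>2)"
        by (simp flip: exp_double)
      ultimately show ?thesis by (simp add: power_mult_distrib)
    qed
    then have "(\<integral>\<^sup>+t. ennreal ((hermite1 0 t)\<^sup>2) \<partial>lborel) = (\<integral>\<^sup>+t. ennreal (1 / sqrt pi) * ennreal (exp (- t\<^sup>2)) \<partial>lborel)"
      by (intro nn_integral_cong) (simp add: ennreal_mult[symmetric] del: hermite1.simps)
    also have "\<dots> = ennreal (1 / sqrt pi) * ennreal (sqrt pi)"
      by (subst nn_integral_cmult) (simp_all add: nn_integral_gaussian)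
    also have "\<dots> = 1" by (simp add: ennreal_mult[symmetric])
    finally show ?case by (simp add: integral_eq_nn_integral del: hermite1.simps)
  qed (simp add: integral_hermite1_sq_Suc del: hermite1.simps)
  with int show ?thesis by (simp add: has_bochner_integral_iff)
qed

text \<open>
  A one-dimensional Sobolev inequality: \<open>\<psi>\<^sub>n\<^sup>2\<close> vanishes at infinity and its derivative \<open>2 \<psi>\<^sub>n \<psi>\<^sub>n'\<close> has an integral
  that is controlled by the ladder relations, so the supremum grows at most polynomially in \<open>n\<close>.
\<close>

lemma hermite1_bounded: "\<bar>hermite1 n x\<bar> \<le> 2 * (real n + 1)"
proof -
  define a b where "a = sqrt (real n / 2)" and "b = sqrt (real (Suc n) / 2)"
  define d where "d t = a * hermite1 (n - 1) t - b * hermite1 (Suc n) t" for t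
  \<comment> \<open>\<open>B\<close> dominates the derivative of \<open>\<psi>\<^sub>n\<^sup>2\<close> and has integral \<open>2 n + 2\<close>.\<close>
  define B where "B t = (hermite1 n t)\<^sup>2 + 2 * a\<^sup>2 * (hermite1 (n - 1) t)\<^sup>2 + 2 * b\<^sup>2 * (hermite1 (Suc n) t)\<^sup>2" for t
  have a2: "2 * a\<^sup>2 = real n" and b2: "2 * b\<^sup>2 = real n + 1" by (simp_all add: a_def b_def)
  have B: "has_bochner_integral lborel B (1 + 2 * a\<^sup>2 * 1 + 2 * b\<^sup>2 * 1)"
    unfolding B_def by (intro has_bochner_integral_add has_bochner_integral_mult_right integral_hermite1_sq)
  have le: "\<bar>2 * hermite1 n t * d t\<bar> \<le> B t" for t
  proof -
    have "(d t)\<^sup>2 \<le> 2 * (a * hermite1 (n - 1) t)\<^sup>2 + 2 * (b * hermite1 (Suc n) t)\<^sup>2"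
      using zero_le_power2[of "a * hermite1 (n - 1) t + b * hermite1 (Suc n) t"]
      by (simp add: d_def power2_diff power2_sum algebra_simps del: hermite1.simps)
    moreover have "\<bar>2 * hermite1 n t * d t\<bar> \<le> (hermite1 n t)\<^sup>2 + (d t)\<^sup>2"
      using zero_le_power2[of "hermite1 n t - d t"] zero_le_power2[of "hermite1 n t + d t"]
      by (simp add: power2_diff power2_sum abs_le_iff)
    ultimately show ?thesis by (simp add: B_def power_mult_distrib del: hermite1.simps)
  qed
  have deriv: "((\<lambda>t. (hermite1 n t)\<^sup>2) has_real_derivative 2 * hermite1 n t * d t) (at t)" for t
    using DERIV_power[OF has_derivative_hermite1[of n t], of 2]
    by (simp add: d_def a_def b_def mult_ac del: hermite1.simps of_nat_Suc)
  have cont: "continuous_on S (\<lambda>t. 2 * hermite1 n t * d t)" for S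
    unfolding d_def by (intro continuous_intros continuous_on_subset[OF continuous_hermite1]) auto
  have diff: "(hermite1 n x)\<^sup>2 \<le> (hermite1 n y)\<^sup>2 + (2 * real n + 2)" if "y \<le> x" for y
  proof -
    have "has_bochner_integral lborel (\<lambda>t. indicator {y..x} t *\<^sub>R (2 * hermite1 n t *
        d t)) ((hermite1 n x)\<^sup>2 - (hermite1 n y)\<^sup>2)"
      using that cont deriv
      by (intro has_bochner_integral_FTC_Icc) (auto simp: has_real_derivative_iff_has_vector_derivative[symmetric]
          intro: DERIV_subset simp del: hermite1.simps)
    moreover have "indicator {y..x} t *\<^sub>R (2 * hermite1 n t * d t) \<le> B t" for t
    proof -
      have "0 \<le> B t" by (simp add: B_def)
      then show ?thesis using le[of t] by (auto simp: indicator_def)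
    qed
    ultimately have "(hermite1 n x)\<^sup>2 - (hermite1 n y)\<^sup>2 \<le> 1 + 2 * a\<^sup>2 * 1 + 2 * b\<^sup>2 * 1"
      using B integral_mono[of lborel "\<lambda>t. indicator {y..x} t *\<^sub>R (2 * hermite1 n t * d t)" B]
      unfolding has_bochner_integral_iff by metis
    then show ?thesis using a2 b2 by simp
  qed
  obtain C where C: "\<And>t. \<bar>t ^ 1 * hermite1 n t\<bar> \<le> C" using hermite1_rapid_decay by metis
  have "((\<lambda>y. (C / y)\<^sup>2 + (2 * real n + 2)) \<longlongrightarrow> 0\<^sup>2 + (2 * real n + 2)) at_bot"
    by (intro tendsto_intros tendsto_divide_0[OF tendsto_const] filterlim_mono[OF filterlim_ident
        at_bot_le_at_infinity order_refl])
  moreover have "eventually (\<lambda>y. (hermite1 n x)\<^sup>2 \<le> (C / y)\<^sup>2 + (2 * real n + 2)) at_bot"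
  proof (rule eventually_at_bot_linorderI[of "min x (-1)"])
    fix y assume y: "y \<le> min x (-1)"
    then have "\<bar>hermite1 n y\<bar> \<le> \<bar>C / y\<bar>"
      using C[of y] by (simp add: abs_mult field_simps)
    then have "(hermite1 n y)\<^sup>2 \<le> (C / y)\<^sup>2" by (rule abs_le_square_iff[THEN iffD1])
    then show "(hermite1 n x)\<^sup>2 \<le> (C / y)\<^sup>2 + (2 * real n + 2)" using diff[of y] y by simp
  qed
  ultimately have "(hermite1 n x)\<^sup>2 \<le> 0\<^sup>2 + (2 * real n + 2)"
    by (intro tendsto_lowerbound) auto
  also have "\<dots> \<le> (2 * (real n + 1))\<^sup>2" by (simp add: power2_eq_square algebra_simps)
  finally show ?thesis by (simp add: abs_le_square_iff[symmetric])
qed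

text \<open>
  Each factor \<open>t\<close> is absorbed by the three-term recurrence at the cost of one power of \<open>n\<close>.
\<close>

lemma hermite1_uniform_decay:
  "\<exists>C M. 0 \<le> C \<and> (\<forall>n t. \<bar>t ^ k * hermite1 n t\<bar> \<le> C * real (Suc n) ^ M)"
proof (induction k)
  case 0
  show ?case using hermite1_bounded by (intro exI[of _ 2] exI[of _ 1]) (auto simp: algebra_simps)
next
  case (Suc k)
  then obtain C M where C: "0 \<le> C" "\<And>n t. \<bar>t ^ k * hermite1 n t\<bar> \<le> C * real (Suc n) ^ M" by blast
  have "\<bar>t ^ Suc k * hermite1 n t\<bar> \<le> (2 * C * 2 ^ M) * real (Suc n) ^ Suc M" for n t
  proof -
    have sq: "sqrt (real m / 2) \<le> real (Suc n)" if "m \<le> Suc n" for m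
      using that by (intro real_le_lsqrt) (auto simp: power2_eq_square intro: order_trans[of _ "real (Suc n)"]
          simp: algebra_simps)
    have "C * real (Suc m) ^ M \<le> C * (2 ^ M * real (Suc n) ^ M)" if "m \<le> Suc n" for m
      unfolding power_mult_distrib[symmetric] using that C by (intro mult_left_mono power_mono) auto
    then have h: "\<bar>t ^ k * hermite1 m t\<bar> \<le> C * (2 ^ M * real (Suc n) ^ M)" if "m \<le> Suc n" for m
      using C(2)[of t m] that by force
    have "t ^ Suc k * hermite1 n t =
        sqrt (real n / 2) * (t ^ k * hermite1 (n - 1) t) + sqrt (real (Suc n) / 2) * (t ^ k * hermite1 (Suc n) t)"
    proof -
      have "t ^ Suc k * hermite1 n t = t ^ k * (t * hermite1 n t)" by (simp only: power_Suc mult_ac)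
      then show ?thesis unfolding hermite1_times by (simp only: distrib_left mult_ac)
    qed
    then have "\<bar>t ^ Suc k * hermite1 n t\<bar> \<le>
        sqrt (real n / 2) * \<bar>t ^ k * hermite1 (n - 1) t\<bar> + sqrt (real (Suc n) / 2) * \<bar>t ^ k * hermite1 (Suc n) t\<bar>"
      by (simp only:) (rule order_trans[OF abs_triangle_ineq], simp add: abs_mult del: hermite1.simps)
    also have "\<dots> \<le> real (Suc n) * (C * (2 ^ M * real (Suc n) ^ M)) + real (Suc n) * (C * (2 ^ M * real (Suc n) ^ M))"
      by (intro add_mono mult_mono sq h) auto
    finally show ?thesis by (simp add: mult_ac)
  qed
  then show ?case using C(1) by (intro exI[of _ "2 * C * 2 ^ M"] exI[of _ "Suc M"]) auto
qed

section \<open>Hermite functions of several variables\<close>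

definition raise :: "'d \<Rightarrow> nat ^ 'd \<Rightarrow> nat ^ 'd" where
  "raise j \<alpha> = (\<chi> i. if i = j then Suc (\<alpha> $ i) else \<alpha> $ i)"

definition lower :: "'d \<Rightarrow> nat ^ 'd \<Rightarrow> nat ^ 'd" where
  "lower j \<alpha> = (\<chi> i. if i = j then \<alpha> $ i - 1 else \<alpha> $ i)"

lemma partial_deriv_eq: "(f has_derivative f') (at x) \<Longrightarrow> partial_deriv j f x = f' (axis j 1)"
  unfolding partial_deriv_def by (metis frechet_derivative_at)

lemma partial_derivs_append: "partial_derivs (js @ js') f = partial_derivs js (partial_derivs js' f)"
  by (induction js) simp_all

lemma has_derivative_vec_nth: "((\<lambda>x :: real ^ 'd::finite. x $ i) has_derivative (\<lambda>v. v $ i)) (at x)"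
  by (rule bounded_linear_imp_has_derivative) (rule bounded_linear_vec_nth)

lemma has_derivative_prod_coords:
  fixes f f' :: "'d::finite \<Rightarrow> real \<Rightarrow> real"
  assumes "\<And>i. (f i has_real_derivative f' i (x $ i)) (at (x $ i))"
  shows "((\<lambda>x. \<Prod>i\<in>UNIV. f i (x $ i)) has_derivative
    (\<lambda>v. \<Sum>j\<in>UNIV. v $ j * (f' j (x $ j) * (\<Prod>i\<in>UNIV - {j}. f i (x $ i))))) (at x)"
proof -
  have "((\<lambda>x. f i (x $ i)) has_derivative (\<lambda>v. v $ i * f' i (x $ i))) (at x)" for i
  proof -
    have "(f i has_derivative (*) (f' i (x $ i))) (at (x $ i))"
      using assms by (simp add: has_field_derivative_def)
    from has_derivative_compose[OF has_derivative_vec_nth this]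
    show ?thesis by (simp add: mult.commute)
  qed
  then have "((\<lambda>x. \<Prod>i\<in>UNIV. f i (x $ i)) has_derivative
    (\<lambda>v. \<Sum>j\<in>UNIV. (v $ j * f' j (x $ j)) * (\<Prod>i\<in>UNIV - {j}. f i (x $ i)))) (at x)"
    by (intro has_derivative_prod) auto
  then show ?thesis by (simp add: mult.assoc)
qed

lemma norm_vec_sq: "(norm x)\<^sup>2 = (\<Sum>i\<in>UNIV. (x $ i)\<^sup>2)" for x :: "real ^ 'd::finite"
  by (simp add: norm_vec_def L2_set_def sum_nonneg)

lemma sum_axis: "(\<Sum>i\<in>UNIV. axis j (1::real) $ i * g i) = g j" for g :: "'d::finite \<Rightarrow> real"
proof -
  have "(\<Sum>i\<in>UNIV. axis j (1::real) $ i * g i) = (\<Sum>i\<in>UNIV. if i = j then g i else 0)"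
    by (intro sum.cong) (auto simp: axis_def)
  then show ?thesis by simp
qed

text \<open>The derivatives of the one-dimensional Gaussian (Rodrigues' formula).\<close>

definition gauss_deriv :: "nat \<Rightarrow> real \<Rightarrow> real" where
  "gauss_deriv n t = (- 1) ^ n * sqrt (2 ^ n * fact n) * pi powr (1 / 4) * (exp (- (t\<^sup>2 / 2)) * hermite1 n t)"

lemma gauss_deriv_0: "gauss_deriv 0 t = exp (- t\<^sup>2)"
proof -
  have "pi powr (1 / 4) * pi powr (- 1 / 4) = 1" by (simp add: powr_add[symmetric])
  moreover have "exp (- (t\<^sup>2 / 2)) * exp (- (t\<^sup>2 / 2)) = exp (- t\<^sup>2)" by (simp add: exp_add[symmetric])
  ultimately show ?thesis by (simp add: gauss_deriv_def mult_ac)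
qed

lemma has_derivative_gauss_deriv: "(gauss_deriv n has_real_derivative gauss_deriv (Suc n) t) (at t)"
proof -
  define c where "c = (- 1) ^ n * sqrt (2 ^ n * fact n) * pi powr (1 / 4)"
  define s where "s = sqrt (2 * real (Suc n))"
  have E: "((\<lambda>t. exp (- (t\<^sup>2 / 2))) has_real_derivative (- t * exp (- (t\<^sup>2 / 2)))) (at t)"
    by (auto intro!: derivative_eq_intros)
  have "((\<lambda>t. c * (exp (- (t\<^sup>2 / 2)) * hermite1 n t)) has_real_derivative
      c * ((- t * exp (- (t\<^sup>2 / 2))) * hermite1 n t +
        (t * hermite1 n t - s * hermite1 (Suc n) t) * exp (- (t\<^sup>2 / 2)))) (at t)"
    using DERIV_cmult[OF DERIV_mult[OF E has_derivative_hermite1_raise[of n t]], of c]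
    by (simp add: s_def del: hermite1.simps of_nat_Suc)
  moreover have "gauss_deriv n = (\<lambda>t. c * (exp (- (t\<^sup>2 / 2)) * hermite1 n t))"
    by (simp add: gauss_deriv_def[abs_def] c_def)
  moreover have "c * ((- t * exp (- (t\<^sup>2 / 2))) * hermite1 n t +
        (t * hermite1 n t - s * hermite1 (Suc n) t) * exp (- (t\<^sup>2 / 2))) = gauss_deriv (Suc n) t"
  proof -
    have "sqrt (2 ^ Suc n * fact (Suc n)) = s * sqrt (2 ^ n * fact n)"
      by (simp add: s_def real_sqrt_mult[symmetric] mult_ac del: of_nat_Suc)
    then have "gauss_deriv (Suc n) t = - c * s * (exp (- (t\<^sup>2 / 2)) * hermite1 (Suc n) t)"
      by (simp add: gauss_deriv_def c_def del: hermite1.simps fact_Suc of_nat_Suc)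
    then show ?thesis by (simp add: algebra_simps del: hermite1.simps)
  qed
  ultimately show ?thesis by metis
qed

lemma partial_derivs_gaussian:
  "partial_derivs js (\<lambda>y :: real ^ 'd::finite. exp (- (norm y)\<^sup>2)) =
      (\<lambda>x. \<Prod>i\<in>UNIV. gauss_deriv (count_list js i) (x $ i))"
proof (induction js)
  case Nil
  have "exp (- (norm x)\<^sup>2) = (\<Prod>i\<in>UNIV. exp (- (x $ i)\<^sup>2))" for x :: "real ^ 'd"
    by (simp add: exp_sum[symmetric] sum_negf norm_vec_sq)
  then show ?case by (simp add: gauss_deriv_0)
next
  case (Cons j js)
  have "partial_deriv j (\<lambda>x. \<Prod>i\<in>UNIV. gauss_deriv (count_list js i) (x $ i)) x =
      (\<Prod>i\<in>UNIV. gauss_deriv (count_list (j # js) i) (x $ i))" for x :: "real ^ 'd"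
  proof -
    have "partial_deriv j (\<lambda>x. \<Prod>i\<in>UNIV. gauss_deriv (count_list js i) (x $ i)) x =
        gauss_deriv (Suc (count_list js j)) (x $ j) * (\<Prod>i\<in>UNIV - {j}. gauss_deriv (count_list js i) (x $ i))"
      by (subst partial_deriv_eq[OF has_derivative_prod_coords[where f' = "\<lambda>i. gauss_deriv (Suc (count_list js i))",
          OF has_derivative_gauss_deriv]]) (rule sum_axis)
    also have "\<dots> = gauss_deriv (count_list (j # js) j) (x $ j) *
        (\<Prod>i\<in>UNIV - {j}. gauss_deriv (count_list (j # js) i) (x $ i))"
      by (intro arg_cong2[where f = "(*)"] prod.cong) auto
    also have "\<dots> = (\<Prod>i\<in>UNIV. gauss_deriv (count_list (j # js) i) (x $ i))"
      by (rule prod.remove[symmetric]) auto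
    finally show ?thesis .
  qed
  then show ?case using Cons by auto
qed

lemma ex_list_count: "\<exists>js. \<forall>j. count_list js j = \<alpha> $ j" for \<alpha> :: "nat ^ 'd::finite"
proof -
  obtain js where "mset js = Abs_multiset (($) \<alpha>)" using ex_mset by blast
  then have "count (mset js) j = \<alpha> $ j" for j by (simp add: Abs_multiset_inverse)
  then show ?thesis by (auto simp: count_mset)
qed

lemma multi_deriv_gaussian:
  "multi_deriv \<alpha> (\<lambda>y :: real ^ 'd::finite. exp (- (norm y)\<^sup>2)) x = (\<Prod>i\<in>UNIV. gauss_deriv (\<alpha> $ i) (x $ i))"
  unfolding multi_deriv_def partial_derivs_gaussian using someI_ex[OF ex_list_count[of \<alpha>]] by simp

lemma hermite_fun_eq_prod: "hermite_fun \<alpha> x = (\<Prod>i\<in>UNIV. hermite1 (\<alpha> $ i) (x $ i))"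
  for x :: "real ^ 'd::finite"
proof -
  have one: "hermite1 n t = pi powr (- 1 / 4) * (- 1) ^ n * (2 ^ n * fact n) powr (- 1 / 2) * exp (t\<^sup>2 / 2) *
      gauss_deriv n t"
    for n t
  proof -
    have "(- 1) ^ n * (- 1) ^ n = (1::real)" by (simp add: power_mult_distrib[symmetric])
    moreover have "(2 ^ n * fact n) powr (- 1 / 2) * sqrt (2 ^ n * fact n) = (1::real)"
      by (simp add: powr_half_sqrt[symmetric] powr_add[symmetric])
    moreover have "pi powr (- 1 / 4) * pi powr (1 / 4) = 1" by (simp add: powr_add[symmetric])
    moreover have "exp (t\<^sup>2 / 2) * exp (- (t\<^sup>2 / 2)) = 1" by (simp add: exp_add[symmetric])
    moreover have "pi powr (- 1 / 4) * (- 1) ^ n * (2 ^ n * fact n) powr (- 1 / 2) * exp (t\<^sup>2 / 2) * gauss_deriv n t =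
        ((- 1) ^ n * (- 1) ^ n) * ((2 ^ n * fact n) powr (- 1 / 2) * sqrt (2 ^ n * fact n)) *
        (pi powr (- 1 / 4) * pi powr (1 / 4)) * (exp (t\<^sup>2 / 2) * exp (- (t\<^sup>2 / 2))) * hermite1 n t"
      by (simp only: gauss_deriv_def mult_ac)
    ultimately show ?thesis by (simp del: hermite1.simps)
  qed
  have "pi powr (- real CARD('d) / 4) = (\<Prod>i\<in>(UNIV :: 'd set). pi powr (- 1 / 4))"
    by (simp add: powr_realpow[symmetric] powr_powr)
  moreover have "(- 1) ^ mdeg \<alpha> = (\<Prod>i\<in>UNIV. (- 1 :: real) ^ (\<alpha> $ i))"
    by (simp add: mdeg_def power_sum)
  moreover have "(2 ^ mdeg \<alpha> * mfact \<alpha>) powr (- 1 / 2) = (\<Prod>i\<in>UNIV. (2 ^ (\<alpha> $ i) * fact (\<alpha> $ i)) powr (- 1 / 2))"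
  proof -
    have "2 ^ mdeg \<alpha> * mfact \<alpha> = (\<Prod>i\<in>UNIV. 2 ^ (\<alpha> $ i) * fact (\<alpha> $ i) :: real)"
      by (simp add: mdeg_def mfact_def power_sum prod.distrib)
    then show ?thesis by (simp add: prod_powr_distrib)
  qed
  moreover have "exp ((norm x)\<^sup>2 / 2) = (\<Prod>i\<in>UNIV. exp ((x $ i)\<^sup>2 / 2))"
    by (simp add: exp_sum[symmetric] sum_divide_distrib[symmetric] norm_vec_sq)
  ultimately show ?thesis
    unfolding hermite_fun_def multi_deriv_gaussian by (simp only: prod.distrib[symmetric] one[symmetric])
qed

lemma hermite_fun_remove:
  "hermite_fun \<alpha> x = hermite1 (\<alpha> $ j) (x $ j) * (\<Prod>i\<in>UNIV - {j}. hermite1 (\<alpha> $ i) (x $ i))"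
  "hermite_fun (raise j \<alpha>) x = hermite1 (Suc (\<alpha> $ j)) (x $ j) * (\<Prod>i\<in>UNIV - {j}. hermite1 (\<alpha> $ i) (x $ i))"
  "hermite_fun (lower j \<alpha>) x = hermite1 (\<alpha> $ j - 1) (x $ j) * (\<Prod>i\<in>UNIV - {j}. hermite1 (\<alpha> $ i) (x $ i))"
  unfolding hermite_fun_eq_prod
  by (subst prod.remove[of _ j]; auto simp: raise_def lower_def intro!: arg_cong2[where f =
      "(*)"] prod.cong simp del: hermite1.simps)+

text \<open>The matrix entries of multiplication by \<open>x\<^sub>j\<close> and of \<open>\<partial>\<^sub>j\<close> in the Hermite basis.\<close>

definition cdown :: "'d \<Rightarrow> nat ^ 'd \<Rightarrow> complex" where
  "cdown j \<alpha> = complex_of_real (sqrt (real (\<alpha> $ j) / 2))"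

definition cup :: "'d \<Rightarrow> nat ^ 'd \<Rightarrow> complex" where
  "cup j \<alpha> = complex_of_real (sqrt (real (Suc (\<alpha> $ j)) / 2))"

lemma coord_times_hermite_fun:
  "of_real (x $ j) * chermite_fun \<alpha> x = cdown j \<alpha> * chermite_fun (lower j \<alpha>) x + cup j \<alpha> * chermite_fun (raise j \<alpha>) x"
proof -
  have "x $ j * hermite_fun \<alpha> x = (x $ j * hermite1 (\<alpha> $ j) (x $ j)) * (\<Prod>i\<in>UNIV - {j}. hermite1 (\<alpha> $ i) (x $ i))"
    by (simp only: hermite_fun_remove(1)[of \<alpha> x j] mult.assoc)
  also have "\<dots> = sqrt (real (\<alpha> $ j) / 2) * hermite_fun (lower j \<alpha>) x +
      sqrt (real (Suc (\<alpha> $ j)) / 2) * hermite_fun (raise j \<alpha>) x"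
    by (simp only: hermite1_times hermite_fun_remove(2,3) distrib_right mult.assoc)
  finally show ?thesis
    unfolding cdown_def cup_def of_real_mult[symmetric] of_real_add[symmetric] by (rule arg_cong)
qed

lemma has_derivative_chermite_fun:
  "(chermite_fun \<alpha> has_derivative
     (\<lambda>v. \<Sum>j\<in>UNIV. of_real (v $ j) * (cdown j \<alpha> * chermite_fun (lower j \<alpha>) x - cup j \<alpha> *
         chermite_fun (raise j \<alpha>) x))) (at x)"
proof -
  have F: "hermite_fun \<alpha> = (\<lambda>x. \<Prod>i\<in>UNIV. hermite1 (\<alpha> $ i) (x $ i))"
    by (rule ext) (rule hermite_fun_eq_prod)
  have "(hermite_fun \<alpha> has_derivative
     (\<lambda>v. \<Sum>j\<in>UNIV. v $ j * (sqrt (real (\<alpha> $ j) / 2) * hermite_fun (lower j \<alpha>) x -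
        sqrt (real (Suc (\<alpha> $ j)) / 2) * hermite_fun (raise j \<alpha>) x))) (at x)"
    using has_derivative_prod_coords[where f = "\<lambda>i. hermite1 (\<alpha> $ i)" and x = x
        and f' = "\<lambda>i t. sqrt (real (\<alpha> $ i) / 2) * hermite1 (\<alpha> $ i - 1) t - sqrt (real (Suc (\<alpha> $ i)) / 2) *
            hermite1 (Suc (\<alpha> $ i)) t",
        OF has_derivative_hermite1]
    unfolding F hermite_fun_remove(2,3)
    by (simp only: left_diff_distrib mult.assoc)
  from has_derivative_of_real[OF this] show ?thesis
    by (simp add: cdown_def cup_def)
qed

lemma sum_axis_complex: "(\<Sum>i\<in>UNIV. complex_of_real (axis j 1 $ i) * g i) = g j" for g :: "'d::finite \<Rightarrow> complex"
proof -
  have "(\<Sum>i\<in>UNIV. complex_of_real (axis j 1 $ i) * g i) = (\<Sum>i\<in>UNIV. if i = j then g i else 0)"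
    by (intro sum.cong) (auto simp: axis_def)
  then show ?thesis by simp
qed

lemma partial_deriv_chermite_fun:
  "partial_deriv j (chermite_fun \<alpha>) =
    (\<lambda>x. cdown j \<alpha> * chermite_fun (lower j \<alpha>) x + (- cup j \<alpha>) * chermite_fun (raise j \<alpha>) x)"
  by (rule ext) (simp add: partial_deriv_eq[OF has_derivative_chermite_fun] sum_axis_complex)

section \<open>Linearity of iterated partial derivatives\<close>

text \<open>
  Only derivatives of smaller order have to be differentiable; this is what the induction in \<open>smooth_chermite_fun\<close>
  has available.
\<close>

lemma partial_derivs_lincomb_aux:
  fixes f g :: "real ^ 'd::finite \<Rightarrow> complex"
  assumes "\<And>l x. length l < length js \<Longrightarrow> partial_derivs l f differentiable (at x)"
    and "\<And>l x. length l < length js \<Longrightarrow> partial_derivs l g differentiable (at x)"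
  shows "partial_derivs js (\<lambda>x. a * f x + b * g x) = (\<lambda>x. a * partial_derivs js f x + b * partial_derivs js g x)"
  using assms
proof (induction js)
  case (Cons j js)
  have "partial_derivs js (\<lambda>x. a * f x + b * g x) = (\<lambda>x. a * partial_derivs js f x + b * partial_derivs js g x)"
    using Cons by simp
  moreover have "partial_deriv j (\<lambda>x. a * partial_derivs js f x + b * partial_derivs js g x) x =
      a * partial_deriv j (partial_derivs js f) x + b * partial_deriv j (partial_derivs js g) x" for x
  proof -
    have f: "(partial_derivs js f has_derivative frechet_derivative (partial_derivs js f) (at x)) (at x)"
      and g: "(partial_derivs js g has_derivative frechet_derivative (partial_derivs js g) (at x)) (at x)"
      using Cons.prems by (auto simp: frechet_derivative_works[symmetric])
    show ?thesis
      by (subst partial_deriv_eq[OF has_derivative_add[OF has_derivative_mult_right[OF f]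
          has_derivative_mult_right[OF g]]])
         (simp add: partial_deriv_def)
  qed
  ultimately show ?case by auto
qed simp

lemma partial_derivs_lincomb:
  fixes f g :: "real ^ 'd::finite \<Rightarrow> complex"
  assumes "smooth f" "smooth g"
  shows "partial_derivs js (\<lambda>x. a * f x + b * g x) = (\<lambda>x. a * partial_derivs js f x + b * partial_derivs js g x)"
  using assms by (intro partial_derivs_lincomb_aux) (auto simp: smooth_def)

lemma smooth_lincomb:
  fixes f g :: "real ^ 'd::finite \<Rightarrow> complex"
  assumes "smooth f" "smooth g"
  shows "smooth (\<lambda>x. a * f x + b * g x)"
  unfolding smooth_def partial_derivs_lincomb[OF assms]
  using assms by (auto simp: smooth_def intro!: derivative_intros)

lemma partial_derivs_0: "partial_derivs js (\<lambda>x. 0 :: complex) = (\<lambda>x. 0)"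
  by (induction js) (auto simp: partial_deriv_eq[OF has_derivative_const])

lemma smooth_0: "smooth (\<lambda>x. 0 :: complex)"
  by (simp add: smooth_def partial_derivs_0)

lemma smooth_sum:
  fixes f :: "'i \<Rightarrow> real ^ 'd::finite \<Rightarrow> complex"
  assumes "finite I" "\<And>i. i \<in> I \<Longrightarrow> smooth (f i)"
  shows "smooth (\<lambda>x. \<Sum>i\<in>I. c i * f i x)" (is ?S)
    and "partial_derivs js (\<lambda>x. \<Sum>i\<in>I. c i * f i x) = (\<lambda>x. \<Sum>i\<in>I. c i * partial_derivs js (f i) x)" (is ?P)
proof -
  have "?S \<and> ?P" using assms
  proof (induction I)
    case empty
    then show ?case by (simp add: smooth_0 partial_derivs_0)
  next
    case (insert i I)
    then have "smooth (f i)" and s: "smooth (\<lambda>x. \<Sum>i\<in>I. c i * f i x)"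
      and p: "partial_derivs js (\<lambda>x. \<Sum>i\<in>I. c i * f i x) = (\<lambda>x. \<Sum>i\<in>I. c i * partial_derivs js (f i) x)" by auto
    note * = smooth_lincomb[OF this(1,2), of "c i" 1] partial_derivs_lincomb[OF this(1,2), of js "c i" 1]
    show ?case using * insert.hyps p by simp
  qed
  then show ?S ?P by simp_all
qed

lemma smooth_partial_deriv: "smooth f \<Longrightarrow> smooth (partial_deriv j f)"
  unfolding smooth_def using partial_derivs_append[of _ "[j]" f] by (metis partial_derivs.simps)

text \<open>
  Induction on the order for all indices at once: the innermost derivative turns \<open>h\<^sub>\<alpha>\<close> into a combination of two
  Hermite functions with one derivative less to take.
\<close>

lemma smooth_chermite_fun: "smooth (chermite_fun \<alpha>)"
proof -
  have "\<forall>\<alpha> js x. length js = n \<longrightarrow> partial_derivs js (chermite_fun (\<alpha> :: nat ^ 'a)) differentiable (at x)" for n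
  proof (induction n rule: less_induct)
    case (less n)
    show ?case
    proof (intro allI impI)
      fix \<alpha> :: "nat ^ 'a" and js :: "'a list" and x assume len: "length js = n"
      show "partial_derivs js (chermite_fun \<alpha>) differentiable (at x)"
      proof (cases js rule: rev_exhaust)
        case Nil
        then show ?thesis using has_derivative_chermite_fun by (auto simp: differentiable_def)
      next
        case (snoc js' j)
        have d: "partial_derivs l (chermite_fun \<gamma>) differentiable (at x)" if "length l \<le> length js'"
          for l :: "'a list" and \<gamma> x
        proof -
          have "length l < n" using that len snoc by simp
          from less.IH[OF this] show ?thesis by blast
        qed
        have "partial_derivs js (chermite_fun \<alpha>) = (\<lambda>x. cdown j \<alpha> * partial_derivs js' (chermite_fun (lower j \<alpha>)) x +
            (- cup j \<alpha>) * partial_derivs js' (chermite_fun (raise j \<alpha>)) x)"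
          unfolding snoc partial_derivs_append partial_derivs.simps partial_deriv_chermite_fun
          by (rule partial_derivs_lincomb_aux) (use d in auto)
        then show ?thesis using d by (auto intro!: derivative_intros)
      qed
    qed
  qed
  then show ?thesis by (auto simp: smooth_def)
qed

section \<open>Polynomial bounds for Hermite functions\<close>

lemma mdeg_lower: "mdeg (lower j \<alpha>) \<le> mdeg \<alpha>"
  unfolding mdeg_def lower_def by (intro sum_mono) auto

lemma mdeg_raise: "mdeg (raise j \<alpha>) = Suc (mdeg \<alpha>)"
proof -
  have "mdeg (raise j \<alpha>) = (\<Sum>i\<in>UNIV. \<alpha> $ i + (if i = j then 1 else 0))"
    unfolding mdeg_def raise_def by (intro sum.cong) auto
  then show ?thesis by (simp add: sum.distrib mdeg_def)
qed

lemma nth_le_mdeg: "\<alpha> $ j \<le> mdeg \<alpha>"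
  unfolding mdeg_def by (rule member_le_sum) auto

lemma prod_poly_bound:
  fixes f :: "'d::finite \<Rightarrow> nat \<Rightarrow> real"
  assumes "\<And>j. 0 \<le> C j" "\<And>j n. 0 \<le> f j n" "\<And>j n. f j n \<le> C j * real (Suc n) ^ M j"
  shows "(\<Prod>j\<in>UNIV. f j (\<alpha> $ j)) \<le> (\<Prod>j\<in>UNIV. C j) * real (Suc (mdeg \<alpha>)) ^ (\<Sum>j\<in>UNIV. M j)"
proof -
  have "(\<Prod>j\<in>UNIV. f j (\<alpha> $ j)) \<le> (\<Prod>j\<in>UNIV. C j * real (Suc (mdeg \<alpha>)) ^ M j)"
  proof (intro prod_mono conjI)
    fix j
    have "C j * real (Suc (\<alpha> $ j)) ^ M j \<le> C j * real (Suc (mdeg \<alpha>)) ^ M j"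
      using assms nth_le_mdeg[of \<alpha> j] by (intro mult_left_mono power_mono) auto
    then show "f j (\<alpha> $ j) \<le> C j * real (Suc (mdeg \<alpha>)) ^ M j" using assms(3)[of j "\<alpha> $ j"] by linarith
  qed (use assms in auto)
  then show ?thesis by (simp add: prod.distrib power_sum)
qed

lemma hermite_fun_poly_bound_0:
  "\<exists>C M. 0 \<le> C \<and> (\<forall>\<alpha> x. \<bar>mpow x \<beta> * hermite_fun \<alpha> x\<bar> \<le> C * real (Suc (mdeg \<alpha>)) ^ M)"
proof -
  have "\<forall>j. \<exists>C M. 0 \<le> C \<and> (\<forall>n t. \<bar>t ^ (\<beta> $ j) * hermite1 n t\<bar> \<le> C * real (Suc n) ^ M)"
    using hermite1_uniform_decay by blast
  then obtain C M where C: "\<And>j. 0 \<le> C j" "\<And>j n t. \<bar>t ^ (\<beta> $ j) * hermite1 n t\<bar> \<le> C j * real (Suc n) ^ M j"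
    by metis
  have "\<bar>mpow x \<beta> * hermite_fun \<alpha> x\<bar> \<le> (\<Prod>j\<in>UNIV. C j) * real (Suc (mdeg \<alpha>)) ^ (\<Sum>j\<in>UNIV. M j)" for \<alpha> x
  proof -
    have "\<bar>mpow x \<beta> * hermite_fun \<alpha> x\<bar> = (\<Prod>j\<in>UNIV. \<bar>(x $ j) ^ (\<beta> $ j) * hermite1 (\<alpha> $ j) (x $ j)\<bar>)"
      by (simp only: mpow_def hermite_fun_eq_prod prod.distrib[symmetric] abs_prod)
    also have "\<dots> \<le> (\<Prod>j\<in>UNIV. C j) * real (Suc (mdeg \<alpha>)) ^ (\<Sum>j\<in>UNIV. M j)"
      by (rule prod_poly_bound) (use C in auto)
    finally show ?thesis .
  qed
  then show ?thesis using C(1) by (intro exI[of _ "\<Prod>j\<in>UNIV. C j"] exI[of _ "\<Sum>j\<in>UNIV. M j"]) (auto intro: prod_nonneg)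
qed

lemma norm_cdown_cup: "cmod (cdown j \<alpha>) \<le> real (Suc (mdeg \<alpha>))" "cmod (cup j \<alpha>) \<le> real (Suc (mdeg \<alpha>))"
proof -
  have *: "sqrt (real m / 2) \<le> real (Suc (mdeg \<alpha>))" if "m \<le> Suc (mdeg \<alpha>)" for m
  proof -
    have "real m / 2 \<le> real (Suc (mdeg \<alpha>))" using that by simp
    also have "\<dots> \<le> (real (Suc (mdeg \<alpha>)))\<^sup>2" by (rule self_le_power) auto
    finally show ?thesis by (intro real_le_lsqrt) auto
  qed
  show "cmod (cdown j \<alpha>) \<le> real (Suc (mdeg \<alpha>))" "cmod (cup j \<alpha>) \<le> real (Suc (mdeg \<alpha>))"
    using *[of "\<alpha> $ j"] *[of "Suc (\<alpha> $ j)"] nth_le_mdeg[of \<alpha> j] by (simp_all add: cdown_def cup_def)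
qed

text \<open>
  The innermost derivative is replaced by neighbouring Hermite functions, whose coefficients are of order
  \<open>|\<alpha>|\<close>; the polynomial factor stays outside throughout.
\<close>

lemma hermite_fun_poly_bound:
  "\<exists>C M. 0 \<le> C \<and> (\<forall>\<alpha> x. cmod (of_real (mpow x \<beta>) * partial_derivs js (chermite_fun \<alpha>) x) \<le> C *
      real (Suc (mdeg \<alpha>)) ^ M)"
proof (induction js rule: rev_induct)
  case Nil
  then show ?case using hermite_fun_poly_bound_0[of \<beta>] by (simp add: norm_mult abs_mult)
next
  case (snoc j js)
  then obtain C M where C: "0 \<le> C"
    "\<And>\<alpha> x. cmod (of_real (mpow x \<beta>) * partial_derivs js (chermite_fun \<alpha>) x) \<le> C * real (Suc (mdeg \<alpha>)) ^ M"
    by blast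
  let ?h = "\<lambda>\<alpha> x. of_real (mpow x \<beta>) * partial_derivs js (chermite_fun \<alpha>) x"
  have "cmod (of_real (mpow x \<beta>) * partial_derivs (js @ [j]) (chermite_fun \<alpha>) x) \<le> 2 * (C * 2 ^ M) *
      real (Suc (mdeg \<alpha>)) ^ Suc M" for \<alpha> x
  proof -
    have h: "cmod (?h \<gamma> x) \<le> C * 2 ^ M * real (Suc (mdeg \<alpha>)) ^ M" if "mdeg \<gamma> \<le> Suc (mdeg \<alpha>)" for \<gamma>
    proof -
      have "C * real (Suc (mdeg \<gamma>)) ^ M \<le> C * (2 * real (Suc (mdeg \<alpha>))) ^ M"
        using that C(1) by (intro mult_left_mono power_mono) auto
      then show ?thesis using C(2)[of x \<gamma>] unfolding power_mult_distrib mult.assoc by linarith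
    qed
    have "of_real (mpow x \<beta>) * partial_derivs (js @ [j]) (chermite_fun \<alpha>) x =
        cdown j \<alpha> * ?h (lower j \<alpha>) x + (- cup j \<alpha>) * ?h (raise j \<alpha>) x"
      unfolding partial_derivs_append partial_derivs.simps partial_deriv_chermite_fun
        partial_derivs_lincomb[OF smooth_chermite_fun smooth_chermite_fun]
      by (simp only: distrib_left mult_ac)
    also have "cmod \<dots> \<le> cmod (cdown j \<alpha>) * cmod (?h (lower j \<alpha>) x) + cmod (cup j \<alpha>) * cmod (?h (raise j \<alpha>) x)"
      by (rule order_trans[OF norm_triangle_ineq]) (simp add: norm_mult)
    also have "\<dots> \<le> real (Suc (mdeg \<alpha>)) * (C * 2 ^ M * real (Suc (mdeg \<alpha>)) ^ M) +
        real (Suc (mdeg \<alpha>)) * (C * 2 ^ M * real (Suc (mdeg \<alpha>)) ^ M)"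
      using mdeg_lower[of j \<alpha>] by (intro add_mono mult_mono norm_cdown_cup h) (auto simp: mdeg_raise)
    finally show ?thesis by (simp add: algebra_simps)
  qed
  then show ?case using C(1) by (intro exI[of _ "2 * (C * 2 ^ M)"] exI[of _ "Suc M"]) auto
qed

text \<open>A product weight: its integrability reduces to one variable, it changes
by a bounded factor under unit translations, and it dominates every Hermite function.\<close>

definition decay_weight :: "real ^ 'd::finite \<Rightarrow> real" where
  "decay_weight x = (\<Prod>j\<in>UNIV. 1 / (1 + (x $ j)\<^sup>2))"

lemma nn_integral_prod_coords:
  fixes f :: "'d::finite \<Rightarrow> real \<Rightarrow> real"
  assumes "\<And>j. f j \<in> borel_measurable borel" "\<And>j t. 0 \<le> f j t"
  shows "(\<integral>\<^sup>+x. ennreal (\<Prod>j\<in>UNIV. f j (x $ j)) \<partial>(lborel :: (real ^ 'd) measure)) =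
      (\<Prod>j\<in>UNIV. \<integral>\<^sup>+t. ennreal (f j t) \<partial>lborel)"
proof -
  have inj: "inj (\<lambda>j::'d. axis j (1::real))" by (auto simp: inj_def axis_eq_axis)
  have B: "(Basis :: (real ^ 'd) set) = range (\<lambda>j. axis j 1)" by (auto simp: Basis_vec_def)
  define g where "g b = f (inv (\<lambda>j. axis j (1::real)) b)" for b
  have g: "g (axis j 1) = f j" for j unfolding g_def inv_f_f[OF inj, of j] ..
  have "(\<integral>\<^sup>+x. (\<Prod>b\<in>Basis. ennreal (g b (x \<bullet> b))) \<partial>(lborel :: (real ^ 'd) measure)) =
      (\<Prod>b\<in>(Basis :: (real ^ 'd) set). \<integral>\<^sup>+t. ennreal (g b t) \<partial>lborel)"
    by (rule nn_integral_lborel_prod) (use assms in \<open>auto simp: g_def\<close>)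
  then show ?thesis
    unfolding B prod.reindex[OF inj] comp_def g using assms by (simp add: inner_axis prod_ennreal)
qed

lemma decay_weight_pos: "0 < decay_weight x"
  unfolding decay_weight_def by (intro prod_pos) (auto simp: add_pos_nonneg)

lemma measurable_decay_weight [measurable]: "decay_weight \<in> borel_measurable borel"
  unfolding decay_weight_def[abs_def] by (intro borel_measurable_continuous_onI continuous_intros) (auto simp:
      add_nonneg_eq_0_iff)

lemma integrable_decay_weight: "integrable lborel decay_weight"
proof (rule integrableI_nonneg)
  have "(\<integral>\<^sup>+t. ennreal (1 / (1 + t\<^sup>2)) \<partial>lborel) < (\<infinity> :: ennreal)"
    using integrable_inverse_square by (subst nn_integral_eq_integral) auto
  then show "(\<integral>\<^sup>+x. ennreal (decay_weight x) \<partial>(lborel :: (real ^ 'a) measure)) < \<infinity>"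
    unfolding decay_weight_def by (subst nn_integral_prod_coords) (auto simp: power_less_top_ennreal)
qed (auto intro: less_imp_le decay_weight_pos)

lemma hermite_fun_decay:
  "\<exists>C M. 0 \<le> C \<and> (\<forall>\<alpha> x. \<bar>hermite_fun \<alpha> (x :: real ^ 'd::finite)\<bar> \<le> C * real (Suc (mdeg \<alpha>)) ^ M * decay_weight x)"
proof -
  obtain C M where C: "0 \<le> C" "\<And>n t. \<bar>t ^ 0 * hermite1 n t\<bar> \<le> C * real (Suc n) ^ M" using hermite1_uniform_decay
      by metis
  obtain D N where D: "0 \<le> D" "\<And>n t. \<bar>t ^ 2 * hermite1 n t\<bar> \<le> D * real (Suc n) ^ N" using hermite1_uniform_decay
      by metis
  have one: "(1 + t\<^sup>2) * \<bar>hermite1 n t\<bar> \<le> (C + D) * real (Suc n) ^ (M + N)" for n t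
  proof -
    have "C * real (Suc n) ^ M \<le> C * real (Suc n) ^ (M + N)" "D * real (Suc n) ^ N \<le> D * real (Suc n) ^ (M + N)"
      using C D by (auto intro!: mult_left_mono power_increasing)
    then show ?thesis using C(2)[of t n] D(2)[of t n] by (simp add: abs_mult algebra_simps)
  qed
  have "\<bar>hermite_fun \<alpha> x\<bar> \<le> (C + D) ^ CARD('d) * real (Suc (mdeg \<alpha>)) ^ (CARD('d) * (M + N)) * decay_weight x"
      for \<alpha> and x :: "real ^ 'd"
  proof -
    have "(\<Prod>j\<in>UNIV. (1 + (x $ j)\<^sup>2) * \<bar>hermite1 (\<alpha> $ j) (x $ j)\<bar>) \<le> (\<Prod>j\<in>(UNIV::'d set). C + D) *
        real (Suc (mdeg \<alpha>)) ^ (\<Sum>j\<in>(UNIV::'d set). M + N)"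
      by (rule prod_poly_bound) (use C(1) D(1) one in auto)
    moreover have "(\<Prod>j\<in>UNIV. (1 + (x $ j)\<^sup>2) * \<bar>hermite1 (\<alpha> $ j) (x $ j)\<bar>) = \<bar>hermite_fun \<alpha> x\<bar> / decay_weight x"
      unfolding hermite_fun_eq_prod decay_weight_def prod.distrib abs_prod by (simp add: prod_dividef mult.commute)
    ultimately show ?thesis using decay_weight_pos[of x] by (simp add: pos_divide_le_eq)
  qed
  then show ?thesis using C(1) D(1)
    by (intro exI[of _ "(C + D) ^ CARD('d)"] exI[of _ "CARD('d) * (M + N)"]) auto
qed

lemma decay_weight_translate:
  assumes "0 \<le> t" "t \<le> 1"
  shows "decay_weight (x + t *\<^sub>R axis j 1) \<le> 3 ^ CARD('d) * decay_weight (x :: real ^ 'd::finite)"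
proof -
  have "decay_weight (x + t *\<^sub>R axis j 1) \<le> (\<Prod>i\<in>(UNIV::'d set). 3 * (1 / (1 + (x $ i)\<^sup>2)))"
    unfolding decay_weight_def using assms
    using inverse_square_translate[OF assms] inverse_square_translate[of 0]
    by (intro prod_mono conjI) (auto simp: axis_def)
  then show ?thesis by (simp add: decay_weight_def prod.distrib del: times_divide_eq_right)
qed

section \<open>Schwartz functions and tame operators\<close>

lemma schwartz_seminorm_upper:
  assumes "f \<in> schwartz"
  shows "cmod (of_real (mpow x \<beta>) * partial_derivs js f x) \<le> schwartz_seminorm \<beta> js f"
  unfolding schwartz_seminorm_def by (rule cSUP_upper) (use assms in \<open>auto simp: schwartz_def\<close>)

lemma schwartz_seminorm_nonneg: "f \<in> schwartz \<Longrightarrow> 0 \<le> schwartz_seminorm \<beta> js f"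
  using schwartz_seminorm_upper[of f 0 \<beta> js] norm_ge_zero order_trans by blast

lemma schwartz_smooth: "f \<in> schwartz \<Longrightarrow> smooth f"
  by (simp add: schwartz_def)

lemma mpow_0: "mpow x 0 = 1"
  by (simp add: mpow_def)

lemma schwartz_bounded_deriv: "f \<in> schwartz \<Longrightarrow> cmod (partial_derivs js f x) \<le> schwartz_seminorm 0 js f"
  using schwartz_seminorm_upper[of f x 0 js] by (simp add: mpow_0)

lemma schwartz_bounded_fun: "f \<in> schwartz \<Longrightarrow> cmod (f x) \<le> schwartz_seminorm 0 [] f"
  using schwartz_bounded_deriv[of f "[]" x] by simp

text \<open>
  The seminorms are labelled by the multi-index of the polynomial weight and the list of differentiations.
\<close>

definition seminorm_sum :: "((nat ^ 'd) \<times> 'd list) set \<Rightarrow> (real ^ 'd::finite \<Rightarrow> complex) \<Rightarrow> real" where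
  "seminorm_sum Q f = (\<Sum>q\<in>Q. schwartz_seminorm (fst q) (snd q) f)"

lemma seminorm_sum_mono:
  assumes "f \<in> schwartz" "finite R" "Q \<subseteq> R"
  shows "seminorm_sum Q f \<le> seminorm_sum R f"
  unfolding seminorm_sum_def by (rule sum_mono2) (use assms schwartz_seminorm_nonneg in auto)

lemma seminorm_sum_single: "seminorm_sum {(\<beta>, js)} f = schwartz_seminorm \<beta> js f"
  by (simp add: seminorm_sum_def)

text \<open>Allowing finitely many seminorms instead of one makes this notion closed under sums.\<close>

definition seminorm_dominated :: "((real ^ 'd::finite \<Rightarrow> complex) \<Rightarrow> real) \<Rightarrow> bool" where
  "seminorm_dominated p \<longleftrightarrow> (\<exists>Q C. finite Q \<and> 0 \<le> C \<and> (\<forall>f\<in>schwartz. p f \<le> C * seminorm_sum Q f))"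

lemma seminorm_dominated_mono:
  "seminorm_dominated p \<Longrightarrow> (\<And>f. f \<in> schwartz \<Longrightarrow> p' f \<le> p f) \<Longrightarrow> seminorm_dominated p'"
  unfolding seminorm_dominated_def by (meson order_trans)

lemma seminorm_dominated_seminorm: "seminorm_dominated (schwartz_seminorm \<beta> js)"
  unfolding seminorm_dominated_def
  by (rule exI[of _ "{(\<beta>, js)}"], rule exI[of _ 1]) (simp add: seminorm_sum_single)

lemma seminorm_dominated_cmult:
  assumes "seminorm_dominated p" "0 \<le> a"
  shows "seminorm_dominated (\<lambda>f. a * p f)"
proof -
  obtain Q C where Q: "finite Q" "0 \<le> C" "\<And>f. f \<in> schwartz \<Longrightarrow> p f \<le> C * seminorm_sum Q f"
    using assms(1) unfolding seminorm_dominated_def by blast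
  then have "a * p f \<le> (a * C) * seminorm_sum Q f" if "f \<in> schwartz" for f
    using that mult_left_mono[OF Q(3) assms(2)] by (simp add: mult.assoc)
  then show ?thesis
    unfolding seminorm_dominated_def using Q assms(2)
    by (intro exI[of _ Q] exI[of _ "a * C"]) simp
qed

lemma seminorm_dominated_add:
  assumes "seminorm_dominated p" "seminorm_dominated p'"
  shows "seminorm_dominated (\<lambda>f. p f + p' f)"
proof -
  obtain Q C where Q: "finite Q" "0 \<le> C" "\<And>f. f \<in> schwartz \<Longrightarrow> p f \<le> C * seminorm_sum Q f"
    using assms(1) unfolding seminorm_dominated_def by blast
  obtain R D where R: "finite R" "0 \<le> D" "\<And>f. f \<in> schwartz \<Longrightarrow> p' f \<le> D * seminorm_sum R f"
    using assms(2) unfolding seminorm_dominated_def by blast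
  have "p f + p' f \<le> (C + D) * seminorm_sum (Q \<union> R) f" if f: "f \<in> schwartz" for f
  proof -
    have "C * seminorm_sum Q f \<le> C * seminorm_sum (Q \<union> R) f" "D * seminorm_sum R f \<le> D * seminorm_sum (Q \<union> R) f"
      using Q R f by (auto intro!: mult_left_mono seminorm_sum_mono)
    then show ?thesis using Q(3)[OF f] R(3)[OF f] by (simp add: distrib_right)
  qed
  then show ?thesis
    unfolding seminorm_dominated_def using Q R
    by (intro exI[of _ "Q \<union> R"] exI[of _ "C + D"]) simp
qed

lemma seminorm_dominated_0: "seminorm_dominated (\<lambda>f. 0)"
  unfolding seminorm_dominated_def by (rule exI[of _ "{}"], rule exI[of _ 0]) simp

lemma seminorm_dominated_sum:
  assumes "finite I" "\<And>i. i \<in> I \<Longrightarrow> seminorm_dominated (p i)"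
  shows "seminorm_dominated (\<lambda>f. \<Sum>i\<in>I. p i f)"
  using assms by (induction I) (auto intro: seminorm_dominated_0 seminorm_dominated_add)

text \<open>
  For linear operators on the Schwartz space this is continuity.
\<close>

definition tame :: "((real ^ 'd::finite \<Rightarrow> complex) \<Rightarrow> real ^ 'd \<Rightarrow> complex) \<Rightarrow> bool" where
  "tame A \<longleftrightarrow> (\<forall>f\<in>schwartz. A f \<in> schwartz) \<and> (\<forall>\<beta> js. seminorm_dominated (\<lambda>f. schwartz_seminorm \<beta> js (A f)))"

lemma tame_schwartz: "tame A \<Longrightarrow> f \<in> schwartz \<Longrightarrow> A f \<in> schwartz"
  by (simp add: tame_def)

lemma tameI:
  assumes smooth: "\<And>f. f \<in> schwartz \<Longrightarrow> smooth (A f)"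
    and dom: "\<And>\<beta> js. \<exists>p. seminorm_dominated p \<and>
      (\<forall>f\<in>schwartz. \<forall>x. cmod (of_real (mpow x \<beta>) * partial_derivs js (A f) x) \<le> p f)"
  shows "tame A"
  unfolding tame_def
proof (intro conjI ballI allI)
  fix f :: "real ^ 'a \<Rightarrow> complex" assume f: "f \<in> schwartz"
  have "bdd_above (range (\<lambda>x. cmod (of_real (mpow x \<beta>) * partial_derivs js (A f) x)))" for \<beta> js
  proof -
    obtain p where p: "\<And>x. cmod (of_real (mpow x \<beta>) * partial_derivs js (A f) x) \<le> p f"
      using dom[of \<beta> js] f by blast
    show ?thesis by (rule bdd_aboveI2) (rule p)
  qed
  then show "A f \<in> schwartz" using smooth[OF f] by (simp add: schwartz_def)
next
  fix \<beta> js
  obtain p where p: "seminorm_dominated p"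
    "\<And>f x. f \<in> schwartz \<Longrightarrow> cmod (of_real (mpow x \<beta>) * partial_derivs js (A f) x) \<le> p f"
    using dom[of \<beta> js] by blast
  show "seminorm_dominated (\<lambda>f. schwartz_seminorm \<beta> js (A f))"
    by (rule seminorm_dominated_mono[OF p(1)]) (auto simp: schwartz_seminorm_def intro!: cSUP_least p(2))
qed

lemma seminorm_dominated_tame:
  assumes "seminorm_dominated p" "tame A"
  shows "seminorm_dominated (\<lambda>f. p (A f))"
proof -
  obtain Q C where Q: "finite Q" "0 \<le> C" "\<And>f. f \<in> schwartz \<Longrightarrow> p f \<le> C * seminorm_sum Q f"
    using assms(1) unfolding seminorm_dominated_def by blast
  have "seminorm_dominated (\<lambda>f. C * seminorm_sum Q (A f))"
    unfolding seminorm_sum_def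
    by (intro seminorm_dominated_cmult seminorm_dominated_sum Q) (use assms(2) in \<open>auto simp: tame_def\<close>)
  then show ?thesis
    by (rule seminorm_dominated_mono) (use Q(3) tame_schwartz[OF assms(2)] in blast)
qed

text \<open>
  Seminorms of \<open>A (B f)\<close> are dominated by seminorms of \<open>B f\<close>, and these in turn by seminorms of \<open>f\<close>.
\<close>

lemma tame_comp: "tame A \<Longrightarrow> tame B \<Longrightarrow> tame (\<lambda>f. A (B f))"
  unfolding tame_def[of "\<lambda>f. A (B f)"]
  by (auto intro: tame_schwartz seminorm_dominated_tame[of _ B] simp: tame_def[of A])

lemma tame_id: "tame (\<lambda>f. f)"
  by (simp add: tame_def seminorm_dominated_seminorm)

lemma tame_funpow: "tame A \<Longrightarrow> tame (A ^^ n)"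
proof (induction n)
  case 0
  then show ?case using tame_id by (simp add: id_def)
next
  case (Suc n)
  then show ?case using tame_comp[of A "A ^^ n"] by (simp add: comp_def)
qed

lemma tame_partial_deriv: "tame (partial_deriv j)"
proof (rule tameI)
  fix \<beta> js
  have "partial_derivs js (partial_deriv j f) = partial_derivs (js @ [j]) f" for f :: "real ^ 'a \<Rightarrow> complex"
    by (simp add: partial_derivs_append)
  then show "\<exists>p. seminorm_dominated p \<and>
      (\<forall>f\<in>schwartz. \<forall>x. cmod (of_real (mpow x \<beta>) * partial_derivs js (partial_deriv j f) x) \<le> p f)"
    using seminorm_dominated_seminorm[of \<beta> "js @ [j]"] schwartz_seminorm_upper by metis
qed (simp add: smooth_partial_deriv schwartz_smooth)

lemma weighted_partial_derivs_lincomb_le: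
  assumes "f \<in> schwartz" "g \<in> schwartz"
  shows "cmod (of_real (mpow x \<beta>) * partial_derivs js (\<lambda>x. a * f x + b * g x) x) \<le>
    cmod a * schwartz_seminorm \<beta> js f + cmod b * schwartz_seminorm \<beta> js g"
proof -
  have "of_real (mpow x \<beta>) * partial_derivs js (\<lambda>x. a * f x + b * g x) x =
      a * (of_real (mpow x \<beta>) * partial_derivs js f x) + b * (of_real (mpow x \<beta>) * partial_derivs js g x)"
    by (simp add: partial_derivs_lincomb[OF assms[THEN schwartz_smooth]] algebra_simps)
  also have "cmod \<dots> \<le> cmod a * cmod (of_real (mpow x \<beta>) * partial_derivs js f x) +
      cmod b * cmod (of_real (mpow x \<beta>) * partial_derivs js g x)"
    by (rule order_trans[OF norm_triangle_ineq]) (simp add: norm_mult)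
  also have "\<dots> \<le> cmod a * schwartz_seminorm \<beta> js f + cmod b * schwartz_seminorm \<beta> js g"
    by (intro add_mono mult_left_mono schwartz_seminorm_upper assms) auto
  finally show ?thesis .
qed

lemma schwartz_lincomb:
  assumes "f \<in> schwartz" "g \<in> schwartz"
  shows "(\<lambda>x. a * f x + b * g x) \<in> schwartz"
proof -
  have "bdd_above (range (\<lambda>x. cmod (of_real (mpow x \<beta>) * partial_derivs js (\<lambda>x. a * f x + b * g x) x)))" for \<beta> js
    by (rule bdd_aboveI2) (rule weighted_partial_derivs_lincomb_le[OF assms])
  then show ?thesis using assms by (auto simp: schwartz_def intro!: smooth_lincomb)
qed

lemma tame_lincomb:
  assumes A: "tame A" and B: "tame B"
  shows "tame (\<lambda>f x. a * A f x + b * B f x)"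
proof (rule tameI)
  fix f :: "real ^ 'a \<Rightarrow> complex" assume "f \<in> schwartz"
  then show "smooth (\<lambda>x. a * A f x + b * B f x)"
    using A B by (intro smooth_lincomb schwartz_smooth) (auto intro: tame_schwartz)
next
  fix \<beta> js
  show "\<exists>p. seminorm_dominated p \<and> (\<forall>f\<in>schwartz. \<forall>x.
      cmod (of_real (mpow x \<beta>) * partial_derivs js (\<lambda>x. a * A f x + b * B f x) x) \<le> p f)"
  proof (intro exI conjI ballI allI)
    show "seminorm_dominated (\<lambda>f. cmod a * schwartz_seminorm \<beta> js (A f) + cmod b * schwartz_seminorm \<beta> js (B f))"
      using A B by (intro seminorm_dominated_add seminorm_dominated_cmult) (auto simp: tame_def)
  qed (rule weighted_partial_derivs_lincomb_le[OF tame_schwartz[OF A] tame_schwartz[OF B]])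
qed

lemma tame_0: "tame (\<lambda>f x. 0)"
proof (rule tameI)
  fix \<beta> js
  show "\<exists>p. seminorm_dominated p \<and>
      (\<forall>f\<in>schwartz. \<forall>x. cmod (of_real (mpow x \<beta>) * partial_derivs js (\<lambda>x. 0) x) \<le> p f)"
    by (intro exI[of _ "\<lambda>_. 0"] conjI seminorm_dominated_0) (simp add: partial_derivs_0)
qed (rule smooth_0)

lemma tame_sum:
  assumes "finite I" "\<And>i. i \<in> I \<Longrightarrow> tame (A i)"
  shows "tame (\<lambda>f x. \<Sum>i\<in>I. A i f x)"
  using assms
proof (induction I)
  case (insert i I)
  then show ?case using tame_lincomb[of "A i" "\<lambda>f x. \<Sum>i\<in>I. A i f x" 1 1] by simp
qed (simp add: tame_0)

text \<open>The correction terms in Leibniz' rule arise by deleting one occurrence of \<open>j\<close> from \<open>js\<close>,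
so no derivatives have to be interchanged.\<close>

lemma partial_derivs_coord:
  "\<exists>L. \<forall>f x. smooth f \<longrightarrow> partial_derivs js (\<lambda>x. of_real (x $ j) * f x) x =
      of_real (x $ j) * partial_derivs js f x + (\<Sum>l\<leftarrow>L. partial_derivs l (f :: real ^ 'd::finite \<Rightarrow> complex) x)"
proof (induction js)
  case Nil
  show ?case by (intro exI[of _ "[]"]) simp
next
  case (Cons i js)
  then obtain L where L: "\<And>f x. smooth f \<Longrightarrow> partial_derivs js (\<lambda>x. of_real (x $ j) * f x) x =
      of_real (x $ j) * partial_derivs js f x + (\<Sum>l\<leftarrow>L. partial_derivs l (f :: real ^ 'd \<Rightarrow> complex) x)"
    by blast
  define L' where "L' = (if i = j then [js] else []) @ map ((#) i) L"
  have "partial_derivs (i # js) (\<lambda>x. of_real (x $ j) * f x) x =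
      of_real (x $ j) * partial_derivs (i # js) f x + (\<Sum>l\<leftarrow>L'. partial_derivs l f x)"
    if f: "smooth f" for f :: "real ^ 'd \<Rightarrow> complex" and x
  proof -
    have D: "(partial_derivs l f has_derivative frechet_derivative (partial_derivs l f) (at x)) (at x)" for l
      using f by (auto simp: frechet_derivative_works[symmetric] smooth_def)
    have S: "((\<lambda>x. \<Sum>l\<leftarrow>M. partial_derivs l f x) has_derivative
        (\<lambda>v. \<Sum>l\<leftarrow>M. frechet_derivative (partial_derivs l f) (at x) v)) (at x)" for M
      by (induction M) (auto intro!: derivative_intros D)
    have P: "((\<lambda>x. of_real (x $ j) * partial_derivs js f x) has_derivative
        (\<lambda>v. of_real (x $ j) * frechet_derivative (partial_derivs js f) (at x) v +
          of_real (v $ j) * partial_derivs js f x)) (at x)"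
      by (rule has_derivative_mult[OF has_derivative_of_real[OF has_derivative_vec_nth] D])
    have "partial_derivs js (\<lambda>x. of_real (x $ j) * f x) =
        (\<lambda>x. of_real (x $ j) * partial_derivs js f x + (\<Sum>l\<leftarrow>L. partial_derivs l f x))"
      using L[OF f] by auto
    then have "partial_derivs (i # js) (\<lambda>x. of_real (x $ j) * f x) x =
        partial_deriv i (\<lambda>x. of_real (x $ j) * partial_derivs js f x + (\<Sum>l\<leftarrow>L. partial_derivs l f x)) x"
      by simp
    also have "\<dots> = of_real (x $ j) * partial_deriv i (partial_derivs js f) x +
        of_real (axis i 1 $ j) * partial_derivs js f x + (\<Sum>l\<leftarrow>L. partial_deriv i (partial_derivs l f) x)"
      by (subst partial_deriv_eq[OF has_derivative_add[OF P S]]) (simp add: partial_deriv_def)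
    also have "\<dots> = of_real (x $ j) * partial_derivs (i # js) f x + (\<Sum>l\<leftarrow>L'. partial_derivs l f x)"
      by (simp add: L'_def axis_def comp_def)
    finally show ?thesis .
  qed
  then show ?case by blast
qed

lemma tame_coord: "tame (\<lambda>f x. of_real (x $ j) * f x)"
proof (rule tameI)
  fix f :: "real ^ 'a \<Rightarrow> complex" assume "f \<in> schwartz"
  then have f: "smooth f" by (rule schwartz_smooth)
  show "smooth (\<lambda>x. of_real (x $ j) * f x)"
    unfolding smooth_def
  proof (intro allI)
    fix js x
    obtain L where L: "\<And>x. partial_derivs js (\<lambda>x. of_real (x $ j) * f x) x =
      of_real (x $ j) * partial_derivs js f x + (\<Sum>l\<leftarrow>L. partial_derivs l f x)"
      using partial_derivs_coord[of js j] f by blast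
    have d: "partial_derivs l f differentiable (at x)" for l using f by (simp add: smooth_def)
    have s: "(\<lambda>x. \<Sum>l\<leftarrow>M. partial_derivs l f x) differentiable (at x)" for M
      by (induction M) (auto intro!: derivative_intros d)
    have c: "(\<lambda>x. complex_of_real (x $ j)) differentiable (at x)"
      using has_derivative_of_real[OF has_derivative_vec_nth] unfolding differentiable_def by blast
    have "(\<lambda>x. of_real (x $ j) * partial_derivs js f x + (\<Sum>l\<leftarrow>L. partial_derivs l f x)) differentiable (at x)"
      by (intro differentiable_add differentiable_mult c d s)
    moreover have "partial_derivs js (\<lambda>x. of_real (x $ j) * f x) =
        (\<lambda>x. of_real (x $ j) * partial_derivs js f x + (\<Sum>l\<leftarrow>L. partial_derivs l f x))"
      by (rule ext) (rule L)
    ultimately show "partial_derivs js (\<lambda>x. of_real (x $ j) * f x) differentiable (at x)" by simp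
  qed
next
  fix \<beta> js
  obtain L where L: "\<And>f x. smooth f \<Longrightarrow> partial_derivs js (\<lambda>x. of_real (x $ j) * f x) x =
      of_real (x $ j) * partial_derivs js f x + (\<Sum>l\<leftarrow>L. partial_derivs l (f :: real ^ 'a \<Rightarrow> complex) x)"
    using partial_derivs_coord by blast
  have mp: "mpow x (raise j \<beta>) = mpow x \<beta> * x $ j" for x :: "real ^ 'a"
  proof -
    have "mpow x (raise j \<beta>) = (\<Prod>i\<in>UNIV. (x $ i) ^ (\<beta> $ i) * (if i = j then x $ i else 1))"
      unfolding mpow_def raise_def by (intro prod.cong) auto
    then show ?thesis by (simp add: prod.distrib mpow_def)
  qed
  define p where "p f = schwartz_seminorm (raise j \<beta>) js f + (\<Sum>l\<leftarrow>L. schwartz_seminorm \<beta> l f)"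
      for f :: "real ^ 'a \<Rightarrow> complex"
  have "seminorm_dominated (\<lambda>f. \<Sum>l\<leftarrow>M. schwartz_seminorm \<beta> l f)" for M
    by (induction M) (auto intro: seminorm_dominated_add seminorm_dominated_seminorm seminorm_dominated_0)
  then have "seminorm_dominated p"
    unfolding p_def by (intro seminorm_dominated_add seminorm_dominated_seminorm)
  moreover have "cmod (of_real (mpow x \<beta>) * partial_derivs js (\<lambda>x. of_real (x $ j) * f x) x) \<le> p f"
    if f: "f \<in> schwartz" for f x
  proof -
    have "of_real (mpow x \<beta>) * partial_derivs js (\<lambda>x. of_real (x $ j) * f x) x =
        of_real (mpow x (raise j \<beta>)) * partial_derivs js f x + (\<Sum>l\<leftarrow>L. of_real (mpow x \<beta>) * partial_derivs l f x)"
      unfolding L[OF schwartz_smooth[OF f]] mp sum_list_const_mult of_real_mult by (simp only: distrib_left mult_ac)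
    also have "cmod \<dots> \<le> cmod (of_real (mpow x (raise j \<beta>)) * partial_derivs js f x) +
        (\<Sum>l\<leftarrow>L. cmod (of_real (mpow x \<beta>) * partial_derivs l f x))"
    proof (intro order_trans[OF norm_triangle_ineq] add_left_mono)
      show "cmod (\<Sum>l\<leftarrow>M. of_real (mpow x \<beta>) * partial_derivs l f x) \<le>
          (\<Sum>l\<leftarrow>M. cmod (of_real (mpow x \<beta>) * partial_derivs l f x))" for M
        by (induction M) (auto intro!: order_trans[OF norm_triangle_ineq] simp del: norm_mult)
    qed
    also have "\<dots> \<le> p f"
      unfolding p_def by (intro add_mono sum_list_mono schwartz_seminorm_upper f)
    finally show ?thesis .
  qed
  ultimately show "\<exists>p. seminorm_dominated p \<and>
      (\<forall>f\<in>schwartz. \<forall>x. cmod (of_real (mpow x \<beta>) * partial_derivs js (\<lambda>x. of_real (x $ j) * f x) x) \<le> p f)"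
    by blast
qed

section \<open>Hermite coefficients of Schwartz functions\<close>

lemma smooth_continuous: "smooth f \<Longrightarrow> continuous_on UNIV f"
  unfolding smooth_def using differentiable_imp_continuous_within
  by (metis continuous_at_imp_continuous_on partial_derivs.simps(1))

lemma measurable_smooth: "smooth f \<Longrightarrow> f \<in> borel_measurable borel" for f :: "real ^ 'd::finite \<Rightarrow> complex"
  by (rule borel_measurable_continuous_onI) (rule smooth_continuous)

lemma measurable_hermite_fun [measurable]: "hermite_fun \<alpha> \<in> borel_measurable borel"
proof -
  have "(\<lambda>x. Re (chermite_fun \<alpha> x)) \<in> borel_measurable borel"
    by (rule measurable_compose[OF measurable_smooth[OF smooth_chermite_fun] borel_measurable_Re])
  then show ?thesis by simp
qed

lemma hermite_fun_L1:
  "integrable lborel (\<lambda>x :: real ^ 'd::finite. \<bar>hermite_fun \<alpha> x\<bar>)"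
  "\<exists>C M. 0 \<le> C \<and> (\<forall>\<alpha>. (LINT x|lborel. \<bar>hermite_fun \<alpha> (x :: real ^ 'd)\<bar>) \<le> C * real (Suc (mdeg \<alpha>)) ^ M)"
proof -
  obtain C M where C: "0 \<le> C" "\<And>\<alpha> x. \<bar>hermite_fun \<alpha> (x :: real ^ 'd)\<bar> \<le> C * real (Suc (mdeg \<alpha>)) ^ M * decay_weight x"
    using hermite_fun_decay by metis
  have int: "integrable lborel (\<lambda>x :: real ^ 'd. \<bar>hermite_fun \<alpha> x\<bar>)" for \<alpha>
  proof (rule Bochner_Integration.integrable_bound[OF integrable_mult_right[OF integrable_decay_weight, of "C *
      real (Suc (mdeg \<alpha>)) ^ M"]])
    show "AE x in lborel. norm \<bar>hermite_fun \<alpha> x\<bar> \<le> norm (C * real (Suc (mdeg \<alpha>)) ^ M * decay_weight x)"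
      using order_trans[OF C(2) abs_ge_self] by (intro AE_I2) simp
  qed simp
  show "integrable lborel (\<lambda>x :: real ^ 'd. \<bar>hermite_fun \<alpha> x\<bar>)" by (rule int)
  have "(LINT x|lborel. \<bar>hermite_fun \<alpha> (x :: real ^ 'd)\<bar>) \<le> (C * (LINT x|lborel. decay_weight (x :: real ^ 'd))) *
      real (Suc (mdeg \<alpha>)) ^ M" for \<alpha>
  proof -
    have "(LINT x|lborel. \<bar>hermite_fun \<alpha> (x :: real ^ 'd)\<bar>) \<le> (LINT x|lborel. C * real (Suc (mdeg \<alpha>)) ^ M *
        decay_weight (x :: real ^ 'd))"
      by (intro integral_mono int integrable_mult_right integrable_decay_weight C(2))
    then show ?thesis by (simp add: mult_ac)
  qed
  moreover have "0 \<le> C * (LINT x|lborel. decay_weight (x :: real ^ 'd))"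
    using C(1) by (intro mult_nonneg_nonneg integral_nonneg_AE) (auto intro: less_imp_le decay_weight_pos)
  ultimately show "\<exists>C M. 0 \<le> C \<and> (\<forall>\<alpha>. (LINT x|lborel. \<bar>hermite_fun \<alpha> (x :: real ^ 'd)\<bar>) \<le> C *
      real (Suc (mdeg \<alpha>)) ^ M)"
    by blast
qed

lemma integrable_bounded_hermite:
  fixes f :: "real ^ 'd::finite \<Rightarrow> complex"
  assumes f: "f \<in> borel_measurable borel" "\<And>x. cmod (f x) \<le> B"
  shows "integrable lborel (\<lambda>x. f x * chermite_fun \<alpha> x)"
    and "cmod (hermite_coeffs f \<alpha>) \<le> B * (LINT x|lborel. \<bar>hermite_fun \<alpha> x\<bar>)"
    and "(LINT x|lborel. cmod (f x * chermite_fun \<alpha> x)) \<le> B * (LINT x|lborel. \<bar>hermite_fun \<alpha> x\<bar>)"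
proof -
  have B: "integrable lborel (\<lambda>x. B * \<bar>hermite_fun \<alpha> x\<bar>)"
    by (intro integrable_mult_right hermite_fun_L1)
  have le: "cmod (f x * chermite_fun \<alpha> x) \<le> B * \<bar>hermite_fun \<alpha> x\<bar>" for x
    using f(2)[of x] by (simp add: norm_mult mult_right_mono)
  show int: "integrable lborel (\<lambda>x. f x * chermite_fun \<alpha> x)"
    by (rule Bochner_Integration.integrable_bound[OF B])
       (use f(1) order_trans[OF le abs_ge_self] in \<open>auto simp del: norm_mult intro!: AE_I2\<close>)
  show *: "(LINT x|lborel. cmod (f x * chermite_fun \<alpha> x)) \<le> B * (LINT x|lborel. \<bar>hermite_fun \<alpha> x\<bar>)"
    using integral_mono[OF integrable_norm[OF int] B le] by simp
  show "cmod (hermite_coeffs f \<alpha>) \<le> B * (LINT x|lborel. \<bar>hermite_fun \<alpha> x\<bar>)"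
    unfolding hermite_coeffs_def by (rule order_trans[OF integral_norm_bound *])
qed

lemma integrable_schwartz_hermite: "f \<in> schwartz \<Longrightarrow> integrable lborel (\<lambda>x. f x * chermite_fun \<alpha> x)"
  by (rule integrable_bounded_hermite(1)[OF measurable_smooth[OF schwartz_smooth] schwartz_bounded_fun])

lemma hermite_coeffs_lincomb:
  assumes "f \<in> schwartz" "g \<in> schwartz"
  shows "hermite_coeffs (\<lambda>x. a * f x + b * g x) \<alpha> = a * hermite_coeffs f \<alpha> + b * hermite_coeffs g \<alpha>"
proof -
  have "(LINT x|lborel. (a * f x + b * g x) * chermite_fun \<alpha> x) =
      (LINT x|lborel. a * (f x * chermite_fun \<alpha> x) + b * (g x * chermite_fun \<alpha> x))"
    by (simp add: algebra_simps)
  then show ?thesis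
    unfolding hermite_coeffs_def using integrable_schwartz_hermite[of _ \<alpha>] assms by simp
qed

lemma hermite_coeffs_coord:
  assumes f: "f \<in> schwartz"
  shows "hermite_coeffs (\<lambda>x. of_real (x $ j) * f x) \<alpha> =
    cdown j \<alpha> * hermite_coeffs f (lower j \<alpha>) + cup j \<alpha> * hermite_coeffs f (raise j \<alpha>)"
proof -
  have "of_real (x $ j) * f x * chermite_fun \<alpha> x =
      cdown j \<alpha> * (f x * chermite_fun (lower j \<alpha>) x) + cup j \<alpha> * (f x * chermite_fun (raise j \<alpha>) x)" for x
  proof -
    have "of_real (x $ j) * f x * chermite_fun \<alpha> x = f x * (of_real (x $ j) * chermite_fun \<alpha> x)"
      by (simp only: mult_ac)
    then show ?thesis unfolding coord_times_hermite_fun by (simp only: distrib_left mult_ac)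
  qed
  then show ?thesis
    unfolding hermite_coeffs_def using integrable_schwartz_hermite[OF f] by simp
qed

text \<open>
  Integration by parts.  The product of \<open>f\<close> with a Hermite function and its derivative are dominated
  by the integrable weight,
  so the integral of the derivative of the product vanishes.
\<close>

lemma hermite_coeffs_partial_deriv:
  fixes f :: "real ^ 'd::finite \<Rightarrow> complex"
  assumes f: "f \<in> schwartz"
  shows "hermite_coeffs (partial_deriv j f) \<alpha> =
    cup j \<alpha> * hermite_coeffs f (raise j \<alpha>) - cdown j \<alpha> * hermite_coeffs f (lower j \<alpha>)"
proof -
  have f': "partial_deriv j f \<in> schwartz" using tame_partial_deriv f by (rule tame_schwartz)
  obtain C M where C: "0 \<le> C" "\<And>\<alpha> x. \<bar>hermite_fun \<alpha> (x :: real ^ 'd)\<bar> \<le> C * real (Suc (mdeg \<alpha>)) ^ M * decay_weight x"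
    using hermite_fun_decay by metis
  define K where "K \<gamma> = C * real (Suc (mdeg \<gamma>)) ^ M" for \<gamma> :: "nat ^ 'd"
  have K: "cmod (chermite_fun \<gamma> x) \<le> K \<gamma> * decay_weight x" for \<gamma> and x :: "real ^ 'd" using C by (simp add: K_def)
  define F where "F x = f x * chermite_fun \<alpha> x" for x
  define g where "g x = cdown j \<alpha> * chermite_fun (lower j \<alpha>) x + (- cup j \<alpha>) * chermite_fun (raise j \<alpha>) x" for x
  define D where "D x = partial_deriv j f x * chermite_fun \<alpha> x + f x * g x" for x
  define B where "B = schwartz_seminorm 0 [] (partial_deriv j f) * K \<alpha> +
    schwartz_seminorm 0 [] f * (cmod (cdown j \<alpha>) * K (lower j \<alpha>) + cmod (cup j \<alpha>) * K (raise j \<alpha>))"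
  have D_le: "cmod (D x) \<le> B * decay_weight x" for x
  proof -
    have "cmod (g x) \<le> cmod (cdown j \<alpha>) * cmod (chermite_fun (lower j \<alpha>) x) + cmod (cup j \<alpha>) *
        cmod (chermite_fun (raise j \<alpha>) x)"
      unfolding g_def by (rule order_trans[OF norm_triangle_ineq]) (simp add: norm_mult)
    also have "\<dots> \<le> cmod (cdown j \<alpha>) * (K (lower j \<alpha>) * decay_weight x) + cmod (cup j \<alpha>) * (K (raise j \<alpha>) *
        decay_weight x)"
      by (intro add_mono mult_left_mono K) auto
    finally have g: "cmod (g x) \<le> (cmod (cdown j \<alpha>) * K (lower j \<alpha>) + cmod (cup j \<alpha>) * K (raise j \<alpha>)) *
        decay_weight x"
      by (simp add: algebra_simps)
    have "cmod (D x) \<le> cmod (partial_deriv j f x) * cmod (chermite_fun \<alpha> x) + cmod (f x) * cmod (g x)"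
      unfolding D_def by (rule order_trans[OF norm_triangle_ineq]) (simp add: norm_mult)
    also have "\<dots> \<le> schwartz_seminorm 0 [] (partial_deriv j f) * (K \<alpha> * decay_weight x) + schwartz_seminorm 0 [] f *
        ((cmod (cdown j \<alpha>) * K (lower j \<alpha>) + cmod (cup j \<alpha>) * K (raise j \<alpha>)) * decay_weight x)"
      using f f' by (intro add_mono mult_mono K g schwartz_bounded_fun schwartz_seminorm_nonneg) auto
    finally show ?thesis by (simp add: B_def algebra_simps)
  qed
  have B: "0 \<le> B"
    using f f' C(1) unfolding B_def K_def by (intro add_nonneg_nonneg mult_nonneg_nonneg schwartz_seminorm_nonneg)
        auto
  have "(LINT x|lborel. D x) = 0"
  proof (rule integral_directional_derivative_eq_0(2)[where b = "axis j 1" and F = F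
        and G = "\<lambda>x. B * 3 ^ CARD('d) * decay_weight x"])
    show "integrable lborel F" unfolding F_def using f by (rule integrable_schwartz_hermite)
    show "integrable lborel (\<lambda>x :: real ^ 'd. B * 3 ^ CARD('d) * decay_weight x)"
      by (intro integrable_mult_right integrable_decay_weight)
    show "axis j (1::real) \<noteq> 0" by (simp add: axis_eq_0_iff)
    fix x :: "real ^ 'd" and t :: real
    have fD: "(f has_derivative frechet_derivative f (at x)) (at x)"
      using schwartz_smooth[OF f] unfolding smooth_def frechet_derivative_works[symmetric]
      by (metis partial_derivs.simps(1))
    let ?h' = "\<lambda>v. \<Sum>i\<in>UNIV. of_real (v $ i) * (cdown i \<alpha> * chermite_fun (lower i \<alpha>) x - cup i \<alpha> *
        chermite_fun (raise i \<alpha>) x)"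
    have FD: "(F has_derivative (\<lambda>v. f x * ?h' v + frechet_derivative f (at x) v * chermite_fun \<alpha> x)) (at x)"
      unfolding F_def by (rule has_derivative_mult[OF fD has_derivative_chermite_fun])
    have "((\<lambda>t. x + t *\<^sub>R axis j 1) has_derivative (\<lambda>h. h *\<^sub>R axis j 1)) (at 0)"
      by (auto intro!: derivative_eq_intros)
    then have "((\<lambda>t. F (x + t *\<^sub>R axis j 1)) has_derivative
        (\<lambda>h. f x * ?h' (h *\<^sub>R axis j 1) + frechet_derivative f (at x) (h *\<^sub>R axis j 1) * chermite_fun \<alpha> x)) (at 0)"
      by (rule has_derivative_compose) (simp add: FD)
    moreover have "f x * ?h' (h *\<^sub>R axis j 1) + frechet_derivative f (at x) (h *\<^sub>R axis j 1) * chermite_fun \<alpha> x =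
        h *\<^sub>R D x" for h
    proof -
      have "?h' (h *\<^sub>R axis j 1) = of_real h * ?h' (axis j 1)"
        by (simp add: sum_distrib_left mult.assoc)
      also have "?h' (axis j 1) = g x" by (simp add: sum_axis_complex g_def)
      finally have "?h' (h *\<^sub>R axis j 1) = of_real h * g x" .
      moreover have "frechet_derivative f (at x) (h *\<^sub>R axis j 1) = h *\<^sub>R partial_deriv j f x"
        unfolding partial_deriv_def using fD by (intro linear_cmul has_derivative_linear)
      ultimately show ?thesis by (simp add: D_def scaleR_conv_of_real algebra_simps)
    qed
    ultimately show "((\<lambda>t. F (x + t *\<^sub>R axis j 1)) has_vector_derivative D x) (at 0)"
      by (simp add: has_vector_derivative_def)
    assume t: "0 \<le> t" "t \<le> 1"
    have "cmod (D (x + t *\<^sub>R axis j 1)) \<le> B * decay_weight (x + t *\<^sub>R axis j 1)" by (rule D_le)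
    also have "\<dots> \<le> B * (3 ^ CARD('d) * decay_weight x)"
      using t B by (intro mult_left_mono decay_weight_translate)
    finally show "cmod (D (x + t *\<^sub>R axis j 1)) \<le> B * 3 ^ CARD('d) * decay_weight x" by (simp add: mult.assoc)
  qed
  moreover have "D x = partial_deriv j f x * chermite_fun \<alpha> x +
      (cdown j \<alpha> * (f x * chermite_fun (lower j \<alpha>) x) - cup j \<alpha> * (f x * chermite_fun (raise j \<alpha>) x))" for x
    by (simp add: D_def g_def algebra_simps)
  ultimately have "hermite_coeffs (partial_deriv j f) \<alpha> +
      (cdown j \<alpha> * hermite_coeffs f (lower j \<alpha>) - cup j \<alpha> * hermite_coeffs f (raise j \<alpha>)) = 0"
    unfolding hermite_coeffs_def using integrable_schwartz_hermite[OF f] integrable_schwartz_hermite[OF f'] by simp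
  then show ?thesis by (simp add: algebra_simps add_eq_0_iff)
qed

lemma raise_lower: "raise j (lower j \<alpha>) = \<alpha>" if "0 < \<alpha> $ j"
  using that by (auto simp: raise_def lower_def vec_eq_iff)

lemma lower_raise: "lower j (raise j \<alpha>) = \<alpha>"
  by (auto simp: raise_def lower_def vec_eq_iff)

definition annihilate :: "'d \<Rightarrow> (real ^ 'd::finite \<Rightarrow> complex) \<Rightarrow> real ^ 'd \<Rightarrow> complex" where
  "annihilate j f = (\<lambda>x. of_real (x $ j) * f x + partial_deriv j f x)"

definition create :: "'d \<Rightarrow> (real ^ 'd::finite \<Rightarrow> complex) \<Rightarrow> real ^ 'd \<Rightarrow> complex" where
  "create j f = (\<lambda>x. of_real (x $ j) * f x - partial_deriv j f x)"

lemma tame_annihilate: "tame (annihilate j)" and tame_create: "tame (create j)"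
  using tame_lincomb[OF tame_coord[of j] tame_partial_deriv[of j], of 1 1]
    tame_lincomb[OF tame_coord[of j] tame_partial_deriv[of j], of 1 "- 1"]
  by (simp_all add: annihilate_def[abs_def] create_def[abs_def])

lemma hermite_coeffs_annihilate:
  assumes f: "f \<in> schwartz"
  shows "hermite_coeffs (annihilate j f) \<alpha> = 2 * cup j \<alpha> * hermite_coeffs f (raise j \<alpha>)"
  using hermite_coeffs_lincomb[OF tame_schwartz[OF tame_coord f] tame_schwartz[OF tame_partial_deriv f], of 1 j 1 j \<alpha>]
    hermite_coeffs_coord[OF f, of j \<alpha>] hermite_coeffs_partial_deriv[OF f, of j \<alpha>]
  by (simp add: annihilate_def)

lemma hermite_coeffs_create:
  assumes f: "f \<in> schwartz"
  shows "hermite_coeffs (create j f) \<alpha> = 2 * cdown j \<alpha> * hermite_coeffs f (lower j \<alpha>)"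
  using hermite_coeffs_lincomb[OF tame_schwartz[OF tame_coord f] tame_schwartz[OF tame_partial_deriv f],
      of 1 j "- 1" j \<alpha>]
    hermite_coeffs_coord[OF f, of j \<alpha>] hermite_coeffs_partial_deriv[OF f, of j \<alpha>]
  by (simp add: create_def)

text \<open>
  The identity plus the sum of the operators \<open>(x\<^sub>j - \<partial>\<^sub>j) (x\<^sub>j + \<partial>\<^sub>j)\<close>, which is the harmonic oscillator up to an
  additive constant; the shift by the identity makes all its eigenvalues positive.
\<close>

definition number_op :: "(real ^ 'd::finite \<Rightarrow> complex) \<Rightarrow> real ^ 'd \<Rightarrow> complex" where
  "number_op f = (\<lambda>x. f x + (\<Sum>j\<in>UNIV. create j (annihilate j f) x))"

lemma tame_number_op: "tame (number_op :: (real ^ 'd::finite \<Rightarrow> complex) \<Rightarrow> _)"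
proof -
  have "tame (\<lambda>(f :: real ^ 'd \<Rightarrow> complex) x. \<Sum>j\<in>UNIV. create j (annihilate j f) x)"
    by (rule tame_sum[OF finite tame_comp[OF tame_create tame_annihilate]])
  from tame_lincomb[OF tame_id this, of 1 1] show ?thesis by (simp add: number_op_def[abs_def])
qed

lemma hermite_coeffs_cmult: "hermite_coeffs (\<lambda>x. a * f x) \<alpha> = a * hermite_coeffs f \<alpha>"
  by (simp add: hermite_coeffs_def mult.assoc)

lemma hermite_coeffs_sum:
  fixes f :: "'i \<Rightarrow> real ^ 'd::finite \<Rightarrow> complex"
  assumes "finite I" "\<And>i. i \<in> I \<Longrightarrow> f i \<in> schwartz"
  shows "(\<lambda>x. \<Sum>i\<in>I. c i * f i x) \<in> schwartz \<and> hermite_coeffs (\<lambda>x. \<Sum>i\<in>I. c i * f i x) \<alpha> = (\<Sum>i\<in>I. c i *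
      hermite_coeffs (f i) \<alpha>)"
  using assms
proof (induction I)
  case empty
  show ?case by (simp add: hermite_coeffs_def schwartz_def smooth_0 partial_derivs_0)
next
  case (insert i I)
  then have "f i \<in> schwartz" "(\<lambda>x. \<Sum>i\<in>I. c i * f i x) \<in> schwartz" by auto
  from schwartz_lincomb[OF this, of "c i" 1] hermite_coeffs_lincomb[OF this, of "c i" 1 \<alpha>] insert
  show ?case by simp
qed

lemma hermite_coeffs_number_op:
  assumes f: "f \<in> schwartz"
  shows "hermite_coeffs (number_op f) \<alpha> = of_nat (2 * mdeg \<alpha> + 1) * hermite_coeffs f \<alpha>"
proof -
  have S: "create j (annihilate j f) \<in> schwartz" for j
    using f by (intro tame_schwartz[OF tame_create] tame_schwartz[OF tame_annihilate])
  have one: "hermite_coeffs (create j (annihilate j f)) \<alpha> = of_nat (2 * \<alpha> $ j) * hermite_coeffs f \<alpha>" for j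
  proof (cases "\<alpha> $ j = 0")
    case True
    then show ?thesis using f by (simp add: hermite_coeffs_create tame_schwartz[OF tame_annihilate] cdown_def)
  next
    case False
    then have "hermite_coeffs (create j (annihilate j f)) \<alpha> = 2 * cdown j \<alpha> * (2 * cup j (lower j \<alpha>) *
        hermite_coeffs f \<alpha>)"
      using f by (simp add: hermite_coeffs_create hermite_coeffs_annihilate tame_schwartz[OF tame_annihilate]
          raise_lower)
    moreover have "cup j (lower j \<alpha>) = cdown j \<alpha>" using False by (simp add: cup_def cdown_def lower_def)
    moreover have "4 * (cdown j \<alpha> * cdown j \<alpha>) = of_nat (2 * \<alpha> $ j)"
    proof -
      have c2: "cdown j \<alpha> * cdown j \<alpha> = of_real (real (\<alpha> $ j) / 2)"
        unfolding cdown_def of_real_mult[symmetric] by simp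
      show ?thesis unfolding c2 by simp
    qed
    moreover have "2 * cdown j \<alpha> * (2 * cdown j \<alpha> * hermite_coeffs f \<alpha>) = 4 * (cdown j \<alpha> * cdown j \<alpha>) *
        hermite_coeffs f \<alpha>"
      by simp
    ultimately show ?thesis by simp
  qed
  have "hermite_coeffs (number_op f) \<alpha> = hermite_coeffs f \<alpha> + (\<Sum>j\<in>UNIV. of_nat (2 * \<alpha> $ j) * hermite_coeffs f \<alpha>)"
  proof -
    note sum = hermite_coeffs_sum[of UNIV "\<lambda>j. create j (annihilate j f)" "\<lambda>_. 1" \<alpha>, OF finite S, simplified]
    show ?thesis
      using hermite_coeffs_lincomb[OF f sum[THEN conjunct1], of 1 1 \<alpha>] sum
      by (simp add: number_op_def one)
  qed
  then show ?thesis
    by (simp add: mdeg_def sum_distrib_left sum_distrib_right distrib_right)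
qed

text \<open>
  Applying a power of the number operator multiplies the coefficients by a power of \<open>2 |\<alpha>| + 1\<close>,
  so they decay rapidly.
\<close>

lemma hermite_coeffs_rapid_decay:
  "\<exists>p. seminorm_dominated p \<and> (\<forall>f\<in>schwartz. \<forall>\<alpha>. cmod (hermite_coeffs f \<alpha>) *
      real (Suc (mdeg (\<alpha> :: nat ^ 'd::finite))) ^ k \<le> p f)"
proof -
  obtain C M where C: "0 \<le> C" "\<And>\<alpha>. (LINT x|lborel. \<bar>hermite_fun \<alpha> (x :: real ^ 'd)\<bar>) \<le> C * real (Suc (mdeg \<alpha>)) ^ M"
    using hermite_fun_L1(2) by blast
  \<comment> \<open>The \<open>M\<close> extra powers compensate the growth of the \<open>L\<^sup>1\<close>-norms of the Hermite functions.\<close>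
  define A where "A = (number_op :: (real ^ 'd \<Rightarrow> complex) \<Rightarrow> _) ^^ (k + M)"
  have A: "tame A" unfolding A_def by (intro tame_funpow tame_number_op)
  have pow: "(number_op ^^ n) f \<in> schwartz \<and>
      hermite_coeffs ((number_op ^^ n) f) \<alpha> = of_nat (2 * mdeg \<alpha> + 1) ^ n * hermite_coeffs f \<alpha>"
    if f: "f \<in> schwartz" for n \<alpha> and f :: "real ^ 'd \<Rightarrow> complex"
  proof (induction n)
    case (Suc n)
    then show ?case by (simp add: hermite_coeffs_number_op tame_schwartz[OF tame_number_op] mult.assoc del:
        of_nat_add of_nat_mult)
  qed (simp add: f)
  have "cmod (hermite_coeffs f \<alpha>) * real (Suc (mdeg \<alpha>)) ^ k \<le> C * schwartz_seminorm 0 [] (A f)"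
    if f: "f \<in> schwartz" for f \<alpha>
  proof -
    have Af: "A f \<in> schwartz" using A f by (rule tame_schwartz)
    let ?n = "real (Suc (mdeg \<alpha>))"
    have "cmod (hermite_coeffs f \<alpha>) * ?n ^ k * ?n ^ M = ?n ^ (k + M) * cmod (hermite_coeffs f \<alpha>)"
      by (simp only: power_add mult_ac)
    also have "\<dots> \<le> real (2 * mdeg \<alpha> + 1) ^ (k + M) * cmod (hermite_coeffs f \<alpha>)"
      by (intro mult_right_mono power_mono) auto
    also have "\<dots> = cmod (hermite_coeffs (A f) \<alpha>)"
      unfolding A_def pow[OF f, of "k + M" \<alpha>, THEN conjunct2] by (simp only: norm_mult norm_power norm_of_nat)
    also have "\<dots> \<le> schwartz_seminorm 0 [] (A f) * (LINT x|lborel. \<bar>hermite_fun \<alpha> x\<bar>)"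
      using Af by (intro integrable_bounded_hermite(2) measurable_smooth schwartz_smooth schwartz_bounded_fun)
    also have "\<dots> \<le> schwartz_seminorm 0 [] (A f) * (C * ?n ^ M)"
      using Af by (intro mult_left_mono C(2) schwartz_seminorm_nonneg)
    also have "\<dots> = C * schwartz_seminorm 0 [] (A f) * ?n ^ M"
      by (simp only: mult_ac)
    finally show ?thesis by (rule mult_right_le_imp_le) simp
  qed
  moreover have "seminorm_dominated (\<lambda>f. C * schwartz_seminorm 0 [] (A f))"
    using A C(1) by (intro seminorm_dominated_cmult) (auto simp: tame_def)
  ultimately show ?thesis by blast
qed

section \<open>Orthonormality of the Hermite functions\<close>

lemma chermite_fun_schwartz: "chermite_fun \<alpha> \<in> schwartz"
proof -
  have "bdd_above (range (\<lambda>x. cmod (of_real (mpow x \<beta>) * partial_derivs js (chermite_fun \<alpha>) x)))" for \<beta> js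
  proof -
    obtain C M where C: "\<And>\<alpha> x. cmod (of_real (mpow x \<beta>) * partial_derivs js (chermite_fun \<alpha>) x) \<le> C *
        real (Suc (mdeg \<alpha>)) ^ M"
      using hermite_fun_poly_bound[of \<beta> js] by blast
    show ?thesis by (rule bdd_aboveI2) (rule C)
  qed
  then show ?thesis by (simp add: schwartz_def smooth_chermite_fun)
qed

lemma create_chermite_fun: "create j (chermite_fun \<alpha>) = (\<lambda>x. (2 * cup j \<alpha>) * chermite_fun (raise j \<alpha>) x)"
  unfolding create_def coord_times_hermite_fun partial_deriv_chermite_fun by (rule ext) (simp add: algebra_simps)

lemma annihilate_chermite_fun: "annihilate j (chermite_fun \<alpha>) = (\<lambda>x. (2 * cdown j \<alpha>) * chermite_fun (lower j \<alpha>) x)"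
  unfolding annihilate_def coord_times_hermite_fun partial_deriv_chermite_fun by (rule ext) (simp add: algebra_simps)

lemma hermite_coeffs_chermite_fun_0: "hermite_coeffs (chermite_fun (0 :: nat ^ 'd::finite)) 0 = 1"
proof -
  have sq: "hermite_fun (0 :: nat ^ 'd) x * hermite_fun 0 x = (\<Prod>i\<in>UNIV. (hermite1 0 (x $ i))\<^sup>2)" for x :: "real ^ 'd"
    unfolding hermite_fun_eq_prod power2_eq_square prod.distrib zero_index ..
  have one: "(\<integral>\<^sup>+t. ennreal ((hermite1 0 t)\<^sup>2) \<partial>lborel) = 1"
    using integral_hermite1_sq[of 0] by (subst nn_integral_eq_integral) (auto simp: has_bochner_integral_iff simp
        del: hermite1.simps)
  have "(\<integral>\<^sup>+x. ennreal (hermite_fun (0 :: nat ^ 'd) x * hermite_fun 0 x) \<partial>lborel) = 1"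
    unfolding sq by (subst nn_integral_prod_coords) (auto simp: one simp del: hermite1.simps)
  then have "(LINT x|lborel. hermite_fun (0 :: nat ^ 'd) x * hermite_fun 0 x) = 1"
    by (subst integral_eq_nn_integral) auto
  then have "(LINT x|lborel. complex_of_real (hermite_fun (0 :: nat ^ 'd) x * hermite_fun 0 x)) = 1"
    by (simp only: integral_complex_of_real of_real_1)
  then show ?thesis by (simp add: hermite_coeffs_def)
qed

lemma cup_nonzero: "cup j \<alpha> \<noteq> 0"
  by (simp add: cup_def)

text \<open>
  Induction on the degree.  The adjoint relation between creation and annihilation lowers \<open>\<alpha>\<close> and
  \<open>\<beta>\<close> simultaneously in one coordinate; in degree zero, \<open>h\<^sub>0\<close> is annihilated by every \<open>x\<^sub>j + \<partial>\<^sub>j\<close>,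
  which leaves a Gaussian integral.
\<close>

lemma hermite_coeffs_chermite_fun: "hermite_coeffs (chermite_fun \<alpha>) = hermite_term (\<alpha> :: nat ^ 'd::finite)"
proof (rule ext)
  fix \<beta>
  show "hermite_coeffs (chermite_fun \<alpha>) \<beta> = hermite_term \<alpha> \<beta>"
  proof (induction "mdeg \<alpha>" arbitrary: \<alpha> \<beta>)
    case 0
    then have \<alpha>: "\<alpha> = 0" by (simp add: mdeg_def vec_eq_iff)
    show ?case
    proof (cases "\<beta> = 0")
      case True
      then show ?thesis using \<alpha> by (simp add: hermite_coeffs_chermite_fun_0 hermite_term_def)
    next
      case False
      then obtain j where j: "0 < \<beta> $ j" by (auto simp: vec_eq_iff)
      have "hermite_coeffs (annihilate j (chermite_fun \<alpha>)) (lower j \<beta>) = 0"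
        using \<alpha> by (simp add: annihilate_chermite_fun hermite_coeffs_def cdown_def)
      then show ?thesis
        using False \<alpha> by (simp add: hermite_coeffs_annihilate[OF chermite_fun_schwartz] raise_lower[of \<beta> j,
            OF j] cup_nonzero hermite_term_def)
    qed
  next
    case (Suc n)
    then obtain j where j: "0 < \<alpha> $ j" by (metis mdeg_def nat.distinct(1) neq0_conv sum.neutral)
    define \<gamma> where "\<gamma> = lower j \<alpha>"
    have \<alpha>: "\<alpha> = raise j \<gamma>" using j by (simp add: \<gamma>_def raise_lower)
    have n: "n = mdeg \<gamma>" using Suc.hyps(2) by (simp add: \<alpha> mdeg_raise)
    have "2 * cup j \<gamma> * hermite_coeffs (chermite_fun \<alpha>) \<beta> = hermite_coeffs (create j (chermite_fun \<gamma>)) \<beta>"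
      unfolding create_chermite_fun hermite_coeffs_cmult \<alpha> ..
    also have "\<dots> = 2 * cdown j \<beta> * hermite_term \<gamma> (lower j \<beta>)"
      using Suc.hyps(1)[OF n] by (simp add: hermite_coeffs_create chermite_fun_schwartz)
    also have "\<dots> = 2 * cup j \<gamma> * hermite_term \<alpha> \<beta>"
    proof (cases "\<beta> = \<alpha>")
      case True
      then show ?thesis by (simp add: hermite_term_def \<alpha> lower_raise) (simp add: cup_def cdown_def raise_def)
    next
      case False
      have "cdown j \<beta> = 0 \<or> lower j \<beta> \<noteq> \<gamma>"
        using False raise_lower[of \<beta> j] by (auto simp: \<alpha> cdown_def)
      then show ?thesis using False by (auto simp: hermite_term_def)
    qed
    finally show ?case using cup_nonzero[of j \<gamma>] by simp
  qed
qed

section \<open>Hermite expansions with rapidly decreasing coefficients\<close>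

text \<open>By the Weierstrass test all series of derivatives converge uniformly, so differentiation is termwise, order
by order.\<close>

lemma partial_derivs_series:
  fixes T :: "nat \<Rightarrow> real ^ 'd::finite \<Rightarrow> complex"
  assumes T: "\<And>n. smooth (T n)"
    and M: "\<And>js. summable (M js)" "\<And>js n x. cmod (partial_derivs js (T n) x) \<le> M js n"
  shows "smooth (\<lambda>x. \<Sum>n. T n x)"
    and "partial_derivs js (\<lambda>x. \<Sum>n. T n x) = (\<lambda>x. \<Sum>n. partial_derivs js (T n) x)"
proof -
  define S where "S js x = (\<Sum>n. partial_derivs js (T n) x)" for js x
  have D: "(S js has_derivative (\<lambda>h. \<Sum>i\<in>UNIV. of_real (h $ i) * S (i # js) x)) (at x)" for js x
  proof -
    let ?f' = "\<lambda>n x h. \<Sum>i\<in>UNIV. of_real (h $ i) * partial_derivs (i # js) (T n) x"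
    let ?g' = "\<lambda>x h. \<Sum>i\<in>UNIV. of_real (h $ i) * S (i # js) x"
    have fd: "(partial_derivs js (T n) has_derivative ?f' n x) (at x within UNIV)" for n x
    proof -
      let ?L = "frechet_derivative (partial_derivs js (T n)) (at x)"
      have L: "(partial_derivs js (T n) has_derivative ?L) (at x)"
        using T[of n] by (simp add: smooth_def frechet_derivative_works[symmetric])
      have "?L h = ?f' n x h" for h
      proof -
        have "?L h = ?L (\<Sum>i\<in>UNIV. h $ i *\<^sub>R axis i 1)"
          by (simp add: basis_expansion flip: scalar_mult_eq_scaleR)
        also have "\<dots> = (\<Sum>i\<in>UNIV. h $ i *\<^sub>R ?L (axis i 1))"
          by (simp add: linear_sum[OF has_derivative_linear[OF L]] linear_cmul[OF has_derivative_linear[OF L]])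
        finally show ?thesis by (simp add: partial_deriv_def scaleR_conv_of_real)
      qed
      then have "?L = ?f' n x" by auto
      then show ?thesis using L by simp
    qed
    have uni: "\<forall>\<^sub>F N in sequentially. \<forall>x\<in>UNIV. \<forall>h. norm ((\<Sum>n<N. ?f' n x h) - ?g' x h) \<le> e * norm h" if e: "0 < e" for e
    proof -
      have "\<forall>\<^sub>F N in sequentially. \<forall>x. norm ((\<Sum>n<N. partial_derivs (i # js) (T n) x) - S (i # js) x) < e /
          CARD('d)" for i
      proof -
        have "uniform_limit UNIV (\<lambda>N x. \<Sum>n<N. partial_derivs (i # js) (T n) x) (S (i # js)) sequentially"
          unfolding S_def[abs_def] by (rule Weierstrass_m_test[OF M(2) M(1)])
        moreover have "0 < e / CARD('d)" using e by simp
        ultimately have "\<forall>\<^sub>F N in sequentially. \<forall>x\<in>UNIV. dist (\<Sum>n<N. partial_derivs (i # js) (T n) x) (S (i # js)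
            x) < e / CARD('d)"
          by (rule uniform_limitD)
        then show ?thesis by (simp add: dist_norm)
      qed
      then have "\<forall>\<^sub>F N in sequentially. \<forall>i\<in>UNIV. \<forall>x. norm ((\<Sum>n<N. partial_derivs (i # js) (T n) x) - S (i # js) x)
          < e / CARD('d)"
        by (intro eventually_ball_finite) auto
      then show ?thesis
      proof (rule eventually_mono, intro ballI allI)
        fix N x and h :: "real ^ 'd"
        assume N: "\<forall>i\<in>UNIV. \<forall>x. norm ((\<Sum>n<N. partial_derivs (i # js) (T n) x) - S (i # js) x) < e / CARD('d)"
        have "(\<Sum>n<N. ?f' n x h) - ?g' x h = (\<Sum>i\<in>UNIV. of_real (h $ i) *
            ((\<Sum>n<N. partial_derivs (i # js) (T n) x) - S (i # js) x))"
          by (subst sum.swap) (simp add: sum_distrib_left[symmetric] sum_subtractf right_diff_distrib)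
        also have "norm \<dots> \<le> (\<Sum>i\<in>(UNIV :: 'd set). norm h * (e / CARD('d)))"
        proof (rule order_trans[OF norm_sum], rule sum_mono)
          fix i
          show "norm (of_real (h $ i) * ((\<Sum>n<N. partial_derivs (i # js) (T n) x) - S (i # js) x)) \<le> norm h *
              (e / CARD('d))"
            unfolding norm_mult norm_of_real using N component_le_norm_cart[of h i]
            by (intro mult_mono) (auto intro: less_imp_le)
        qed
        also have "\<dots> = e * norm h" by simp
        finally show "norm ((\<Sum>n<N. ?f' n x h) - ?g' x h) \<le> e * norm h" .
      qed
    qed
    have sums: "(\<lambda>n. partial_derivs js (T n) x) sums S js x" for x
      unfolding S_def using summable_comparison_test'[OF M(1)[of js], of 0 "\<lambda>n. partial_derivs js (T n) x"] M(2)
      by (intro summable_sums) auto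
    obtain g where g: "\<And>x. (\<lambda>n. partial_derivs js (T n) x) sums g x" "\<And>x. (g has_derivative ?g' x) (at x)"
      using has_derivative_series[OF convex_UNIV fd uni UNIV_I sums[of 0]] by auto
    have "g = S js" using g(1) sums sums_unique2 by blast
    then show ?thesis using g(2) by simp
  qed
  have eq: "partial_derivs js (\<lambda>x. \<Sum>n. T n x) = S js" for js
  proof (induction js)
    case Nil
    then show ?case by (simp add: S_def[abs_def])
  next
    case (Cons j js)
    then show ?case by (auto simp: partial_deriv_eq[OF D] sum_axis_complex)
  qed
  show "smooth (\<lambda>x. \<Sum>n. T n x)"
    unfolding smooth_def eq using D by (auto simp: differentiable_def)
  show "partial_derivs js (\<lambda>x. \<Sum>n. T n x) = (\<lambda>x. \<Sum>n. partial_derivs js (T n) x)"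
    unfolding eq by (simp add: S_def[abs_def])
qed

lemma finite_mdeg: "finite {\<alpha> :: nat ^ 'd::finite. mdeg \<alpha> = n}"
  and card_mdeg: "card {\<alpha> :: nat ^ 'd::finite. mdeg \<alpha> = n} \<le> Suc n ^ CARD('d)"
proof -
  let ?F = "(\<lambda>f. vec_lambda f :: nat ^ 'd) ` (PiE UNIV (\<lambda>_. {..n}))"
  have sub: "{\<alpha> :: nat ^ 'd. mdeg \<alpha> = n} \<subseteq> ?F"
  proof
    fix \<alpha> :: "nat ^ 'd" assume "\<alpha> \<in> {\<alpha>. mdeg \<alpha> = n}"
    then have "\<alpha> $ j \<le> n" for j using nth_le_mdeg[of \<alpha> j] by simp
    then show "\<alpha> \<in> ?F" by (intro image_eqI[of _ _ "($) \<alpha>"]) auto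
  qed
  have fin: "finite (PiE (UNIV :: 'd set) (\<lambda>_. {..n}))" by (intro finite_PiE) auto
  then show "finite {\<alpha> :: nat ^ 'd. mdeg \<alpha> = n}" using sub finite_subset by blast
  have "card {\<alpha> :: nat ^ 'd. mdeg \<alpha> = n} \<le> card ?F" using fin sub by (intro card_mono) auto
  also have "\<dots> \<le> card (PiE (UNIV :: 'd set) (\<lambda>_. {..n}))" by (rule card_image_le[OF fin])
  also have "\<dots> = Suc n ^ CARD('d)" by (subst card_PiE) auto
  finally show "card {\<alpha> :: nat ^ 'd. mdeg \<alpha> = n} \<le> Suc n ^ CARD('d)" .
qed

text \<open>
  The terms are grouped by degree, which gives an ordinary series; a block of degree \<open>n\<close> has only polynomially many
  terms.
\<close>

definition hermite_expansion :: "'d::finite hermite_series \<Rightarrow> real ^ 'd \<Rightarrow> complex" where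
  "hermite_expansion c x = (\<Sum>n. \<Sum>\<alpha>\<in>{\<alpha>. mdeg \<alpha> = n}. c \<alpha> * chermite_fun \<alpha> x)"

definition rapidly_decreasing :: "'d::finite hermite_series \<Rightarrow> bool" where
  "rapidly_decreasing c \<longleftrightarrow> (\<forall>k. \<exists>P. \<forall>\<alpha>. cmod (c \<alpha>) * real (Suc (mdeg \<alpha>)) ^ k \<le> P)"

abbreviation hermite_block :: "'d::finite hermite_series \<Rightarrow> nat \<Rightarrow> real ^ 'd \<Rightarrow> complex" where
  "hermite_block c n \<equiv> \<lambda>x. \<Sum>\<alpha>\<in>{\<alpha>. mdeg \<alpha> = n}. c \<alpha> * chermite_fun \<alpha> x"

text \<open>
  The exponent \<open>k\<close> has to beat the number of multi-indices of degree \<open>n\<close>, the growth of the seminorms of the Hermite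
  functions, and leave a summable \<open>1 / n\<^sup>2\<close>.
\<close>

lemma hermite_block_bound:
  "\<exists>k K. 0 \<le> K \<and> (\<forall>(c :: 'd::finite hermite_series) P n x. (\<forall>\<alpha>. cmod (c \<alpha>) * real (Suc (mdeg \<alpha>)) ^ k \<le> P) \<longrightarrow>
     cmod (of_real (mpow x \<beta>) * (\<Sum>\<alpha>\<in>{\<alpha>. mdeg \<alpha> = n}. c \<alpha> * partial_derivs js (chermite_fun \<alpha>) x)) \<le>
       K * P * (1 / real (Suc n) ^ 2))"
proof -
  obtain C M where C: "0 \<le> C"
    "\<And>\<alpha> x. cmod (of_real (mpow x \<beta>) * partial_derivs js (chermite_fun \<alpha>) (x :: real ^ 'd)) \<le> C *
        real (Suc (mdeg \<alpha>)) ^ M"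
    using hermite_fun_poly_bound by blast
  define k where "k = CARD('d) + M + 2"
  have "cmod (of_real (mpow x \<beta>) * (\<Sum>\<alpha>\<in>{\<alpha>. mdeg \<alpha> = n}. c \<alpha> * partial_derivs js (chermite_fun \<alpha>) x)) \<le> C * P *
      (1 / real (Suc n) ^ 2)"
    if P: "\<And>\<alpha>. cmod (c \<alpha>) * real (Suc (mdeg \<alpha>)) ^ k \<le> P" for c :: "'d hermite_series" and P n x
  proof -
    let ?N = "real (Suc n)"
    have P0: "0 \<le> P" using P[of 0] by (rule order_trans[rotated]) simp
    have "of_real (mpow x \<beta>) * (\<Sum>\<alpha>\<in>{\<alpha>. mdeg \<alpha> = n}. c \<alpha> * partial_derivs js (chermite_fun \<alpha>) x) =
        (\<Sum>\<alpha>\<in>{\<alpha>. mdeg \<alpha> = n}. c \<alpha> * (of_real (mpow x \<beta>) * partial_derivs js (chermite_fun \<alpha>) x))"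
      by (simp add: sum_distrib_left mult_ac)
    also have "cmod \<dots> \<le> (\<Sum>\<alpha>\<in>{\<alpha>::nat^'d. mdeg \<alpha> = n}. (P / ?N ^ k) * (C * ?N ^ M))"
    proof (rule order_trans[OF norm_sum], rule sum_mono)
      fix \<alpha> :: "nat ^ 'd" assume "\<alpha> \<in> {\<alpha>. mdeg \<alpha> = n}"
      then have \<alpha>: "mdeg \<alpha> = n" by simp
      have "cmod (c \<alpha>) \<le> P / ?N ^ k" using P[of \<alpha>] by (simp add: \<alpha> pos_le_divide_eq)
      then show "cmod (c \<alpha> * (of_real (mpow x \<beta>) * partial_derivs js (chermite_fun \<alpha>) x)) \<le> (P / ?N ^ k) * (C *
          ?N ^ M)"
        unfolding norm_mult[of "c \<alpha>"] using C(2)[of x \<alpha>] C(1) P0 by (intro mult_mono) (auto simp: \<alpha>)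
    qed
    also have "\<dots> = real (card {\<alpha>::nat^'d. mdeg \<alpha> = n}) * ((P / ?N ^ k) * (C * ?N ^ M))"
      by simp
    also have "\<dots> \<le> real (Suc n ^ CARD('d)) * ((P / ?N ^ k) * (C * ?N ^ M))"
      using card_mdeg[where 'd='d] C(1) P0 by (intro mult_right_mono of_nat_mono) auto
    also have "\<dots> = C * P * (1 / ?N ^ 2)"
    proof -
      have "real (Suc n ^ CARD('d)) = ?N ^ CARD('d)" by (rule of_nat_power)
      moreover have "?N ^ k = ?N ^ CARD('d) * ?N ^ M * ?N ^ 2" by (simp only: k_def power_add)
      ultimately show ?thesis by (simp del: of_nat_Suc)
    qed
    finally show ?thesis .
  qed
  then show ?thesis using C(1) by blast
qed

lemma summable_inverse_Suc_sq: "summable (\<lambda>n. 1 / real (Suc n) ^ 2)"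
proof -
  have "summable (\<lambda>n. inverse (real (Suc n) ^ 2))"
    using inverse_power_summable[of 2, where 'a=real] by (subst summable_Suc_iff) simp
  then show ?thesis by (simp add: inverse_eq_divide)
qed

lemma smooth_hermite_block:
  "smooth (hermite_block c n)"
  "partial_derivs js (hermite_block c n) =
    (\<lambda>x. \<Sum>\<alpha>\<in>{\<alpha>. mdeg \<alpha> = n}. c \<alpha> * partial_derivs js (chermite_fun \<alpha>) x)"
  by (rule smooth_sum[OF finite_mdeg smooth_chermite_fun])+

lemma hermite_block_summable_bound:
  fixes c :: "'d::finite hermite_series"
  assumes c: "rapidly_decreasing c"
  shows "\<exists>M. \<forall>js. summable (M js) \<and> (\<forall>n x. cmod (partial_derivs js (hermite_block c n) x) \<le> M js n)"
proof -
  have "\<exists>M. summable M \<and> (\<forall>n x. cmod (partial_derivs js (hermite_block c n) x) \<le> M n)" for js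
  proof -
    obtain k K where K: "\<And>(c :: 'd hermite_series) P n x. (\<forall>\<alpha>. cmod (c \<alpha>) * real (Suc (mdeg \<alpha>)) ^ k \<le> P) \<Longrightarrow>
      cmod (of_real (mpow x 0) * (\<Sum>\<alpha>\<in>{\<alpha>. mdeg \<alpha> = n}. c \<alpha> * partial_derivs js (chermite_fun \<alpha>) x)) \<le> K * P *
      (1 / real (Suc n) ^ 2)"
      using hermite_block_bound[of 0 js] by blast
    obtain P where P: "\<forall>\<alpha>. cmod (c \<alpha>) * real (Suc (mdeg \<alpha>)) ^ k \<le> P" using c unfolding rapidly_decreasing_def by blast
    show ?thesis
      unfolding smooth_hermite_block
      using K[OF P] summable_mult[OF summable_inverse_Suc_sq, of "K * P"] by (auto simp: mpow_0)
  qed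
  then show ?thesis by (intro choice allI)
qed

lemma summable_hermite_blocks:
  assumes c: "rapidly_decreasing c"
  shows "summable (\<lambda>n. \<Sum>\<alpha>\<in>{\<alpha>. mdeg \<alpha> = n}. c \<alpha> * partial_derivs js (chermite_fun \<alpha>) x)"
proof -
  obtain M where M: "\<And>js. summable (M js)"
    "\<And>js n x. cmod (partial_derivs js (hermite_block c n) x) \<le> M js n"
    using hermite_block_summable_bound[OF c] by blast
  show ?thesis
    by (rule summable_comparison_test'[OF M(1)[of js], of 0]) (use M(2)[of js, unfolded smooth_hermite_block] in simp)
qed

lemma partial_derivs_hermite_expansion:
  assumes c: "rapidly_decreasing c"
  shows "smooth (hermite_expansion c)"
    and "partial_derivs js (hermite_expansion c) = (\<lambda>x. \<Sum>n. \<Sum>\<alpha>\<in>{\<alpha>. mdeg \<alpha> = n}. c \<alpha> *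
        partial_derivs js (chermite_fun \<alpha>) x)"
proof -
  obtain M where M: "\<And>js. summable (M js)"
    "\<And>js n x. cmod (partial_derivs js (hermite_block c n) x) \<le> M js n"
    using hermite_block_summable_bound[OF c] by blast
  note * = partial_derivs_series[OF smooth_hermite_block(1) M]
  show "smooth (hermite_expansion c)" using *(1) by (simp add: hermite_expansion_def[abs_def])
  show "partial_derivs js (hermite_expansion c) = (\<lambda>x. \<Sum>n. \<Sum>\<alpha>\<in>{\<alpha>. mdeg \<alpha> = n}. c \<alpha> *
      partial_derivs js (chermite_fun \<alpha>) x)"
    using *(2)[of js] unfolding smooth_hermite_block by (simp add: hermite_expansion_def[abs_def])
qed

lemma hermite_expansion_bound:
  "\<exists>k K. 0 \<le> K \<and> (\<forall>(c :: 'd::finite hermite_series) P x. rapidly_decreasing c \<longrightarrow> (\<forall>\<alpha>. cmod (c \<alpha>) *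
      real (Suc (mdeg \<alpha>)) ^ k \<le> P) \<longrightarrow>
     cmod (of_real (mpow x \<beta>) * partial_derivs js (hermite_expansion c) x) \<le> K * P)"
proof -
  obtain k K where K: "0 \<le> K" "\<And>(c :: 'd hermite_series) P n x. (\<forall>\<alpha>. cmod (c \<alpha>) * real (Suc (mdeg \<alpha>)) ^ k \<le> P) \<Longrightarrow>
      cmod (of_real (mpow x \<beta>) * (\<Sum>\<alpha>\<in>{\<alpha>. mdeg \<alpha> = n}. c \<alpha> * partial_derivs js (chermite_fun \<alpha>) x)) \<le> K * P *
      (1 / real (Suc n) ^ 2)"
    using hermite_block_bound[of \<beta> js] by blast
  define Z where "Z = (\<Sum>n. 1 / real (Suc n) ^ 2)"
  have Z: "0 \<le> Z" unfolding Z_def by (intro suminf_nonneg summable_inverse_Suc_sq) simp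
  have "cmod (of_real (mpow x \<beta>) * partial_derivs js (hermite_expansion c) x) \<le> K * Z * P"
    if c: "rapidly_decreasing c" and P: "\<forall>\<alpha>. cmod (c \<alpha>) * real (Suc (mdeg \<alpha>)) ^ k \<le> P"
        for c :: "'d hermite_series" and P x
  proof -
    let ?T = "\<lambda>n. \<Sum>\<alpha>\<in>{\<alpha>. mdeg \<alpha> = n}. c \<alpha> * partial_derivs js (chermite_fun \<alpha>) x"
    have sT: "summable ?T" by (rule summable_hermite_blocks[OF c])
    have sB: "summable (\<lambda>n. K * P * (1 / real (Suc n) ^ 2))" by (intro summable_mult summable_inverse_Suc_sq)
    have "of_real (mpow x \<beta>) * partial_derivs js (hermite_expansion c) x = (\<Sum>n. of_real (mpow x \<beta>) * ?T n)"
      unfolding partial_derivs_hermite_expansion[OF c] using sT by (simp add: suminf_mult)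
    also have "cmod \<dots> \<le> (\<Sum>n. K * P * (1 / real (Suc n) ^ 2))"
      by (rule norm_suminf_le[OF _ sB]) (rule K(2)[OF P])
    also have "\<dots> = K * Z * P" unfolding Z_def using suminf_mult[OF summable_inverse_Suc_sq, of "K * P"]
        by (simp add: mult_ac)
    finally show ?thesis .
  qed
  then show ?thesis using K(1) Z by (intro exI[of _ k] exI[of _ "K * Z"]) auto
qed

lemma suminf_delta: "(\<Sum>n. if n = i then a else 0) = (a :: complex)"
  using sums_single[of i "\<lambda>_. a"] by (rule sums_unique[symmetric])

text \<open>
  Integral and series can be interchanged because the blocks are bounded by a summable sequence and the
  Hermite functions are integrable.
\<close>

lemma hermite_coeffs_hermite_expansion:
  fixes c :: "'d::finite hermite_series"
  assumes c: "rapidly_decreasing c"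
  shows "hermite_coeffs (hermite_expansion c) = c"
proof (rule ext)
  fix \<beta> :: "nat ^ 'd"
  let ?T = "hermite_block c"
  obtain M where M: "\<And>js. summable (M js)" "\<And>js n x. cmod (partial_derivs js (?T n) x) \<le> M js n"
    using hermite_block_summable_bound[OF c] by blast
  have T: "cmod (?T n x) \<le> M [] n" for n x using M(2)[of "[]" n x] by simp
  have meas: "?T n \<in> borel_measurable borel" for n by (rule measurable_smooth) (rule smooth_hermite_block)
  have int: "integrable lborel (\<lambda>x. ?T n x * chermite_fun \<beta> x)" for n
    by (rule integrable_bounded_hermite(1)[OF meas T])
  have sT: "summable (\<lambda>n. ?T n x)" for x using summable_hermite_blocks[OF c, of "[]"] by simp
  have coeff: "(LINT x|lborel. ?T n x * chermite_fun \<beta> x) = (if n = mdeg \<beta> then c \<beta> else 0)" for n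
  proof -
    have "(LINT x|lborel. ?T n x * chermite_fun \<beta> x) = hermite_coeffs (?T n) \<beta>" by (simp only: hermite_coeffs_def)
    also have "\<dots> = (\<Sum>\<alpha>\<in>{\<alpha>. mdeg \<alpha> = n}. c \<alpha> * hermite_coeffs (chermite_fun \<alpha>) \<beta>)"
      using hermite_coeffs_sum[OF finite_mdeg, of n chermite_fun c \<beta>] chermite_fun_schwartz by blast
    also have "\<dots> = (\<Sum>\<alpha>\<in>{\<alpha>. mdeg \<alpha> = n}. if \<alpha> = \<beta> then c \<beta> else 0)"
      by (intro sum.cong) (auto simp: hermite_coeffs_chermite_fun hermite_term_def)
    also have "\<dots> = (if n = mdeg \<beta> then c \<beta> else 0)" by (simp add: finite_mdeg)
    finally show ?thesis .
  qed
  have "hermite_coeffs (hermite_expansion c) \<beta> = (LINT x|lborel. (\<Sum>n. ?T n x * chermite_fun \<beta> x))"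
    unfolding hermite_coeffs_def hermite_expansion_def suminf_mult2[OF sT] ..
  also have "\<dots> = (\<Sum>n. LINT x|lborel. ?T n x * chermite_fun \<beta> x)"
  proof (rule integral_suminf)
    show "AE x in lborel. summable (\<lambda>n. norm (?T n x * chermite_fun \<beta> x))"
    proof (rule AE_I2)
      fix x :: "real ^ 'd"
      show "summable (\<lambda>n. norm (?T n x * chermite_fun \<beta> x))"
        by (rule summable_comparison_test'[OF summable_mult2[OF M(1)[of "[]"], of "cmod (chermite_fun \<beta> x)"], of 0])
           (use T in \<open>simp add: norm_mult mult_right_mono\<close>)
    qed
    show "summable (\<lambda>n. LINT x|lborel. norm (?T n x * chermite_fun \<beta> x))"
    proof (rule summable_comparison_test'[OF summable_mult2[OF M(1)[of "[]"],
        of "LINT x|lborel. \<bar>hermite_fun \<beta> x\<bar>"], of 0])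
      fix n
      show "norm (LINT x|lborel. norm (?T n x * chermite_fun \<beta> x)) \<le> M [] n * (LINT x|lborel. \<bar>hermite_fun \<beta> x\<bar>)"
        using integrable_bounded_hermite(3)[OF meas T, of n \<beta>] by (simp add: integral_nonneg_AE)
    qed
  qed (rule int)
  also have "\<dots> = (\<Sum>n. if n = mdeg \<beta> then c \<beta> else 0)" unfolding coeff ..
  also have "\<dots> = c \<beta>" by (simp add: suminf_delta)
  finally show "hermite_coeffs (hermite_expansion c) \<beta> = c \<beta>" .
qed

section \<open>The fractional Fourier transform on the Schwartz space and its dual\<close>

definition schwartz_frac_fourier :: "real ^ 'd::finite \<Rightarrow> (real ^ 'd \<Rightarrow> complex) \<Rightarrow> real ^ 'd \<Rightarrow> complex" where
  "schwartz_frac_fourier r f = hermite_expansion (frac_fourier r (hermite_coeffs f))"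

lemma rapidly_decreasing_frac_fourier:
  assumes f: "f \<in> schwartz"
  shows "rapidly_decreasing (frac_fourier r (hermite_coeffs f))"
  unfolding rapidly_decreasing_def
proof
  fix k
  obtain p where "\<forall>\<alpha>. cmod (hermite_coeffs f \<alpha>) * real (Suc (mdeg \<alpha>)) ^ k \<le> p f"
    using hermite_coeffs_rapid_decay[of k, where 'd='a] f by blast
  then show "\<exists>P. \<forall>\<alpha>. cmod (frac_fourier r (hermite_coeffs f) \<alpha>) * real (Suc (mdeg \<alpha>)) ^ k \<le> P"
    by (auto simp: frac_fourier_eq norm_mult)
qed

lemma hermite_coeffs_schwartz_frac_fourier:
  "f \<in> schwartz \<Longrightarrow> hermite_coeffs (schwartz_frac_fourier r f) = frac_fourier r (hermite_coeffs f)"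
  unfolding schwartz_frac_fourier_def by (intro hermite_coeffs_hermite_expansion rapidly_decreasing_frac_fourier)

lemma tame_schwartz_frac_fourier: "tame (schwartz_frac_fourier (r :: real ^ 'd::finite))"
proof (rule tameI)
  fix f :: "real ^ 'd \<Rightarrow> complex" assume "f \<in> schwartz"
  then show "smooth (schwartz_frac_fourier r f)"
    unfolding schwartz_frac_fourier_def by (intro partial_derivs_hermite_expansion rapidly_decreasing_frac_fourier)
next
  fix \<beta> :: "nat ^ 'd" and js
  obtain k K where K: "0 \<le> K" "\<And>(c :: 'd hermite_series) P x. rapidly_decreasing c \<Longrightarrow> (\<forall>\<alpha>. cmod (c \<alpha>) *
      real (Suc (mdeg \<alpha>)) ^ k \<le> P) \<Longrightarrow>
     cmod (of_real (mpow x \<beta>) * partial_derivs js (hermite_expansion c) x) \<le> K * P"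
    using hermite_expansion_bound[of \<beta> js] by blast
  obtain p where p: "seminorm_dominated p"
    "\<And>f \<alpha>. f \<in> schwartz \<Longrightarrow> cmod (hermite_coeffs f \<alpha>) * real (Suc (mdeg (\<alpha> :: nat ^ 'd))) ^ k \<le> p f"
    using hermite_coeffs_rapid_decay[of k, where 'd='d] by blast
  show "\<exists>p. seminorm_dominated p \<and> (\<forall>f\<in>schwartz. \<forall>x.
      cmod (of_real (mpow x \<beta>) * partial_derivs js (schwartz_frac_fourier r f) x) \<le> p f)"
  proof (intro exI conjI ballI allI)
    show "seminorm_dominated (\<lambda>f. K * p f)" using p(1) K(1) by (rule seminorm_dominated_cmult)
    fix f :: "real ^ 'd \<Rightarrow> complex" and x assume f: "f \<in> schwartz"
    show "cmod (of_real (mpow x \<beta>) * partial_derivs js (schwartz_frac_fourier r f) x) \<le> K * p f"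
      unfolding schwartz_frac_fourier_def
    proof (rule K(2)[OF rapidly_decreasing_frac_fourier[OF f]], rule allI)
      fix \<alpha>
      show "cmod (frac_fourier r (hermite_coeffs f) \<alpha>) * real (Suc (mdeg \<alpha>)) ^ k \<le> p f"
        using p(2)[OF f, of \<alpha>] by (simp add: frac_fourier_eq norm_mult)
    qed
  qed
qed

lemma schwartz_frac_fourier_lincomb:
  assumes f: "f \<in> schwartz" and g: "g \<in> schwartz"
  shows "schwartz_frac_fourier r (\<lambda>x. a * f x + b * g x) =
    (\<lambda>x. a * schwartz_frac_fourier r f x + b * schwartz_frac_fourier r g x)"
proof (rule ext)
  fix x
  let ?c = "frac_fourier r (hermite_coeffs f)" and ?d = "frac_fourier r (hermite_coeffs g)"
  note sf = summable_hermite_blocks[OF rapidly_decreasing_frac_fourier[OF f, of r], of "[]", simplified]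
    and sg = summable_hermite_blocks[OF rapidly_decreasing_frac_fourier[OF g, of r], of "[]", simplified]
  have c: "frac_fourier r (hermite_coeffs (\<lambda>x. a * f x + b * g x)) \<alpha> = a * ?c \<alpha> + b * ?d \<alpha>" for \<alpha>
    by (simp add: frac_fourier_eq hermite_coeffs_lincomb[OF f g] algebra_simps)
  have "schwartz_frac_fourier r (\<lambda>x. a * f x + b * g x) x =
      (\<Sum>n. a * (\<Sum>\<alpha>\<in>{\<alpha>. mdeg \<alpha> = n}. ?c \<alpha> * chermite_fun \<alpha> x) + b * (\<Sum>\<alpha>\<in>{\<alpha>. mdeg \<alpha> = n}. ?d \<alpha> * chermite_fun \<alpha> x))"
    unfolding schwartz_frac_fourier_def hermite_expansion_def c
    by (simp add: sum_distrib_left distrib_right sum.distrib mult.assoc)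
  also have "\<dots> = a * schwartz_frac_fourier r f x + b * schwartz_frac_fourier r g x"
    unfolding schwartz_frac_fourier_def hermite_expansion_def
    using sf sg by (simp add: suminf_add[symmetric] suminf_mult summable_mult)
  finally show "schwartz_frac_fourier r (\<lambda>x. a * f x + b * g x) x = a * schwartz_frac_fourier r f x + b *
      schwartz_frac_fourier r g x" .
qed

lemma schwartz_frac_fourier_chermite_fun:
  "schwartz_frac_fourier r (chermite_fun \<beta>) = (\<lambda>x. phase r \<beta> * chermite_fun \<beta> x)"
proof (rule ext)
  fix x
  have "(\<Sum>\<alpha>\<in>{\<alpha>. mdeg \<alpha> = n}. frac_fourier r (hermite_coeffs (chermite_fun \<beta>)) \<alpha> * chermite_fun \<alpha> x) =
      (if n = mdeg \<beta> then phase r \<beta> * chermite_fun \<beta> x else 0)" for n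
  proof -
    have "(\<Sum>\<alpha>\<in>{\<alpha>. mdeg \<alpha> = n}. frac_fourier r (hermite_coeffs (chermite_fun \<beta>)) \<alpha> * chermite_fun \<alpha> x) =
        (\<Sum>\<alpha>\<in>{\<alpha>. mdeg \<alpha> = n}. if \<alpha> = \<beta> then phase r \<beta> * chermite_fun \<beta> x else 0)"
      by (intro sum.cong) (auto simp: hermite_coeffs_chermite_fun hermite_term_def frac_fourier_eq)
    then show ?thesis by (simp add: finite_mdeg)
  qed
  then show "schwartz_frac_fourier r (chermite_fun \<beta>) x = phase r \<beta> * chermite_fun \<beta> x"
    by (simp add: schwartz_frac_fourier_def hermite_expansion_def suminf_delta)
qed

lemma continuous_map_schwartz_frac_fourier:
  "continuous_map schwartz_top schwartz_top (schwartz_frac_fourier (r :: real ^ 'd::finite))"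
  unfolding schwartz_top_def
proof (rule continuous_map_seminorm_topology)
  show "schwartz_frac_fourier r f \<in> schwartz" if "f \<in> schwartz" for f
    using tame_schwartz_frac_fourier that by (rule tame_schwartz)
next
  fix q and \<epsilon> :: real
  assume "q \<in> {schwartz_seminorm \<beta> js |(\<beta> :: nat ^ 'd) js. True}" and \<epsilon>: "0 < \<epsilon>"
  then obtain \<beta> js where q: "q = schwartz_seminorm \<beta> js" by blast
  have "seminorm_dominated (\<lambda>f. q (schwartz_frac_fourier r f))"
    using tame_schwartz_frac_fourier unfolding q tame_def by blast
  then obtain Q C where Q: "finite Q" "0 \<le> C" "\<And>f. f \<in> schwartz \<Longrightarrow> q (schwartz_frac_fourier r f) \<le> C *
      seminorm_sum Q f"
    unfolding seminorm_dominated_def by blast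
  \<comment> \<open>The added ones cover \<open>C = 0\<close> and \<open>Q = {}\<close>.\<close>
  define \<delta> where "\<delta> = \<epsilon> / ((C + 1) * (card Q + 1))"
  have \<delta>: "0 < \<delta>" using \<epsilon> Q(2) by (simp add: \<delta>_def)
  show "\<exists>R \<delta>. finite R \<and> R \<subseteq> {schwartz_seminorm \<beta> js |\<beta> js. True} \<and> 0 < \<delta> \<and>
      (\<forall>f\<in>schwartz. \<forall>g\<in>schwartz. (\<forall>p\<in>R. p (\<lambda>i. g i - f i) < \<delta>) \<longrightarrow>
        q (\<lambda>i. schwartz_frac_fourier r g i - schwartz_frac_fourier r f i) < \<epsilon>)"
  proof (intro exI[of _ "(\<lambda>q. schwartz_seminorm (fst q) (snd q)) ` Q"] exI[of _ \<delta>] conjI ballI impI)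
    fix f g :: "real ^ 'd \<Rightarrow> complex"
    assume fg: "f \<in> schwartz" "g \<in> schwartz"
      and small: "\<forall>p\<in>(\<lambda>q. schwartz_seminorm (fst q) (snd q)) ` Q. p (\<lambda>i. g i - f i) < \<delta>"
    have d: "(\<lambda>i. g i - f i) \<in> schwartz" using schwartz_lincomb[OF fg(2,1), of 1 "- 1"] by simp
    have "q (\<lambda>i. schwartz_frac_fourier r g i - schwartz_frac_fourier r f i) =
        q (schwartz_frac_fourier r (\<lambda>i. g i - f i))"
      using schwartz_frac_fourier_lincomb[OF fg(2,1), of r 1 "- 1"] by simp
    also have "\<dots> \<le> C * seminorm_sum Q (\<lambda>i. g i - f i)" by (rule Q(3)[OF d])
    also have "\<dots> \<le> C * (card Q * \<delta>)"
    proof (rule mult_left_mono[OF _ Q(2)])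
      have "schwartz_seminorm (fst q) (snd q) (\<lambda>i. g i - f i) \<le> \<delta>" if "q \<in> Q" for q
        using small that by (simp add: less_imp_le)
      then show "seminorm_sum Q (\<lambda>i. g i - f i) \<le> card Q * \<delta>"
        unfolding seminorm_sum_def by (rule sum_bounded_above)
    qed
    also have "\<dots> < (C + 1) * (card Q + 1) * \<delta>"
    proof -
      have "C * card Q < (C + 1) * (card Q + 1)" using Q(2) by (simp add: algebra_simps add_nonneg_pos)
      then show ?thesis using \<delta> by (simp add: mult.assoc[symmetric])
    qed
    also have "\<dots> = \<epsilon>"
    proof -
      have "(C + 1) * (card Q + 1) \<noteq> 0" using Q(2) by (simp add: add_nonneg_eq_0_iff)
      then show ?thesis by (simp add: \<delta>_def)
    qed
    finally show "q (\<lambda>i. schwartz_frac_fourier r g i - schwartz_frac_fourier r f i) < \<epsilon>" .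
  qed (use Q \<delta> in auto)
qed

lemma continuous_bijective_S_top: "continuous_bijective S_top (frac_fourier r)"
  unfolding S_top_def
  by (rule continuous_bijective_transport[OF continuous_map_schwartz_frac_fourier])
     (simp add: schwartz_top_def hermite_coeffs_schwartz_frac_fourier)

text \<open>
  The transpose for the bilinear pairing.  As the Hermite functions are eigenfunctions of the transform, their
  coefficients are multiplied by the same phases as for functions.
\<close>

definition tempered_frac_fourier ::
    "real ^ 'd::finite \<Rightarrow> ((real ^ 'd \<Rightarrow> complex) \<Rightarrow> complex) \<Rightarrow> (real ^ 'd \<Rightarrow> complex) \<Rightarrow> complex" where
  "tempered_frac_fourier r u = (\<lambda>f. if f \<in> schwartz then u (schwartz_frac_fourier r f) else 0)"

lemma tempered_linear:
  assumes "u \<in> tempered" "f \<in> schwartz" "g \<in> schwartz"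
  shows "u (\<lambda>x. a * f x + b * g x) = a * u f + b * u g"
proof -
  note lin = assms(1)[unfolded tempered_def mem_Collect_eq, THEN conjunct1]
  show ?thesis by (rule lin[THEN bspec, THEN bspec, THEN spec, THEN spec, OF assms(2,3)])
qed

lemma tempered_frac_fourier_tempered:
  assumes u: "u \<in> tempered"
  shows "tempered_frac_fourier r u \<in> tempered"
proof -
  note cont = u[unfolded tempered_def mem_Collect_eq, THEN conjunct2, THEN conjunct1]
  have "continuous_map schwartz_top euclidean (tempered_frac_fourier r u)"
    by (rule continuous_map_eq[OF continuous_map_compose[OF continuous_map_schwartz_frac_fourier cont]])
       (simp add: tempered_frac_fourier_def schwartz_top_def)
  moreover have "tempered_frac_fourier r u (\<lambda>x. a * f x + b * g x) = a * tempered_frac_fourier r u f + b *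
      tempered_frac_fourier r u g"
    if "f \<in> schwartz" "g \<in> schwartz" for f g a b
  proof -
    have "schwartz_frac_fourier r f \<in> schwartz" "schwartz_frac_fourier r g \<in> schwartz"
      using that by (auto intro: tame_schwartz[OF tame_schwartz_frac_fourier])
    from tempered_linear[OF u this, of a b] show ?thesis
      using that schwartz_lincomb[OF that]
      by (simp add: tempered_frac_fourier_def schwartz_frac_fourier_lincomb)
  qed
  moreover have "tempered_frac_fourier r u f = 0" if "f \<notin> schwartz" for f
    using that by (simp add: tempered_frac_fourier_def)
  ultimately show ?thesis
    unfolding tempered_def mem_Collect_eq by (intro conjI ballI allI impI)
qed

lemma tempered_coeffs_frac_fourier:
  assumes u: "u \<in> tempered"
  shows "tempered_coeffs (tempered_frac_fourier r u) = frac_fourier r (tempered_coeffs u)"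
proof (rule ext)
  fix \<alpha>
  have "u (\<lambda>x. phase r \<alpha> * chermite_fun \<alpha> x + 0 * chermite_fun \<alpha> x) = phase r \<alpha> * u (chermite_fun \<alpha>) + 0 *
      u (chermite_fun \<alpha>)"
    by (rule tempered_linear[OF u chermite_fun_schwartz chermite_fun_schwartz])
  then show "tempered_coeffs (tempered_frac_fourier r u) \<alpha> = frac_fourier r (tempered_coeffs u) \<alpha>"
    by (simp add: tempered_coeffs_def tempered_frac_fourier_def chermite_fun_schwartz
        schwartz_frac_fourier_chermite_fun frac_fourier_eq)
qed

lemma schwartz_bounded_image:
  assumes B: "schwartz_bounded B"
  shows "schwartz_bounded (schwartz_frac_fourier r ` B)"
  unfolding schwartz_bounded_def
proof (intro conjI allI)
  have BS: "B \<subseteq> schwartz" using B by (simp add: schwartz_bounded_def)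
  then show "schwartz_frac_fourier r ` B \<subseteq> schwartz" using tame_schwartz[OF tame_schwartz_frac_fourier] by blast
  fix \<beta> js
  obtain Q C where Q: "finite Q" "0 \<le> C" "\<And>f. f \<in> schwartz \<Longrightarrow> schwartz_seminorm \<beta> js (schwartz_frac_fourier r f) \<le>
      C * seminorm_sum Q f"
    using tame_schwartz_frac_fourier[of r] unfolding tame_def seminorm_dominated_def by blast
  have "\<forall>q. \<exists>K. \<forall>f\<in>B. schwartz_seminorm (fst q) (snd q) f \<le> K"
    using B unfolding schwartz_bounded_def bdd_above_def by auto
  then obtain K where K: "\<And>q f. f \<in> B \<Longrightarrow> schwartz_seminorm (fst q) (snd q) f \<le> K q" by metis
  show "bdd_above (schwartz_seminorm \<beta> js ` schwartz_frac_fourier r ` B)"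
    unfolding image_image
  proof (rule bdd_aboveI2)
    fix f assume f: "f \<in> B"
    have "schwartz_seminorm \<beta> js (schwartz_frac_fourier r f) \<le> C * seminorm_sum Q f" using f BS by (intro Q(3)) auto
    also have "\<dots> \<le> C * (\<Sum>q\<in>Q. K q)" unfolding seminorm_sum_def using Q(2) K[OF f] by (intro mult_left_mono sum_mono)
    finally show "schwartz_seminorm \<beta> js (schwartz_frac_fourier r f) \<le> C * (\<Sum>q\<in>Q. K q)" .
  qed
qed

text \<open>
  The image of a bounded set is bounded, so the seminorm for \<open>B\<close> pulls back exactly to the seminorm for its image.
\<close>

lemma continuous_map_tempered_strong:
  "continuous_map tempered_strong_top tempered_strong_top (tempered_frac_fourier (r :: real ^ 'd::finite))"
  unfolding tempered_strong_top_def
proof (rule continuous_map_seminorm_topology)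
  show "tempered_frac_fourier r u \<in> tempered" if "u \<in> tempered" for u using that
      by (rule tempered_frac_fourier_tempered)
next
  let ?P = "{(\<lambda>u. SUP f\<in>B. cmod (u f)) |B. schwartz_bounded B \<and> B \<noteq> {}}
    :: (((real ^ 'd \<Rightarrow> complex) \<Rightarrow> complex) \<Rightarrow> real) set"
  fix q and \<epsilon> :: real
  assume "q \<in> ?P" and \<epsilon>: "0 < \<epsilon>"
  then obtain B where B: "schwartz_bounded B" "B \<noteq> {}" and q: "q = (\<lambda>u. SUP f\<in>B. cmod (u f))" by blast
  let ?q = "\<lambda>u. SUP f\<in>schwartz_frac_fourier r ` B. cmod (u f)"
  have BS: "B \<subseteq> schwartz" using B by (simp add: schwartz_bounded_def)
  have "?q \<in> ?P" using schwartz_bounded_image[OF B(1), of r] B(2) by blast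
  moreover have "q (\<lambda>i. tempered_frac_fourier r v i - tempered_frac_fourier r u i) = ?q (\<lambda>i. v i - u i)" for u v
    unfolding q image_image using BS by (intro SUP_cong) (auto simp: tempered_frac_fourier_def)
  ultimately show "\<exists>Q \<delta>. finite Q \<and> Q \<subseteq> ?P \<and> 0 < \<delta> \<and>
      (\<forall>f\<in>tempered. \<forall>g\<in>tempered. (\<forall>p\<in>Q. p (\<lambda>i. g i - f i) < \<delta>) \<longrightarrow>
        q (\<lambda>i. tempered_frac_fourier r g i - tempered_frac_fourier r f i) < \<epsilon>)"
    using \<epsilon> by (intro exI[of _ "{?q}"] exI[of _ \<epsilon>]) simp
qed

lemma continuous_map_tempered_weak:
  "continuous_map tempered_weak_top tempered_weak_top (tempered_frac_fourier (r :: real ^ 'd::finite))"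
  unfolding tempered_weak_top_def
proof (rule continuous_map_seminorm_topology)
  show "tempered_frac_fourier r u \<in> tempered" if "u \<in> tempered" for u using that
      by (rule tempered_frac_fourier_tempered)
next
  let ?P = "{(\<lambda>u. cmod (u f)) |f. f \<in> schwartz} :: (((real ^ 'd \<Rightarrow> complex) \<Rightarrow> complex) \<Rightarrow> real) set"
  fix q and \<epsilon> :: real
  assume "q \<in> ?P" and \<epsilon>: "0 < \<epsilon>"
  then obtain f where f: "f \<in> schwartz" and q: "q = (\<lambda>u. cmod (u f))" by blast
  let ?q = "\<lambda>u. cmod (u (schwartz_frac_fourier r f))"
  have "?q \<in> ?P" using tame_schwartz[OF tame_schwartz_frac_fourier f] by blast
  moreover have "q (\<lambda>i. tempered_frac_fourier r v i - tempered_frac_fourier r u i) = ?q (\<lambda>i. v i - u i)" for u v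
    unfolding q using f by (simp add: tempered_frac_fourier_def)
  ultimately show "\<exists>Q \<delta>. finite Q \<and> Q \<subseteq> ?P \<and> 0 < \<delta> \<and>
      (\<forall>f\<in>tempered. \<forall>g\<in>tempered. (\<forall>p\<in>Q. p (\<lambda>i. g i - f i) < \<delta>) \<longrightarrow>
        q (\<lambda>i. tempered_frac_fourier r g i - tempered_frac_fourier r f i) < \<epsilon>)"
    using \<epsilon> by (intro exI[of _ "{?q}"] exI[of _ \<epsilon>]) simp
qed

lemma continuous_bijective_S_dual:
  "continuous_bijective S_dual_strong_top (frac_fourier r)"
  "continuous_bijective S_dual_weak_top (frac_fourier r)"
  unfolding S_dual_strong_top_def S_dual_weak_top_def
  by (rule continuous_bijective_transport[OF continuous_map_tempered_strong],
      simp add: tempered_strong_top_def tempered_coeffs_frac_fourier)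
     (rule continuous_bijective_transport[OF continuous_map_tempered_weak],
      simp add: tempered_weak_top_def tempered_coeffs_frac_fourier)

theorem proposition7p1:
  fixes s :: flat_real
    and r :: "real ^ 'd::finite"
    and p :: ennreal
    and \<omega> :: "(real ^ 'd) \<times> (real ^ 'd) \<Rightarrow> real"
    and \<omega>\<^sub>0 :: "real ^ 'd \<Rightarrow> real"
  assumes "s \<in> extended_flat_reals"
    and "0 < p"
    and "weight_fun \<omega>"
    and "\<And>x \<xi>. \<omega> (x, \<xi>) = \<omega>\<^sub>0 (\<chi> j. cmod (Complex (x $ j) (\<xi> $ j)))"
  shows "(continuous_bijective (Hs_top s) (frac_fourier r) \<and>
          continuous_bijective (H0s_top s) (frac_fourier r) \<and>
          continuous_bijective S_top (frac_fourier r) \<and>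
          continuous_bijective (Hs_dual_top s) (frac_fourier r) \<and>
          continuous_bijective (H0s_dual_top s) (frac_fourier r) \<and>
          continuous_bijective S_dual_strong_top (frac_fourier r) \<and>
          continuous_bijective S_dual_weak_top (frac_fourier r))
       \<and> ((\<forall>\<alpha>. frac_fourier r (hermite_term \<alpha>) =
               (\<lambda>\<beta>. exp (- \<i> * of_real (\<Sum>j\<in>UNIV. r $ j * real (\<alpha> $ j)) * of_real (pi / 2)) * hermite_term \<alpha> \<beta>)) \<and>
          (\<forall>\<alpha>. frac_fourier r (hermite_coeffs (chermite_fun \<alpha>)) =
               (\<lambda>\<beta>. exp (- \<i> * of_real (\<Sum>j\<in>UNIV. r $ j * real (\<alpha> $ j)) * of_real (pi / 2)) *
                    hermite_coeffs (chermite_fun \<alpha>) \<beta>)) \<and>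
          frac_fourier r \<circ> harmonic_osc = harmonic_osc \<circ> frac_fourier r)
       \<and> (bij_betw (frac_fourier r) (mod_space p \<omega>) (mod_space p \<omega>) \<and>
          (\<forall>f\<in>mod_space p \<omega>. mod_qnorm p \<omega> (frac_fourier r f) = mod_qnorm p \<omega> f) \<and>
          (\<forall>N::int. \<forall>f\<in>H_flat1_dual.
             mod_qnorm p \<omega> (harmonic_osc_pow N (frac_fourier r f)) = mod_qnorm p \<omega> (harmonic_osc_pow N f)))"
proof -
  have eigen: "frac_fourier r (hermite_term \<alpha>) = (\<lambda>\<beta>. phase r \<alpha> * hermite_term \<alpha> \<beta>)" for \<alpha>
    by (auto simp: frac_fourier_eq hermite_term_def)
  have norm: "mod_qnorm p \<omega> (frac_fourier r' f) = mod_qnorm p \<omega> f" for r' f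
    by (rule mod_qnorm_frac_fourier) (rule assms(4))
  have "frac_fourier r' f \<in> mod_space p \<omega>" if "f \<in> mod_space p \<omega>" for r' f
    using that unfolding mod_space_def mem_Collect_eq norm frac_fourier_H_flat1_dual .
  then have "bij_betw (frac_fourier r) (mod_space p \<omega>) (mod_space p \<omega>)"
    by (rule bij_betw_frac_fourier)
  then show ?thesis
    unfolding hermite_coeffs_chermite_fun phase_def[symmetric]
    using continuous_bijective_Pilipovic[of s r] continuous_bijective_S_top[of r] continuous_bijective_S_dual[of r]
      eigen norm
    by (simp add: fun_eq_iff frac_fourier_harmonic_osc flip: frac_fourier_harmonic_osc_pow)
qed

end
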